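(* Let $U_0\in H$, let $S(t)U_0=(\dot\varepsilon(t),\dot v(t))$, and let $\dot\omega(0)$ be a square integrable field on $\Omega$ with values in skew-symmetric $3\times3$ matrices. Define $\dot\omega_{ij}$ by integrating in time, $$\dot\omega_{ij}(t)=\dot\omega_{ij}(0)+\int_0^t\Big(\tfrac12(\partial_j\dot v_i-\partial_i\dot v_j)-\dot J_{[ij]}\Big)(s)\,ds,\qquad \dot J_{ij}=\mathbb B_{ijkl}\dot\varepsilon_{kl},$$ (in the sense of distributions on $\Omega$). Then $(S(t)U_0,\dot\omega)$ is the unique weak solution, with initial data $(U_0,\dot\omega(0))$, of $$\partial_t\dot\varepsilon_{ij}=\tfrac12(\partial_j\dot v_i+\partial_i\dot v_j)-\dot J_{(ij)},\qquad \rho\,\partial_t\dot v_i=\partial_j(\mathbb C_{ijkl}\dot\varepsilon_{kl}),\qquad \partial_t\dot\omega_{ij}=\tfrac12(\partial_j\dot v_i-\partial_i\dot v_j)-\dot J_{[ij]}$$ in $\Omega$, with boundary conditions $\dot v_i=0$ on $\partial\Omega_1$ and $\mathbb C_{ijkl}\dot\varepsilon_{kl}n_j=0$ on $\partial\Omega_2$.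
   Context: Conventions: indices run over $1,2,3$, repeated indices are summed, $e_{ijk}$ is the permutation symbol, $\partial_j=\partial/\partial x_j$; $A_{\ldots(ij)\ldots}=\frac12(A_{\ldots ij\ldots}+A_{\ldots ji\ldots})$ and $A_{\ldots[ij]\ldots}=\frac12(A_{\ldots ij\ldots}-A_{\ldots ji\ldots})$. Domain: $\Omega\subset\mathbb R^3$ is open, bounded, connected, with $C^1$ boundary $\partial\Omega$ and outward unit normal $n$. $\partial\Omega_1,\partial\Omega_2\subset\partial\Omega$ are fixed disjoint measurable subsets whose union is $\partial\Omega$ up to a set of surface measure zero. Coefficients: $\rho>0$ is a constant. $\mathbb C_{ijkl}$ is real, continuous on $\overline\Omega$, with $\mathbb C_{ijkl}=\mathbb C_{jikl}=\mathbb C_{ijlk}=\mathbb C_{klij}$ and $\mathbb C_{ijkl}\varepsilon_{ij}\varepsilon_{kl}\ge a_0\varepsilon_{ij}\varepsilon_{ij}$ for all symmetric $\varepsilon$, with a constant $a_0>0$. $\alpha_{ij}$ is a real time-independent tensor field, continuous on $\overline\Omega$, of the form $\alpha_{ir}=e_{rjk}\partial_j\omega^0_{ik}$ for a skew-symmetric tensor field $\omega^0$ (a stress-free base state). Put $$\mathbb B_{ijkl}=e_{sjr}\alpha_{ir}\,e_{smn}\alpha_{pn}\,\mathbb C_{pmkl}.$$ Spaces: $H^0(\Omega)$ is the space of square integrable fields $\varepsilon:\Omega\to\mathbb R^{3\times3}_{sym}$; $L^2(\Omega)$ is the space of square integrable $v:\Omega\to\mathbb R^3$; $H^1(\Omega)$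 is the usual Sobolev space of $\mathbb R^3$-valued fields; $\widehat H^1(\Omega)=\{v\in H^1(\Omega): v=0\text{ a.e. on }\partial\Omega_1\}$. $H=H^0(\Omega)\times L^2(\Omega)$ is a Hilbert space with inner product $$\langle(\varepsilon,v),(\bar\varepsilon,\bar v)\rangle_H=\int_\Omega \mathbb C_{ijkl}\varepsilon_{kl}\bar\varepsilon_{ij}+\rho v_i\bar v_i\,dx.$$ Operator: for $U=(\varepsilon,v)$, $$AU=\Big(\partial_{(j}v_{i)}-\mathbb B_{(ij)(kl)}\varepsilon_{kl},\ \tfrac1\rho\partial_j(\mathbb C_{ijkl}\varepsilon_{kl})\Big),$$ $$D(A)=\{(\varepsilon,v)\in H: v\in\widehat H^1(\Omega),\ \partial_j(\mathbb C_{ijkl}\varepsilon_{kl})\in L^2(\Omega),\ \mathbb C_{ijkl}\varepsilon_{kl}n_j=0\text{ on }\partial\Omega_2\},$$ where the condition on $\partial\Omega_2$ is understood in the weak (trace) sense $\int_\Omega \partial_j\bar v_i\,\mathbb C_{ijkl}\varepsilon_{kl}+\bar v_i\,\partial_j(\mathbb C_{ijkl}\varepsilon_{kl})\,dx=0$ for all $\bar v\in\widehat H^1(\Omega)$. $A$ generates a $C^0$ semigroup of contractions on $H$, denoted $S(t)$. Weak solution: the first two equations are $\partial_tU=AU$, $U=(\dot\varepsilon,\dot v)$; a weak solution of them with datum $U_0$ is $U\in C([0,\infty);H)$ with $U(0)=U_0$ such that for every $W\in D(A^* )$ the function $t\mapsto\langle U(t),W\rangle_H$ is locally absolutely continuous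 and $\frac{d}{dt}\langle U(t),W\rangle_H=\langle U(t),A^*W\rangle_H$ for a.e. $t$. A weak solution of the full system is a pair $(U,\dot\omega)$ with $U$ such a weak solution and $\dot\omega_{ij}(t)$, $t\ge0$, distributions on $\Omega$ with the prescribed value at $t=0$, such that for every $w\in C_0^\infty(\Omega)$ the function $t\mapsto\langle\dot\omega_{ij}(t),w\rangle$ is $C^1$ on $[0,\infty)$ and the third equation holds when tested against $w$, for every $t\ge 0$. *)

theory Defs
  imports "HOL-Analysis.Analysis"
begin

section \<open>Fields on a domain\<close>

text \<open>Square integrable fields are represented by functions; two of them denote the same element
  of the \<open>L\<^sup>2\<close> space iff they are related by \<open>ae_eq\<close>.  Values outside \<open>\<Omega>\<close> are irrelevant.\<close>

type_synonym space = "real^3"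

type_synonym state = "space \<Rightarrow> (real^3^3) \<times> (real^3)"

definition ae_eq :: "space set \<Rightarrow> (space \<Rightarrow> 'b) \<Rightarrow> (space \<Rightarrow> 'b) \<Rightarrow> bool" where
  "ae_eq \<Omega> f g \<longleftrightarrow> (AE x in lebesgue_on \<Omega>. f x = g x)"

definition L2 :: "space set \<Rightarrow> (space \<Rightarrow> 'b::euclidean_space) set" where
  "L2 \<Omega> = {f. f \<in> borel_measurable (lebesgue_on \<Omega>) \<and> integrable (lebesgue_on \<Omega>) (\<lambda>x. (norm (f x))\<^sup>2)}"

definition pd :: "3 \<Rightarrow> (space \<Rightarrow> real) \<Rightarrow> space \<Rightarrow> real" where
  "pd j f x = frechet_derivative f (at x) (axis j 1)"

primrec iter_pd :: "3 list \<Rightarrow> (space \<Rightarrow> real) \<Rightarrow> space \<Rightarrow> real" where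
  "iter_pd [] f = f"
| "iter_pd (j # js) f = pd j (iter_pd js f)"

definition smooth :: "(space \<Rightarrow> real) \<Rightarrow> bool" where
  "smooth f \<longleftrightarrow> (\<forall>js x. iter_pd js f differentiable (at x))"

definition supp :: "(space \<Rightarrow> real) \<Rightarrow> space set" where
  "supp w = closure {x. w x \<noteq> 0}"

text \<open>The space \<open>C\<^sub>0\<^sup>\<infinity>(\<Omega>)\<close>, its elements being extended by zero to the whole space.\<close>

definition test_fun :: "space set \<Rightarrow> (space \<Rightarrow> real) set" where
  "test_fun \<Omega> = {w. smooth w \<and> compact (supp w) \<and> supp w \<subseteq> \<Omega>}"

section \<open>Weak derivatives and Sobolev spaces\<close>

definition is_weak_pd :: "space set \<Rightarrow> 3 \<Rightarrow> (space \<Rightarrow> real) \<Rightarrow> (space \<Rightarrow> real) \<Rightarrow> bool" where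
  "is_weak_pd \<Omega> j f g \<longleftrightarrow>
     (\<forall>w\<in>test_fun \<Omega>. (\<integral>x. f x * pd j w x \<partial>lebesgue_on \<Omega>) = - (\<integral>x. g x * w x \<partial>lebesgue_on \<Omega>))"

definition is_weak_div :: "space set \<Rightarrow> (space \<Rightarrow> real^3) \<Rightarrow> (space \<Rightarrow> real) \<Rightarrow> bool" where
  "is_weak_div \<Omega> F g \<longleftrightarrow>
     (\<forall>w\<in>test_fun \<Omega>. (\<integral>x. (\<Sum>j\<in>UNIV. F x $ j * pd j w x) \<partial>lebesgue_on \<Omega>)
        = - (\<integral>x. g x * w x \<partial>lebesgue_on \<Omega>))"

text \<open>The \<open>L\<^sup>2\<close> representatives chosen below are unique up to \<open>ae_eq\<close>; they are used only for fields
  whose weak derivative or divergence in \<open>L\<^sup>2\<close> exists.\<close>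

definition wpd :: "space set \<Rightarrow> 3 \<Rightarrow> (space \<Rightarrow> real) \<Rightarrow> space \<Rightarrow> real" where
  "wpd \<Omega> j f = (SOME g. g \<in> L2 \<Omega> \<and> is_weak_pd \<Omega> j f g)"

definition wdiv :: "space set \<Rightarrow> (space \<Rightarrow> real^3) \<Rightarrow> space \<Rightarrow> real" where
  "wdiv \<Omega> F = (SOME g. g \<in> L2 \<Omega> \<and> is_weak_div \<Omega> F g)"

definition H1_scalar :: "space set \<Rightarrow> (space \<Rightarrow> real) set" where
  "H1_scalar \<Omega> = {u \<in> L2 \<Omega>. \<forall>j. \<exists>g\<in>L2 \<Omega>. is_weak_pd \<Omega> j u g}"

definition H1 :: "space set \<Rightarrow> (space \<Rightarrow> real^3) set" where
  "H1 \<Omega> = {v \<in> L2 \<Omega>. \<forall>i. (\<lambda>x. v x $ i) \<in> H1_scalar \<Omega>}"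

section \<open>The boundary\<close>

definition C1_fun :: "(space \<Rightarrow> real) \<Rightarrow> bool" where
  "C1_fun f \<longleftrightarrow> (\<forall>x. f differentiable (at x)) \<and> (\<forall>j. continuous_on UNIV (pd j f))"

text \<open>Near each boundary point \<open>\<Omega>\<close> is the region above the graph of a \<open>C\<^sup>1\<close> function \<open>\<gamma>\<close> over the
  plane orthogonal to a unit vector \<open>u\<close>; only the restriction of \<open>\<gamma>\<close> to that plane enters.\<close>

definition C1_boundary :: "space set \<Rightarrow> bool" where
  "C1_boundary \<Omega> \<longleftrightarrow>
     (\<forall>p\<in>frontier \<Omega>. \<exists>r>0. \<exists>u \<gamma>. norm u = 1 \<and> C1_fun \<gamma> \<and>
        \<Omega> \<inter> ball p r = {x \<in> ball p r. \<gamma> (x - (x \<bullet> u) *\<^sub>R u) < x \<bullet> u})"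

text \<open>Two-dimensional Hausdorff outer measure; the factor \<open>pi / 4\<close> makes it agree with the area on
  planes.\<close>

definition hausdorff2_pre :: "real \<Rightarrow> space set \<Rightarrow> ennreal" where
  "hausdorff2_pre \<delta> E =
     (INF A\<in>{A :: nat \<Rightarrow> space set. E \<subseteq> (\<Union>n. A n) \<and> (\<forall>n. bounded (A n) \<and> diameter (A n) \<le> \<delta>)}.
        \<Sum>n. ennreal (pi / 4 * (diameter (A n))\<^sup>2))"

definition hausdorff2 :: "space set \<Rightarrow> ennreal" where
  "hausdorff2 E = (SUP \<delta>\<in>{0<..}. hausdorff2_pre \<delta> E)"

lemma hausdorff2_pre_mono: "E \<subseteq> F \<Longrightarrow> hausdorff2_pre \<delta> E \<le> hausdorff2_pre \<delta> F"
  unfolding hausdorff2_pre_def by (rule INF_superset_mono) auto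

lemma hausdorff2_pre_subadditive:
  "hausdorff2_pre \<delta> (\<Union>i. E i) \<le> (\<Sum>i. hausdorff2_pre \<delta> (E i))"
proof (rule ennreal_le_epsilon)
  fix e :: real assume "0 < e" and fin: "(\<Sum>i. hausdorff2_pre \<delta> (E i)) < top"
  let ?f = "\<lambda>A :: space set. ennreal (pi / 4 * (diameter A)\<^sup>2)"
  have "\<exists>A. E i \<subseteq> (\<Union>n. A n) \<and> (\<forall>n. bounded (A n) \<and> diameter (A n) \<le> \<delta>) \<and>
      (\<Sum>n. ?f (A n)) \<le> hausdorff2_pre \<delta> (E i) + ennreal (e * (1/2) ^ Suc i)" for i
  proof -
    have "hausdorff2_pre \<delta> (E i) \<noteq> top"
      using ennreal_suminf_lessD[OF fin, of i] by auto
    then have "hausdorff2_pre \<delta> (E i) < hausdorff2_pre \<delta> (E i) + ennreal (e * (1/2) ^ Suc i)"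
      using \<open>0 < e\<close> by (simp add: ennreal_add_less_top ennreal_less_zero_iff less_top)
    then show ?thesis
      unfolding hausdorff2_pre_def[of \<delta> "E i"] INF_less_iff by (auto intro: less_imp_le)
  qed
  then obtain A where A: "\<And>i. E i \<subseteq> (\<Union>n. A i n)"
    "\<And>i n. bounded (A i n) \<and> diameter (A i n) \<le> \<delta>"
    "\<And>i. (\<Sum>n. ?f (A i n)) \<le> hausdorff2_pre \<delta> (E i) + ennreal (e * (1/2) ^ Suc i)"
    by metis
  let ?B = "\<lambda>k. case_prod A (prod_decode k)"
  have "x \<in> (\<Union>k. ?B k)" if x: "x \<in> (\<Union>i. E i)" for x
  proof -
    from x A(1) obtain i n where "x \<in> A i n" by blast
    then have "x \<in> ?B (prod_encode (i, n))" by simp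
    then show ?thesis by (rule UN_I[OF UNIV_I])
  qed
  then have "(\<Union>i. E i) \<subseteq> (\<Union>k. ?B k)" by (rule subsetI)
  then have "hausdorff2_pre \<delta> (\<Union>i. E i) \<le> (\<Sum>k. ?f (?B k))"
    unfolding hausdorff2_pre_def using A(2)
    by (intro INF_lower) (auto split: prod.split)
  also have "\<dots> = (\<Sum>i. \<Sum>n. ?f (A i n))"
    by (rule trans[OF _ suminf_ennreal_2dimen[where f="\<lambda>(i,n). ?f (A i n)"]])
       (auto split: prod.split simp: o_def intro!: arg_cong[where f=suminf])
  also have "\<dots> \<le> (\<Sum>i. hausdorff2_pre \<delta> (E i) + ennreal (e * (1/2) ^ Suc i))"
    using A(3) by (intro suminf_le) auto
  also have "\<dots> = (\<Sum>i. hausdorff2_pre \<delta> (E i)) + (\<Sum>i. ennreal (e * (1/2) ^ Suc i))"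
    by (rule suminf_add[symmetric]) auto
  also have "(\<Sum>i. ennreal (e * (1/2) ^ Suc i)) = ennreal e"
  proof -
    have "(\<lambda>i. e * (1/2) ^ Suc i) sums (e * 1)"
      by (rule sums_mult) (rule power_half_series)
    then show ?thesis using \<open>0 < e\<close>
      by (intro suminf_ennreal_eq) auto
  qed
  finally show "hausdorff2_pre \<delta> (\<Union>i. E i) \<le> (\<Sum>i. hausdorff2_pre \<delta> (E i)) + ennreal e" .
qed

lemma outer_measure_space_hausdorff2: "outer_measure_space UNIV hausdorff2"
proof -
  have "hausdorff2_pre \<delta> {} = 0" if "\<delta> > 0" for \<delta>
  proof -
    have "hausdorff2_pre \<delta> {} \<le> (\<Sum>n. ennreal (pi / 4 * (diameter ((\<lambda>_. {}) n :: space set))\<^sup>2))"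
      unfolding hausdorff2_pre_def using that by (intro INF_lower) auto
    then show ?thesis by simp
  qed
  then have "hausdorff2 {} = 0"
    unfolding hausdorff2_def by (simp add: SUP_eq_const)
  moreover have "hausdorff2 E \<le> hausdorff2 F" if "E \<subseteq> F" for E F
    unfolding hausdorff2_def using that by (intro SUP_mono) (auto intro: hausdorff2_pre_mono)
  moreover have "hausdorff2 (\<Union>i. E i) \<le> (\<Sum>i. hausdorff2 (E i))" for E :: "nat \<Rightarrow> space set"
  proof -
    have "hausdorff2_pre \<delta> (\<Union>i. E i) \<le> (\<Sum>i. hausdorff2 (E i))" if "\<delta> > 0" for \<delta>
    proof -
      have "(\<Sum>i. hausdorff2_pre \<delta> (E i)) \<le> (\<Sum>i. hausdorff2 (E i))"
        unfolding hausdorff2_def using that by (intro suminf_le SUP_upper) auto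
      then show ?thesis using hausdorff2_pre_subadditive order_trans by blast
    qed
    then show ?thesis unfolding hausdorff2_def[of "\<Union>i. E i"] by (intro SUP_least) auto
  qed
  ultimately show ?thesis
    unfolding outer_measure_space_def positive_def increasing_def countably_subadditive_def by auto
qed

text \<open>The measure obtained from \<open>hausdorff2\<close> on its Caratheodory-measurable sets; the next lemma makes
  sure that \<open>measure_of\<close> does not degenerate.\<close>

lemma emeasure_hausdorff2:
  assumes "A \<in> lambda_system UNIV UNIV hausdorff2"
  shows "emeasure (measure_of UNIV (lambda_system UNIV UNIV hausdorff2) hausdorff2) A = hausdorff2 A"
proof -
  interpret sigma_algebra UNIV "UNIV :: space set set"
    using sigma_algebra_Pow[of "UNIV :: space set"] by simp
  have "measure_space UNIV (lambda_system UNIV UNIV hausdorff2) hausdorff2"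
    by (rule caratheodory_lemma[OF outer_measure_space_hausdorff2])
  then show ?thesis
    using assms by (intro emeasure_measure_of_sigma) (auto simp: measure_space_def)
qed

definition surface_measure :: "space set \<Rightarrow> space measure" where
  "surface_measure \<Omega> =
     restrict_space (measure_of UNIV (lambda_system UNIV UNIV hausdorff2) hausdorff2) (frontier \<Omega>)"

text \<open>The trace of \<open>u \<in> H\<^sup>1(\<Omega>)\<close> on \<open>\<partial>\<Omega>\<close>: the \<open>L\<^sup>2(\<partial>\<Omega>)\<close>-limit of the boundary values of smooth functions
  that converge to \<open>u\<close> in \<open>H\<^sup>1(\<Omega>)\<close>.\<close>

definition is_trace :: "space set \<Rightarrow> (space \<Rightarrow> real) \<Rightarrow> (space \<Rightarrow> real) \<Rightarrow> bool" where
  "is_trace \<Omega> u g \<longleftrightarrow> g \<in> borel_measurable (surface_measure \<Omega>) \<and>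
     (\<exists>\<phi> :: nat \<Rightarrow> space \<Rightarrow> real. (\<forall>n. smooth (\<phi> n)) \<and>
        (\<lambda>n. \<integral>x. (\<phi> n x - u x)\<^sup>2 \<partial>lebesgue_on \<Omega>) \<longlonglongrightarrow> 0 \<and>
        (\<forall>j. (\<lambda>n. \<integral>x. (pd j (\<phi> n) x - wpd \<Omega> j u x)\<^sup>2 \<partial>lebesgue_on \<Omega>) \<longlonglongrightarrow> 0) \<and>
        (\<lambda>n. \<integral>\<^sup>+x. ennreal ((\<phi> n x - g x)\<^sup>2) \<partial>surface_measure \<Omega>) \<longlonglongrightarrow> 0)"

definition H1_hat :: "space set \<Rightarrow> space set \<Rightarrow> (space \<Rightarrow> real^3) set" where
  "H1_hat \<Omega> \<Gamma>1 = {v \<in> H1 \<Omega>. \<forall>i. \<exists>g. is_trace \<Omega> (\<lambda>x. v x $ i) g \<and>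
     (AE x in surface_measure \<Omega>. x \<in> \<Gamma>1 \<longrightarrow> g x = 0)}"

section \<open>Coefficients\<close>

definition perm_symbol :: "3 \<Rightarrow> 3 \<Rightarrow> 3 \<Rightarrow> real" where
  "perm_symbol i j k =
     (if (i, j, k) \<in> {(1, 2, 3), (2, 3, 1), (3, 1, 2)} then 1
      else if (i, j, k) \<in> {(3, 2, 1), (1, 3, 2), (2, 1, 3)} then - 1 else 0)"

type_synonym tensor4 = "3 \<Rightarrow> 3 \<Rightarrow> 3 \<Rightarrow> 3 \<Rightarrow> real"

definition elasticity_tensor :: "space set \<Rightarrow> (space \<Rightarrow> tensor4) \<Rightarrow> bool" where
  "elasticity_tensor \<Omega> C \<longleftrightarrow>
     (\<forall>i j k l. continuous_on (closure \<Omega>) (\<lambda>x. C x i j k l)) \<and>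
     (\<forall>x\<in>closure \<Omega>. \<forall>i j k l.
        C x i j k l = C x j i k l \<and> C x i j k l = C x i j l k \<and> C x i j k l = C x k l i j) \<and>
     (\<exists>a0>0. \<forall>x\<in>closure \<Omega>. \<forall>e :: real^3^3. transpose e = e \<longrightarrow>
        (\<Sum>i\<in>UNIV. \<Sum>j\<in>UNIV. \<Sum>k\<in>UNIV. \<Sum>l\<in>UNIV. C x i j k l * e $ i $ j * e $ k $ l)
          \<ge> a0 * (\<Sum>i\<in>UNIV. \<Sum>j\<in>UNIV. e $ i $ j * e $ i $ j))"

definition stress_free_base :: "space set \<Rightarrow> (space \<Rightarrow> real^3^3) \<Rightarrow> bool" where
  "stress_free_base \<Omega> \<alpha> \<longleftrightarrow>
     (\<exists>\<omega>b :: space \<Rightarrow> real^3^3. \<forall>x\<in>\<Omega>. \<omega>b differentiable (at x) \<and> transpose (\<omega>b x) = - \<omega>b x \<and>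
        (\<forall>i r. \<alpha> x $ i $ r =
           (\<Sum>j\<in>UNIV. \<Sum>k\<in>UNIV. perm_symbol r j k * pd j (\<lambda>y. \<omega>b y $ i $ k) x)))"

definition Btens :: "(space \<Rightarrow> tensor4) \<Rightarrow> (space \<Rightarrow> real^3^3) \<Rightarrow> space \<Rightarrow> tensor4" where
  "Btens C \<alpha> x i j k l =
     (\<Sum>s\<in>UNIV. \<Sum>r\<in>UNIV. \<Sum>m\<in>UNIV. \<Sum>n\<in>UNIV. \<Sum>p\<in>UNIV.
        perm_symbol s j r * \<alpha> x $ i $ r * (perm_symbol s m n * \<alpha> x $ p $ n) * C x p m k l)"

definition Bsym :: "(space \<Rightarrow> tensor4) \<Rightarrow> (space \<Rightarrow> real^3^3) \<Rightarrow> space \<Rightarrow> tensor4" where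
  "Bsym C \<alpha> x i j k l =
     (Btens C \<alpha> x i j k l + Btens C \<alpha> x j i k l + Btens C \<alpha> x i j l k + Btens C \<alpha> x j i l k) / 4"

definition stress :: "(space \<Rightarrow> tensor4) \<Rightarrow> (space \<Rightarrow> real^3^3) \<Rightarrow> space \<Rightarrow> real^3^3" where
  "stress C \<epsilon> x = (\<chi> i j. \<Sum>k\<in>UNIV. \<Sum>l\<in>UNIV. C x i j k l * \<epsilon> x $ k $ l)"

definition flux :: "(space \<Rightarrow> tensor4) \<Rightarrow> (space \<Rightarrow> real^3^3) \<Rightarrow> (space \<Rightarrow> real^3^3) \<Rightarrow> space \<Rightarrow> real^3^3" where
  "flux C \<alpha> \<epsilon> x = (\<chi> i j. \<Sum>k\<in>UNIV. \<Sum>l\<in>UNIV. Btens C \<alpha> x i j k l * \<epsilon> x $ k $ l)"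

section \<open>The Hilbert space and the operator\<close>

definition strain :: "state \<Rightarrow> space \<Rightarrow> real^3^3" where
  "strain U x = fst (U x)"

definition velocity :: "state \<Rightarrow> space \<Rightarrow> real^3" where
  "velocity U x = snd (U x)"

definition H0 :: "space set \<Rightarrow> (space \<Rightarrow> real^3^3) set" where
  "H0 \<Omega> = {\<epsilon> \<in> L2 \<Omega>. AE x in lebesgue_on \<Omega>. transpose (\<epsilon> x) = \<epsilon> x}"

definition Hspace :: "space set \<Rightarrow> state set" where
  "Hspace \<Omega> = {U. strain U \<in> H0 \<Omega> \<and> velocity U \<in> L2 \<Omega>}"

definition H_inner :: "space set \<Rightarrow> real \<Rightarrow> (space \<Rightarrow> tensor4) \<Rightarrow> state \<Rightarrow> state \<Rightarrow> real" where
  "H_inner \<Omega> \<rho> C U V =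
     (\<integral>x. (\<Sum>i\<in>UNIV. \<Sum>j\<in>UNIV. stress C (strain U) x $ i $ j * strain V x $ i $ j)
           + \<rho> * (\<Sum>i\<in>UNIV. velocity U x $ i * velocity V x $ i) \<partial>lebesgue_on \<Omega>)"

definition H_norm :: "space set \<Rightarrow> real \<Rightarrow> (space \<Rightarrow> tensor4) \<Rightarrow> state \<Rightarrow> real" where
  "H_norm \<Omega> \<rho> C U = sqrt (H_inner \<Omega> \<rho> C U U)"

definition op_A :: "space set \<Rightarrow> real \<Rightarrow> (space \<Rightarrow> tensor4) \<Rightarrow> (space \<Rightarrow> real^3^3) \<Rightarrow> state \<Rightarrow> state" where
  "op_A \<Omega> \<rho> C \<alpha> U = (\<lambda>x.
     ((\<chi> i j. (wpd \<Omega> j (\<lambda>y. velocity U y $ i) x + wpd \<Omega> i (\<lambda>y. velocity U y $ j) x) / 2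
            - (\<Sum>k\<in>UNIV. \<Sum>l\<in>UNIV. Bsym C \<alpha> x i j k l * strain U x $ k $ l)),
      (\<chi> i. 1 / \<rho> * wdiv \<Omega> (\<lambda>y. stress C (strain U) y $ i) x)))"

text \<open>The last condition is the weak form of the traction condition on \<open>\<partial>\<Omega>\<^sub>2\<close>.\<close>

definition dom_A :: "space set \<Rightarrow> space set \<Rightarrow> (space \<Rightarrow> tensor4) \<Rightarrow> state set" where
  "dom_A \<Omega> \<Gamma>1 C = {U \<in> Hspace \<Omega>. velocity U \<in> H1_hat \<Omega> \<Gamma>1 \<and>
     (\<forall>i. \<exists>g\<in>L2 \<Omega>. is_weak_div \<Omega> (\<lambda>x. stress C (strain U) x $ i) g) \<and>
     (\<forall>v\<in>H1_hat \<Omega> \<Gamma>1.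
        (\<integral>x. (\<Sum>i\<in>UNIV. \<Sum>j\<in>UNIV. wpd \<Omega> j (\<lambda>y. v y $ i) x * stress C (strain U) x $ i $ j)
            + (\<Sum>i\<in>UNIV. v x $ i * wdiv \<Omega> (\<lambda>y. stress C (strain U) y $ i) x)
          \<partial>lebesgue_on \<Omega>) = 0)}"

definition adjoint_pair ::
    "space set \<Rightarrow> space set \<Rightarrow> real \<Rightarrow> (space \<Rightarrow> tensor4) \<Rightarrow> (space \<Rightarrow> real^3^3) \<Rightarrow> state \<Rightarrow> state \<Rightarrow> bool" where
  "adjoint_pair \<Omega> \<Gamma>1 \<rho> C \<alpha> W Z \<longleftrightarrow> W \<in> Hspace \<Omega> \<and> Z \<in> Hspace \<Omega> \<and>
     (\<forall>U\<in>dom_A \<Omega> \<Gamma>1 C. H_inner \<Omega> \<rho> C (op_A \<Omega> \<rho> C \<alpha> U) W = H_inner \<Omega> \<rho> C U Z)"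

definition dom_A_adj ::
    "space set \<Rightarrow> space set \<Rightarrow> real \<Rightarrow> (space \<Rightarrow> tensor4) \<Rightarrow> (space \<Rightarrow> real^3^3) \<Rightarrow> state set" where
  "dom_A_adj \<Omega> \<Gamma>1 \<rho> C \<alpha> = {W. \<exists>Z. adjoint_pair \<Omega> \<Gamma>1 \<rho> C \<alpha> W Z}"

definition op_A_adj ::
    "space set \<Rightarrow> space set \<Rightarrow> real \<Rightarrow> (space \<Rightarrow> tensor4) \<Rightarrow> (space \<Rightarrow> real^3^3) \<Rightarrow> state \<Rightarrow> state" where
  "op_A_adj \<Omega> \<Gamma>1 \<rho> C \<alpha> W = (SOME Z. adjoint_pair \<Omega> \<Gamma>1 \<rho> C \<alpha> W Z)"

section \<open>Semigroups on the Hilbert space\<close>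

definition C0_contraction_semigroup ::
    "space set \<Rightarrow> real \<Rightarrow> (space \<Rightarrow> tensor4) \<Rightarrow> (real \<Rightarrow> state \<Rightarrow> state) \<Rightarrow> bool" where
  "C0_contraction_semigroup \<Omega> \<rho> C S \<longleftrightarrow>
     (\<forall>t\<ge>0. \<forall>U\<in>Hspace \<Omega>. S t U \<in> Hspace \<Omega>) \<and>
     (\<forall>t\<ge>0. \<forall>U\<in>Hspace \<Omega>. \<forall>V\<in>Hspace \<Omega>. \<forall>a b.
        ae_eq \<Omega> (S t (\<lambda>x. a *\<^sub>R U x + b *\<^sub>R V x)) (\<lambda>x. a *\<^sub>R S t U x + b *\<^sub>R S t V x)) \<and>
     (\<forall>U\<in>Hspace \<Omega>. ae_eq \<Omega> (S 0 U) U) \<and>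
     (\<forall>s\<ge>0. \<forall>t\<ge>0. \<forall>U\<in>Hspace \<Omega>. ae_eq \<Omega> (S (s + t) U) (S s (S t U))) \<and>
     (\<forall>U\<in>Hspace \<Omega>. ((\<lambda>t. H_norm \<Omega> \<rho> C (\<lambda>x. S t U x - U x)) \<longlongrightarrow> 0) (at_right 0)) \<and>
     (\<forall>t\<ge>0. \<forall>U\<in>Hspace \<Omega>. H_norm \<Omega> \<rho> C (S t U) \<le> H_norm \<Omega> \<rho> C U)"

text \<open>\<open>dom_A\<close> is exactly the set of states at which the difference quotient at time zero converges
  in the Hilbert space, and \<open>op_A\<close> is the limit.\<close>

definition generated_by_A ::
    "space set \<Rightarrow> space set \<Rightarrow> real \<Rightarrow> (space \<Rightarrow> tensor4) \<Rightarrow> (space \<Rightarrow> real^3^3) \<Rightarrow> (real \<Rightarrow> state \<Rightarrow> state) \<Rightarrow> bool"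
    where
  "generated_by_A \<Omega> \<Gamma>1 \<rho> C \<alpha> S \<longleftrightarrow>
     (\<forall>U\<in>Hspace \<Omega>. \<forall>F\<in>Hspace \<Omega>.
        ((\<lambda>t. H_norm \<Omega> \<rho> C (\<lambda>x. (1 / t) *\<^sub>R (S t U x - U x) - F x)) \<longlongrightarrow> 0) (at_right 0)
        \<longleftrightarrow> U \<in> dom_A \<Omega> \<Gamma>1 C \<and> ae_eq \<Omega> F (op_A \<Omega> \<rho> C \<alpha> U))"

section \<open>Weak solutions\<close>

definition abs_cont_on :: "real \<Rightarrow> real \<Rightarrow> (real \<Rightarrow> real) \<Rightarrow> bool" where
  "abs_cont_on a b f \<longleftrightarrow>
     (\<forall>e>0. \<exists>d>0. \<forall>(N::nat) p q.
        (\<forall>k<N. a \<le> p k \<and> p k \<le> q k \<and> q k \<le> b) \<and>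
        (\<forall>k<N. \<forall>l<N. k \<noteq> l \<longrightarrow> {p k<..<q k} \<inter> {p l<..<q l} = {}) \<and>
        (\<Sum>k<N. q k - p k) < d
        \<longrightarrow> (\<Sum>k<N. \<bar>f (q k) - f (p k)\<bar>) < e)"

definition weak_evolution ::
    "space set \<Rightarrow> space set \<Rightarrow> real \<Rightarrow> (space \<Rightarrow> tensor4) \<Rightarrow> (space \<Rightarrow> real^3^3)
      \<Rightarrow> state \<Rightarrow> (real \<Rightarrow> state) \<Rightarrow> bool" where
  "weak_evolution \<Omega> \<Gamma>1 \<rho> C \<alpha> U0 U \<longleftrightarrow>
     (\<forall>t\<ge>0. U t \<in> Hspace \<Omega>) \<and>
     (\<forall>t\<ge>0. ((\<lambda>s. H_norm \<Omega> \<rho> C (\<lambda>x. U s x - U t x)) \<longlongrightarrow> 0) (at t within {0..})) \<and>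
     ae_eq \<Omega> (U 0) U0 \<and>
     (\<forall>W\<in>dom_A_adj \<Omega> \<Gamma>1 \<rho> C \<alpha>.
        (\<forall>a b. 0 \<le> a \<and> a \<le> b \<longrightarrow> abs_cont_on a b (\<lambda>t. H_inner \<Omega> \<rho> C (U t) W)) \<and>
        (AE t in lebesgue_on {0<..}.
           ((\<lambda>s. H_inner \<Omega> \<rho> C (U s) W) has_real_derivative
              H_inner \<Omega> \<rho> C (U t) (op_A_adj \<Omega> \<Gamma>1 \<rho> C \<alpha> W)) (at t)))"

text \<open>Distributions on \<open>\<Omega>\<close> are functionals whose values off \<open>test_fun \<Omega>\<close> are irrelevant.\<close>

type_synonym distr = "(space \<Rightarrow> real) \<Rightarrow> real"

definition distribution_on :: "space set \<Rightarrow> distr \<Rightarrow> bool" where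
  "distribution_on \<Omega> T \<longleftrightarrow>
     (\<forall>w\<in>test_fun \<Omega>. \<forall>z\<in>test_fun \<Omega>. \<forall>a b. T (\<lambda>x. a * w x + b * z x) = a * T w + b * T z) \<and>
     (\<forall>K. compact K \<and> K \<subseteq> \<Omega> \<longrightarrow>
        (\<exists>c N. \<forall>w\<in>test_fun \<Omega>. supp w \<subseteq> K \<longrightarrow>
           \<bar>T w\<bar> \<le> c * (\<Sum>js\<in>{js. length js \<le> N}. SUP x. \<bar>iter_pd js w x\<bar>)))"

definition distr_of :: "space set \<Rightarrow> (space \<Rightarrow> real) \<Rightarrow> distr" where
  "distr_of \<Omega> f w = (\<integral>x. f x * w x \<partial>lebesgue_on \<Omega>)"

definition distr_pd :: "3 \<Rightarrow> distr \<Rightarrow> distr" where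
  "distr_pd j T w = - T (pd j w)"

definition spin_rate ::
    "space set \<Rightarrow> (space \<Rightarrow> tensor4) \<Rightarrow> (space \<Rightarrow> real^3^3) \<Rightarrow> state \<Rightarrow> 3 \<Rightarrow> 3 \<Rightarrow> distr" where
  "spin_rate \<Omega> C \<alpha> U i j w =
     1 / 2 * (distr_pd j (distr_of \<Omega> (\<lambda>x. velocity U x $ i)) w
            - distr_pd i (distr_of \<Omega> (\<lambda>x. velocity U x $ j)) w)
     - distr_of \<Omega> (\<lambda>x. 1 / 2 * (flux C \<alpha> (strain U) x $ i $ j - flux C \<alpha> (strain U) x $ j $ i)) w"

definition integrated_rotation ::
    "space set \<Rightarrow> (space \<Rightarrow> tensor4) \<Rightarrow> (space \<Rightarrow> real^3^3) \<Rightarrow> (space \<Rightarrow> real^3^3)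
      \<Rightarrow> (real \<Rightarrow> state) \<Rightarrow> real \<Rightarrow> 3 \<Rightarrow> 3 \<Rightarrow> distr" where
  "integrated_rotation \<Omega> C \<alpha> \<omega>0 U t i j w =
     distr_of \<Omega> (\<lambda>x. \<omega>0 x $ i $ j) w + integral {0..t} (\<lambda>s. spin_rate \<Omega> C \<alpha> (U s) i j w)"

definition weak_solution ::
    "space set \<Rightarrow> space set \<Rightarrow> real \<Rightarrow> (space \<Rightarrow> tensor4) \<Rightarrow> (space \<Rightarrow> real^3^3) \<Rightarrow> state
      \<Rightarrow> (space \<Rightarrow> real^3^3) \<Rightarrow> (real \<Rightarrow> state) \<Rightarrow> (real \<Rightarrow> 3 \<Rightarrow> 3 \<Rightarrow> distr) \<Rightarrow> bool" where
  "weak_solution \<Omega> \<Gamma>1 \<rho> C \<alpha> U0 \<omega>0 U \<omega> \<longleftrightarrow>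
     weak_evolution \<Omega> \<Gamma>1 \<rho> C \<alpha> U0 U \<and>
     (\<forall>t\<ge>0. \<forall>i j. distribution_on \<Omega> (\<omega> t i j)) \<and>
     (\<forall>i j. \<forall>w\<in>test_fun \<Omega>. \<omega> 0 i j w = distr_of \<Omega> (\<lambda>x. \<omega>0 x $ i $ j) w) \<and>
     (\<forall>i j. \<forall>w\<in>test_fun \<Omega>. \<exists>D. continuous_on {0..} D \<and>
        (\<forall>t\<ge>0. ((\<lambda>s. \<omega> s i j w) has_real_derivative D t) (at t within {0..}) \<and>
                D t = spin_rate \<Omega> C \<alpha> (U t) i j w))"

end

theory Submission
  imports Defs "HOL-Library.Function_Algebras"
begin

text \<open>Weak solutions of \<open>\<partial>\<^sub>t U = A U\<close> in the sense of Ball are the orbits of the semigroup generated by \<open>A\<close>, and the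
rotation is then an integral in time of a functional of the orbit.  The evolution is treated in the Hilbert
space \<open>H\<close>, where \<open>D(A)\<close> is described by the convergence of difference quotients.

The basic object is the time mean \<open>M\<^sub>h x = (1/h) \<integral>\<^sub>0\<^sup>h S(s) x ds\<close>.  It lies in \<open>D(A)\<close> for every \<open>x\<close>, and
\<open>A M\<^sub>h x = (S(h) x - x) / h\<close> (\<open>mean_in_domain\<close>).  If \<open>w \<in> D(A*)\<close>, then pairing this identity with \<open>w\<close> gives
\<open>\<langle>S(h) x, w\<rangle> = \<langle>x, w\<rangle> + \<integral>\<^sub>0\<^sup>h \<langle>S(s) x, A* w\<rangle> ds\<close> for all \<open>x \<in> H\<close>, which says that the orbit of \<open>x\<close> is a weak
solution (\<open>orbit_weak_solution\<close>).

For uniqueness let \<open>v\<close> be the difference of two weak solutions with the same datum.  The vectors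
\<open>w = M\<^sub>h* y\<close> belong to \<open>D(A*)\<close>, with \<open>A* w = (S(h)* y - y) / h\<close> (\<open>adjoint_mean\<close>).  Testing with them shows that
\<open>E = M\<^sub>h v\<close> satisfies \<open>\<langle>E(t), y\<rangle> = \<integral>\<^sub>0\<^sup>t \<langle>A E(s), y\<rangle> ds\<close> for all \<open>y\<close>, where \<open>A E = (S(h) v - v) / h\<close> is continuous.
Hence \<open>E\<close> is Lipschitz, \<open>\<parallel>E\<parallel>\<^sup>2\<close> has the derivative \<open>2 \<langle>A E, E\<rangle> \<le> 0\<close>, and \<open>E = 0\<close>; letting \<open>h\<close> tend to zero gives
\<open>v = 0\<close> (\<open>weak_solution_zero\<close>).  The integrated form of the weak equation comes from the almost everywhere
form by the fundamental theorem of calculus for absolutely continuous functions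
(\<open>abs_cont_on_has_integral\<close>), proved with tagged divisions.

Means and adjoints are produced by the Riesz representation theorem from integrals of real functions, so no
integration of \<open>H\<close>-valued functions occurs.  The Riesz theorem needs that \<open>H\<close> is complete; this follows from
the completeness of \<open>L\<^sup>2\<close> (\<open>square_integrable_complete\<close>) because the energy is equivalent to the \<open>L\<^sup>2\<close> norm.

Tested against a fixed \<open>w \<in> C\<^sub>0\<^sup>\<infinity>(\<Omega>)\<close>, the right-hand side of the third equation is a linear functional of the
state, bounded by the energy norm times suprema of \<open>w\<close> and its first derivatives (\<open>spin_rate_bound\<close>).
Along an orbit it is therefore continuous in time, its time integral is a distribution, and the derivative
of that integral is the prescribed one.  Two solutions have the same right-hand side and the same initial
value, hence they agree.\<close>

section \<open>Hilbert spaces given by a semi-inner product\<close>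

text \<open>The case \<open>a = 0\<close>, in which \<open>b\<close> must vanish, is the first variation argument in the Riesz theorem; the
general case is the Cauchy-Schwarz inequality.\<close>

lemma quadratic_nonneg_imp_discriminant:
  fixes a b c :: real
  assumes "\<And>t. 0 \<le> a + 2 * t * b + t\<^sup>2 * c" "0 \<le> c"
  shows "b\<^sup>2 \<le> a * c"
proof (cases "c = 0")
  case True
  have "b = 0"
  proof (rule ccontr)
    assume "b \<noteq> 0"
    then show False using assms(1)[of "- (a + 1) / (2 * b)"] True by (simp add: field_simps)
  qed
  then show ?thesis using True by simp
next
  case False
  then show ?thesis
    using assms(1)[of "- b / c"] assms(2) by (simp add: field_simps power2_eq_square)
qed

text \<open>The form \<open>ip\<close> is only semidefinite: the elements of \<open>H\<close> will be functions that represent classes modulo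
null sets.  Equality of classes is expressed by \<open>nrm (x - y) = 0\<close>.\<close>

locale semi_hilbert =
  fixes H :: "'v::real_vector set" and ip :: "'v \<Rightarrow> 'v \<Rightarrow> real"
  assumes subspace_H: "subspace H"
    and ip_add_left: "\<lbrakk>x \<in> H; y \<in> H; z \<in> H\<rbrakk> \<Longrightarrow> ip (x + y) z = ip x z + ip y z"
    and ip_scale_left: "\<lbrakk>x \<in> H; z \<in> H\<rbrakk> \<Longrightarrow> ip (a *\<^sub>R x) z = a * ip x z"
    and ip_commute: "\<lbrakk>x \<in> H; y \<in> H\<rbrakk> \<Longrightarrow> ip x y = ip y x"
    and ip_nonneg: "x \<in> H \<Longrightarrow> 0 \<le> ip x x"
    and complete: "\<lbrakk>\<And>n. X n \<in> H; \<And>e. 0 < e \<Longrightarrow> \<exists>N. \<forall>m\<ge>N. \<forall>n\<ge>N. ip (X m - X n) (X m - X n) < e\<rbrakk>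
      \<Longrightarrow> \<exists>x\<in>H. (\<lambda>n. ip (X n - x) (X n - x)) \<longlonglongrightarrow> 0"
begin

definition nrm :: "'v \<Rightarrow> real" where "nrm x = sqrt (ip x x)"

lemma zero_mem [simp]: "0 \<in> H"
  and add_mem [simp]: "\<lbrakk>x \<in> H; y \<in> H\<rbrakk> \<Longrightarrow> x + y \<in> H"
  and diff_mem [simp]: "\<lbrakk>x \<in> H; y \<in> H\<rbrakk> \<Longrightarrow> x - y \<in> H"
  and scale_mem [simp]: "x \<in> H \<Longrightarrow> a *\<^sub>R x \<in> H"
  using subspace_H by (auto intro: subspace_0 subspace_add subspace_diff subspace_scale)

lemma ip_diff_left: "\<lbrakk>x \<in> H; y \<in> H; z \<in> H\<rbrakk> \<Longrightarrow> ip (x - y) z = ip x z - ip y z"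
  using ip_add_left[of "x - y" y z] by simp

lemma ip_add_right: "\<lbrakk>x \<in> H; y \<in> H; z \<in> H\<rbrakk> \<Longrightarrow> ip z (x + y) = ip z x + ip z y"
  by (simp add: ip_commute[of z] ip_add_left)

lemma ip_diff_right: "\<lbrakk>x \<in> H; y \<in> H; z \<in> H\<rbrakk> \<Longrightarrow> ip z (x - y) = ip z x - ip z y"
  by (simp add: ip_commute[of z] ip_diff_left)

lemma ip_scale_right: "\<lbrakk>x \<in> H; z \<in> H\<rbrakk> \<Longrightarrow> ip z (a *\<^sub>R x) = a * ip z x"
  by (simp add: ip_commute[of z] ip_scale_left)

lemmas ip_linear =
  ip_add_left ip_add_right ip_diff_left ip_diff_right ip_scale_left ip_scale_right

lemma ip_zero [simp]: "z \<in> H \<Longrightarrow> ip 0 z = 0"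
  using ip_scale_left[of 0 z 0] by simp

lemma nrm_zero [simp]: "nrm 0 = 0"
  by (simp add: nrm_def)

lemma nrm_nonneg [simp]: "x \<in> H \<Longrightarrow> 0 \<le> nrm x"
  by (simp add: nrm_def ip_nonneg)

lemma nrm_square: "x \<in> H \<Longrightarrow> (nrm x)\<^sup>2 = ip x x"
  by (simp add: nrm_def ip_nonneg)

lemma nrm_scale: "x \<in> H \<Longrightarrow> nrm (a *\<^sub>R x) = \<bar>a\<bar> * nrm x"
  by (simp add: nrm_def ip_linear real_sqrt_mult flip: mult.assoc)

lemma nrm_diff_commute: "\<lbrakk>x \<in> H; y \<in> H\<rbrakk> \<Longrightarrow> nrm (x - y) = nrm (y - x)"
  using nrm_scale[of "y - x" "-1"] by simp

lemma Cauchy_Schwarz: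
  assumes "x \<in> H" "y \<in> H"
  shows "\<bar>ip x y\<bar> \<le> nrm x * nrm y"
proof -
  have "(ip x y)\<^sup>2 \<le> ip x x * ip y y"
  proof (rule quadratic_nonneg_imp_discriminant)
    fix t
    have "ip (x + t *\<^sub>R y) (x + t *\<^sub>R y) = ip x x + 2 * t * ip x y + t\<^sup>2 * ip y y"
      using assms by (simp add: ip_linear ip_commute[of y x] power2_eq_square algebra_simps)
    then show "0 \<le> ip x x + 2 * t * ip x y + t\<^sup>2 * ip y y"
      using ip_nonneg[of "x + t *\<^sub>R y"] assms by simp
  qed (use assms ip_nonneg in simp)
  then have "sqrt ((ip x y)\<^sup>2) \<le> sqrt (ip x x * ip y y)" by (rule real_sqrt_le_mono)
  then show ?thesis by (simp add: nrm_def real_sqrt_mult)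
qed

lemma nrm_triangle:
  assumes "x \<in> H" "y \<in> H"
  shows "nrm (x + y) \<le> nrm x + nrm y"
proof (rule power2_le_imp_le)
  have "ip x y \<le> nrm x * nrm y"
    using Cauchy_Schwarz[OF assms] by simp
  then show "(nrm (x + y))\<^sup>2 \<le> (nrm x + nrm y)\<^sup>2"
    using assms by (simp add: power2_sum nrm_square ip_linear ip_commute[of y x])
qed (use assms in simp)

lemma nrm_triangle_diff:
  assumes "x \<in> H" "y \<in> H" "z \<in> H"
  shows "nrm (x - z) \<le> nrm (x - y) + nrm (y - z)"
  using nrm_triangle[of "x - y" "y - z"] assms by simp

lemma nrm_cong: "\<lbrakk>x \<in> H; y \<in> H; nrm (x - y) = 0\<rbrakk> \<Longrightarrow> nrm x = nrm y"
  using nrm_triangle[of "x - y" y] nrm_triangle[of "y - x" x] nrm_diff_commute[of x y] by auto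

lemma nrm_le_dual:
  assumes "x \<in> H" "\<And>y. y \<in> H \<Longrightarrow> \<bar>ip x y\<bar> \<le> K * nrm y" "0 \<le> K"
  shows "nrm x \<le> K"
proof -
  have "(nrm x)\<^sup>2 \<le> K * nrm x"
    using assms(2)[OF assms(1)] assms(1) by (simp add: nrm_square)
  then show ?thesis
    using nrm_nonneg[OF assms(1)] assms(3) by (cases "nrm x = 0") (auto simp: power2_eq_square)
qed

lemma ip_zero_cong:
  assumes "x \<in> H" "y \<in> H" "z \<in> H" "nrm (x - y) = 0"
  shows "ip x z = ip y z"
  using Cauchy_Schwarz[of "x - y" z] assms by (simp add: ip_linear)

text \<open>The representing vector minimises \<open>J x = \<langle>x, x\<rangle> - 2 f x\<close>.  A minimising sequence is Cauchy by the
parallelogram law, and the vanishing of the first variation at its limit is the asserted identity.\<close>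

lemma Riesz_representation:
  assumes add: "\<And>x y. \<lbrakk>x \<in> H; y \<in> H\<rbrakk> \<Longrightarrow> f (x + y) = f x + f y"
    and scale: "\<And>x a. x \<in> H \<Longrightarrow> f (a *\<^sub>R x) = a * f x"
    and bounded: "\<And>x. x \<in> H \<Longrightarrow> \<bar>f x\<bar> \<le> K * nrm x"
  shows "\<exists>w\<in>H. \<forall>x\<in>H. ip x w = (f x :: real)"
proof -
  define J where "J x = ip x x - 2 * f x" for x
  have lower: "- K\<^sup>2 \<le> J x" if "x \<in> H" for x
  proof -
    have "J x \<ge> (nrm x)\<^sup>2 - 2 * (K * nrm x)"
      using bounded[OF that] by (simp add: J_def nrm_square that)
    moreover have "0 \<le> (nrm x - K)\<^sup>2" by simp
    ultimately show ?thesis by (simp add: power2_diff algebra_simps)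
  qed
  define m where "m = Inf (J ` H)"
  have bdd: "bdd_below (J ` H)" using lower by (intro bdd_belowI2) auto
  have m: "m \<le> J x" if "x \<in> H" for x
    unfolding m_def using that bdd by (simp add: cINF_lower)
  have "\<exists>x\<in>H. J x < m + e" if "e > 0" for e
    using cInf_lessD[of "J ` H" "m + e"] that zero_mem unfolding m_def by (fastforce simp del: zero_mem)
  then have "\<forall>n. \<exists>x. x \<in> H \<and> J x < m + 1 / Suc n"
    by (metis of_nat_0_less_iff zero_less_Suc zero_less_divide_1_iff)
  then obtain X where X: "\<And>n. X n \<in> H" "\<And>n. J (X n) < m + 1 / Suc n"
    by metis
  have f_diff: "f (x - y) = f x - f y" if "x \<in> H" "y \<in> H" for x y
    using add[of "x - y" y] that by simp
  \<comment> \<open>The parallelogram law turns near-minimality into closeness.\<close>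
  have close: "ip (x - y) (x - y) \<le> 2 * (J x - m) + 2 * (J y - m)" if "x \<in> H" "y \<in> H" for x y
  proof -
    have "m \<le> J ((1/2) *\<^sub>R (x + y))" using that by (intro m) simp
    also have "\<dots> = (ip x x + 2 * ip x y + ip y y) / 4 - (f x + f y)"
      using that by (simp add: J_def ip_linear add scale ip_commute[of y x] algebra_simps)
    finally have "4 * m \<le> ip x x + 2 * ip x y + ip y y - 4 * (f x + f y)" by argo
    then show ?thesis
      using that by (simp add: J_def ip_linear ip_commute[of y x])
  qed
  have "\<exists>x\<in>H. (\<lambda>n. ip (X n - x) (X n - x)) \<longlonglongrightarrow> 0"
  proof (rule complete[OF X(1)])
    fix e :: real assume "e > 0"
    then obtain N where N: "1 / Suc N < e / 4"
      using nat_approx_posE[of "e/4"] by auto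
    have "ip (X p - X q) (X p - X q) < e" if "p \<ge> N" "q \<ge> N" for p q
    proof -
      have "1 / real (Suc p) \<le> 1 / Suc N" "1 / real (Suc q) \<le> 1 / Suc N"
        using that by (auto simp: field_simps)
      then show ?thesis
        using close[OF X(1) X(1), of p q] X(2)[of p] X(2)[of q] N by argo
    qed
    then show "\<exists>N. \<forall>p\<ge>N. \<forall>q\<ge>N. ip (X p - X q) (X p - X q) < e" by blast
  qed
  then obtain w where w: "w \<in> H" "(\<lambda>n. ip (X n - w) (X n - w)) \<longlonglongrightarrow> 0" by blast
  have nrm_lim: "(\<lambda>n. nrm (X n - w)) \<longlonglongrightarrow> 0"
    using tendsto_real_sqrt[OF w(2)] by (simp add: nrm_def)
  have weak: "(\<lambda>n. ip (X n) y) \<longlonglongrightarrow> ip w y" if "y \<in> H" for y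
  proof -
    have "(\<lambda>n. ip (X n - w) y) \<longlonglongrightarrow> 0"
    proof (rule Lim_null_comparison)
      show "\<forall>\<^sub>F n in sequentially. norm (ip (X n - w) y) \<le> nrm (X n - w) * nrm y"
        using Cauchy_Schwarz X(1) w(1) that by simp
      show "(\<lambda>n. nrm (X n - w) * nrm y) \<longlonglongrightarrow> 0"
        using tendsto_mult_left_zero[OF nrm_lim] .
    qed
    then show ?thesis
      using X(1) w(1) that by (simp add: ip_linear LIM_zero_iff)
  qed
  \<comment> \<open>First variation of \<open>J\<close> along the minimising sequence.\<close>
  have "ip y w = f y" if y: "y \<in> H" for y
  proof -
    have var: "0 \<le> 2 * t * (ip w y - f y) + t\<^sup>2 * ip y y" for t
    proof -
      have "0 \<le> 1 / Suc n + 2 * t * (ip (X n) y - f y) + t\<^sup>2 * ip y y" for n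
      proof -
        have "m \<le> J (X n + t *\<^sub>R y)" using X y by (intro m) simp
        also have "\<dots> = J (X n) + 2 * t * (ip (X n) y - f y) + t\<^sup>2 * ip y y"
          using X(1) y by (simp add: J_def ip_linear add scale ip_commute[of y "X n"]
              power2_eq_square algebra_simps)
        finally show ?thesis using X(2)[of n] by argo
      qed
      moreover have "(\<lambda>n. 1 / Suc n + 2 * t * (ip (X n) y - f y) + t\<^sup>2 * ip y y)
          \<longlonglongrightarrow> 0 + 2 * t * (ip w y - f y) + t\<^sup>2 * ip y y"
        by (intro tendsto_intros weak y LIMSEQ_Suc[OF lim_1_over_n, unfolded of_nat_Suc] |
            rule LIMSEQ_Suc[OF lim_1_over_n])+
      ultimately show ?thesis
        using LIMSEQ_le_const[of _ _ 0] by (metis (lifting) add_0)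
    qed
    have "ip w y - f y = 0"
      using quadratic_nonneg_imp_discriminant[of 0 "ip w y - f y" "ip y y"] var ip_nonneg[OF y] by simp
    then show ?thesis using ip_commute[OF y w(1)] by simp
  qed
  then show ?thesis using w(1) by blast
qed

definition strongly_continuous :: "(real \<Rightarrow> 'v) \<Rightarrow> bool" where
  "strongly_continuous u \<longleftrightarrow>
     (\<forall>t\<ge>0. u t \<in> H) \<and> (\<forall>t\<ge>0. ((\<lambda>s. nrm (u s - u t)) \<longlongrightarrow> 0) (at t within {0..}))"

lemma strongly_continuous_mem: "\<lbrakk>strongly_continuous u; 0 \<le> t\<rbrakk> \<Longrightarrow> u t \<in> H"
  by (simp add: strongly_continuous_def)

lemma continuous_on_lipschitz_functional:
  assumes u: "strongly_continuous u"
    and f: "\<And>x y. \<lbrakk>x \<in> H; y \<in> H\<rbrakk> \<Longrightarrow> \<bar>f x - f y\<bar> \<le> K * nrm (x - y)"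
  shows "continuous_on {0..} (\<lambda>t. f (u t) :: real)"
unfolding continuous_on_def
proof (intro ballI)
  fix t :: real assume t: "t \<in> {0..}"
  have "((\<lambda>s. f (u s) - f (u t)) \<longlongrightarrow> 0) (at t within {0..})"
  proof (rule Lim_null_comparison)
    show "\<forall>\<^sub>F s in at t within {0..}. norm (f (u s) - f (u t)) \<le> K * nrm (u s - u t)"
      using f strongly_continuous_mem[OF u] t by (auto simp: eventually_at_filter)
    show "((\<lambda>s. K * nrm (u s - u t)) \<longlongrightarrow> 0) (at t within {0..})"
      using u t by (intro tendsto_mult_right_zero) (simp add: strongly_continuous_def)
  qed
  then show "((\<lambda>s. f (u s)) \<longlongrightarrow> f (u t)) (at t within {0..})"
    by (rule LIM_zero_cancel)
qed

lemma continuous_on_ip: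
  assumes "strongly_continuous u" "y \<in> H"
  shows "continuous_on {0..} (\<lambda>t. ip (u t) y)"
proof (rule continuous_on_lipschitz_functional[OF assms(1)])
  show "\<bar>ip x y - ip x' y\<bar> \<le> nrm y * nrm (x - x')" if "x \<in> H" "x' \<in> H" for x x'
    using Cauchy_Schwarz[of "x - x'" y] that assms(2) by (simp add: ip_linear mult.commute)
qed

lemma continuous_on_nrm:
  assumes "strongly_continuous u"
  shows "continuous_on {0..} (\<lambda>t. nrm (u t))"
proof (rule continuous_on_lipschitz_functional[OF assms])
  show "\<bar>nrm x - nrm y\<bar> \<le> 1 * nrm (x - y)" if "x \<in> H" "y \<in> H" for x y
    using nrm_triangle[of "x - y" y] nrm_triangle[of "y - x" x] nrm_diff_commute[of x y] that
    by auto
qed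

lemma strongly_continuous_diff:
  assumes u: "strongly_continuous u" and v: "strongly_continuous v"
  shows "strongly_continuous (\<lambda>t. u t - v t)"
  unfolding strongly_continuous_def
proof (intro conjI allI impI)
  fix t :: real assume t: "0 \<le> t"
  note mem = strongly_continuous_mem[OF u] strongly_continuous_mem[OF v]
  show "u t - v t \<in> H" using mem t by simp
  show "((\<lambda>s. nrm ((u s - v s) - (u t - v t))) \<longlongrightarrow> 0) (at t within {0..})"
  proof (rule Lim_null_comparison)
    have "norm (nrm ((u s - v s) - (u t - v t))) \<le> nrm (u s - u t) + nrm (v s - v t)" if "0 \<le> s" for s
    proof -
      have eq: "(u s - v s) - (u t - v t) = (u s - u t) + (v t - v s)" by simp
      show ?thesis
        unfolding eq
        using nrm_triangle[of "u s - u t" "v t - v s"] nrm_diff_commute[of "v s" "v t"] mem that t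
        by simp
    qed
    then show "\<forall>\<^sub>F s in at t within {0..}.
        norm (nrm ((u s - v s) - (u t - v t))) \<le> nrm (u s - u t) + nrm (v s - v t)"
      by (auto simp: eventually_at_filter)
    show "((\<lambda>s. nrm (u s - u t) + nrm (v s - v t)) \<longlongrightarrow> 0) (at t within {0..})"
      using u v t by (intro tendsto_add_zero) (auto simp: strongly_continuous_def)
  qed
qed

end

section \<open>Contraction semigroups\<close>

lemma integral_minus_const_bound:
  fixes f :: "real \<Rightarrow> real"
  assumes "a \<le> b" "continuous_on {a..b} f" "\<And>s. s \<in> {a..b} \<Longrightarrow> \<bar>f s - c\<bar> \<le> B"
  shows "\<bar>integral {a..b} f - (b - a) * c\<bar> \<le> B * (b - a)"
proof -
  have "integral {a..b} (\<lambda>s. f s - c) = integral {a..b} f - (b - a) * c"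
    using assms by (simp add: integral_diff integrable_continuous_interval)
  moreover have "norm (integral {a..b} (\<lambda>s. f s - c)) \<le> B * (b - a)"
    using assms by (intro integral_bound continuous_intros) auto
  ultimately show ?thesis by simp
qed

text \<open>All identities between states hold up to \<open>nrm\<close>-null differences, in agreement with almost everywhere
equality in the concrete space.\<close>

locale contraction_semigroup = semi_hilbert H ip
  for H :: "'v::real_vector set" and ip +
  fixes S :: "real \<Rightarrow> 'v \<Rightarrow> 'v" and D :: "'v set" and A :: "'v \<Rightarrow> 'v"
  assumes S_mem: "\<lbrakk>0 \<le> t; x \<in> H\<rbrakk> \<Longrightarrow> S t x \<in> H"
    and S_linear: "\<lbrakk>0 \<le> t; x \<in> H; y \<in> H\<rbrakk> \<Longrightarrow>
      nrm (S t (a *\<^sub>R x + b *\<^sub>R y) - (a *\<^sub>R S t x + b *\<^sub>R S t y)) = 0"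
    and S_zero: "x \<in> H \<Longrightarrow> nrm (S 0 x - x) = 0"
    and S_add: "\<lbrakk>0 \<le> s; 0 \<le> t; x \<in> H\<rbrakk> \<Longrightarrow> nrm (S (s + t) x - S s (S t x)) = 0"
    and S_continuous: "x \<in> H \<Longrightarrow> ((\<lambda>t. nrm (S t x - x)) \<longlongrightarrow> 0) (at_right 0)"
    and S_contraction: "\<lbrakk>0 \<le> t; x \<in> H\<rbrakk> \<Longrightarrow> nrm (S t x) \<le> nrm x"
    and D_subset: "D \<subseteq> H"
    and A_mem: "x \<in> D \<Longrightarrow> A x \<in> H"
    and generator: "\<lbrakk>x \<in> H; y \<in> H\<rbrakk> \<Longrightarrow>
      ((\<lambda>t. nrm ((1 / t) *\<^sub>R (S t x - x) - y)) \<longlongrightarrow> 0) (at_right 0) \<longleftrightarrow> x \<in> D \<and> nrm (y - A x) = 0"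
begin

declare S_mem [simp]

lemma ip_S_lincomb:
  assumes "0 \<le> t" "x \<in> H" "y \<in> H" "z \<in> H"
  shows "ip (S t (a *\<^sub>R x + b *\<^sub>R y)) z = a * ip (S t x) z + b * ip (S t y) z"
  using ip_zero_cong[OF _ _ assms(4) S_linear[OF assms(1-3), of a b]] assms
  by (simp add: ip_linear)

lemma ip_S_add_arg:
  "\<lbrakk>0 \<le> t; x \<in> H; y \<in> H; z \<in> H\<rbrakk> \<Longrightarrow> ip (S t (x + y)) z = ip (S t x) z + ip (S t y) z"
  using ip_S_lincomb[of t x y z 1 1] by simp

lemma ip_S_scale_arg:
  "\<lbrakk>0 \<le> t; x \<in> H; z \<in> H\<rbrakk> \<Longrightarrow> ip (S t (a *\<^sub>R x)) z = a * ip (S t x) z"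
  using ip_S_lincomb[of t x x z a 0] by simp

lemma ip_S_zero: "\<lbrakk>x \<in> H; z \<in> H\<rbrakk> \<Longrightarrow> ip (S 0 x) z = ip x z"
  using ip_zero_cong[of "S 0 x" x z] S_zero[of x] by simp

lemma ip_S_add:
  "\<lbrakk>0 \<le> s; 0 \<le> t; x \<in> H; z \<in> H\<rbrakk> \<Longrightarrow> ip (S s (S t x)) z = ip (S (s + t) x) z"
  using ip_zero_cong[of "S (s + t) x" "S s (S t x)" z] S_add[of s t x] by simp

lemma S_lipschitz:
  assumes "0 \<le> t" "x \<in> H" "y \<in> H"
  shows "nrm (S t x - S t y) \<le> nrm (x - y)"
proof -
  have "nrm (S t x - S t y) = nrm (S t (x - y))"
  proof (rule nrm_cong[symmetric])
    show "nrm (S t (x - y) - (S t x - S t y)) = 0"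
      using S_linear[OF assms, of 1 "-1"] by simp
  qed (use assms in auto)
  also have "\<dots> \<le> nrm (x - y)" using assms by (intro S_contraction) auto
  finally show ?thesis .
qed

text \<open>The semigroup law transports an increment at any time back to time zero, so that the orbits are uniformly
continuous.\<close>

lemma S_increment:
  assumes "0 \<le> s" "0 \<le> t" "x \<in> H"
  shows "nrm (S s x - S t x) \<le> nrm (S \<bar>s - t\<bar> x - x)"
proof -
  have main: "nrm (S p x - S q x) \<le> nrm (S (q - p) x - x)" if "0 \<le> p" "p \<le> q" for p q
  proof -
    have "nrm (S p x - S q x) \<le> nrm (S p x - S p (S (q - p) x)) + nrm (S p (S (q - p) x) - S q x)"
      using that assms by (intro nrm_triangle_diff) auto
    also have "nrm (S p (S (q - p) x) - S q x) = 0"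
      using S_add[of p "q - p" x] nrm_diff_commute[of "S p (S (q - p) x)" "S q x"] that assms by simp
    also have "nrm (S p x - S p (S (q - p) x)) \<le> nrm (x - S (q - p) x)"
      using that assms by (intro S_lipschitz) auto
    finally show ?thesis using nrm_diff_commute[of x "S (q - p) x"] that assms by simp
  qed
  show ?thesis
    using main[of s t] main[of t s] assms nrm_diff_commute[of "S s x" "S t x"]
    by (cases "s \<le> t") (auto simp: abs_if)
qed

lemma S_near_zero:
  assumes "x \<in> H" "0 < e"
  obtains d where "0 < d" "\<And>r. \<lbrakk>0 \<le> r; r < d\<rbrakk> \<Longrightarrow> nrm (S r x - x) < e"
proof -
  have "\<forall>\<^sub>F t in at_right 0. nrm (S t x - x) < e"
    using S_continuous[OF assms(1)] assms(2) order_tendstoD(2) by blast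
  then obtain d where d: "0 < d" "\<And>r. \<lbrakk>0 < r; r < d\<rbrakk> \<Longrightarrow> nrm (S r x - x) < e"
    by (auto simp: eventually_at_right_field)
  have "nrm (S r x - x) < e" if "0 \<le> r" "r < d" for r
    using d(2)[of r] S_zero[OF assms(1)] assms(2) that by (cases "r = 0") auto
  then show ?thesis using that d(1) by blast
qed

lemma strongly_continuous_S:
  assumes "x \<in> H"
  shows "strongly_continuous (\<lambda>t. S t x)"
  unfolding strongly_continuous_def
proof (intro conjI allI impI)
  fix t :: real assume t: "0 \<le> t"
  show "((\<lambda>s. nrm (S s x - S t x)) \<longlongrightarrow> 0) (at t within {0..})"
  proof (rule tendstoI)
    fix e :: real assume "0 < e"
    then obtain d where d: "0 < d" "\<And>r. \<lbrakk>0 \<le> r; r < d\<rbrakk> \<Longrightarrow> nrm (S r x - x) < e"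
      using S_near_zero[OF assms] by blast
    have "dist (nrm (S s x - S t x)) 0 < e" if "s \<in> {0..}" "dist s t < d" for s
      using S_increment[of s t x] d(2)[of "\<bar>s - t\<bar>"] t assms that by (simp add: dist_real_def)
    then show "\<forall>\<^sub>F s in at t within {0..}. dist (nrm (S s x - S t x)) 0 < e"
      using d(1) by (auto simp: eventually_at)
  qed
qed (use assms in auto)

lemma continuous_on_ip_S: "\<lbrakk>x \<in> H; y \<in> H; T \<subseteq> {0..}\<rbrakk> \<Longrightarrow> continuous_on T (\<lambda>t. ip (S t x) y)"
  using continuous_on_ip[OF strongly_continuous_S] continuous_on_subset by blast

lemma integrable_ip_S: "\<lbrakk>x \<in> H; y \<in> H; 0 \<le> a\<rbrakk> \<Longrightarrow> (\<lambda>t. ip (S t x) y) integrable_on {a..b}"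
  by (intro integrable_continuous_interval continuous_on_ip_S) auto

lemma ip_S_bound:
  assumes "0 \<le> t" "x \<in> H" "y \<in> H"
  shows "\<bar>ip (S t x) y\<bar> \<le> nrm x * nrm y"
  using Cauchy_Schwarz[of "S t x" y] S_contraction[OF assms(1,2)] assms
  by (meson S_mem mult_right_mono nrm_nonneg order_trans)

text \<open>The pairing \<open>\<langle>M\<^sub>h x, y\<rangle>\<close> of the time mean \<open>M\<^sub>h x = (1/h) \<integral>\<^sub>0\<^sup>h S(s) x ds\<close> with \<open>y\<close>.  It is an integral of a real
function; as a functional of \<open>y\<close> it represents the mean, as a functional of \<open>x\<close> the adjoint mean of \<open>y\<close>.\<close>

definition mean_ip :: "real \<Rightarrow> 'v \<Rightarrow> 'v \<Rightarrow> real" where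
  "mean_ip h x y = 1 / h * integral {0..h} (\<lambda>s. ip (S s x) y)"

lemma mean_ip_bound:
  assumes "0 < h" "x \<in> H" "y \<in> H"
  shows "\<bar>mean_ip h x y\<bar> \<le> nrm x * nrm y"
proof -
  have "norm (integral {0..h} (\<lambda>s. ip (S s x) y)) \<le> nrm x * nrm y * (h - 0)"
    using assms by (intro integral_bound continuous_on_ip_S) (auto intro: ip_S_bound)
  then show ?thesis using assms by (simp add: mean_ip_def field_simps)
qed

lemma mean_ip_near:
  assumes "0 < h" "x \<in> H" "y \<in> H" "\<And>r. \<lbrakk>0 \<le> r; r \<le> h\<rbrakk> \<Longrightarrow> nrm (S r x - x) \<le> e"
  shows "\<bar>mean_ip h x y - ip x y\<bar> \<le> e * nrm y"
proof -
  have "\<bar>integral {0..h} (\<lambda>s. ip (S s x) y) - (h - 0) * ip x y\<bar> \<le> e * nrm y * (h - 0)"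
  proof (rule integral_minus_const_bound)
    fix s assume s: "s \<in> {0..h}"
    have "\<bar>ip (S s x - x) y\<bar> \<le> nrm (S s x - x) * nrm y"
      using assms s by (intro Cauchy_Schwarz) auto
    also have "\<dots> \<le> e * nrm y" using assms s by (intro mult_right_mono) auto
    finally show "\<bar>ip (S s x) y - ip x y\<bar> \<le> e * nrm y"
      using assms s by (simp add: ip_linear)
  qed (use assms in \<open>auto intro: continuous_on_ip_S\<close>)
  then have "\<bar>integral {0..h} (\<lambda>s. ip (S s x) y) - h * ip x y\<bar> / h \<le> e * nrm y"
    using assms(1) by (simp add: pos_divide_le_eq)
  also have "\<bar>integral {0..h} (\<lambda>s. ip (S s x) y) - h * ip x y\<bar> / h
      = \<bar>(integral {0..h} (\<lambda>s. ip (S s x) y) - h * ip x y) / h\<bar>"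
    using assms(1) by (simp add: abs_divide)
  also have "(integral {0..h} (\<lambda>s. ip (S s x) y) - h * ip x y) / h = mean_ip h x y - ip x y"
    using assms(1) by (simp add: mean_ip_def diff_divide_distrib)
  finally show ?thesis .
qed

lemma ex_mean:
  assumes "0 < h" "x \<in> H"
  shows "\<exists>m\<in>H. \<forall>y\<in>H. ip m y = mean_ip h x y"
proof -
  have "\<exists>w\<in>H. \<forall>y\<in>H. ip y w = mean_ip h x y"
  proof (rule Riesz_representation)
    show "mean_ip h x (y + z) = mean_ip h x y + mean_ip h x z" if "y \<in> H" "z \<in> H" for y z
    proof -
      have "integral {0..h} (\<lambda>s. ip (S s x) (y + z))
          = integral {0..h} (\<lambda>s. ip (S s x) y + ip (S s x) z)"
        using assms that by (intro integral_cong) (simp add: ip_linear)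
      then show ?thesis
        using assms that by (simp add: mean_ip_def integral_add integrable_ip_S distrib_left add_divide_distrib)
    qed
    show "mean_ip h x (a *\<^sub>R y) = a * mean_ip h x y" if "y \<in> H" for y a
    proof -
      have "integral {0..h} (\<lambda>s. ip (S s x) (a *\<^sub>R y)) = integral {0..h} (\<lambda>s. a * ip (S s x) y)"
        using assms that by (intro integral_cong) (simp add: ip_linear)
      then show ?thesis by (simp add: mean_ip_def)
    qed
    show "\<bar>mean_ip h x y\<bar> \<le> nrm x * nrm y" if "y \<in> H" for y
      using mean_ip_bound assms that by blast
  qed
  then show ?thesis using ip_commute by metis
qed

lemma ex_adjoint_mean:
  assumes "0 < h" "y \<in> H"
  shows "\<exists>w\<in>H. \<forall>x\<in>H. ip x w = mean_ip h x y"
proof (rule Riesz_representation)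
  show "mean_ip h (x + z) y = mean_ip h x y + mean_ip h z y" if "x \<in> H" "z \<in> H" for x z
  proof -
    have "integral {0..h} (\<lambda>s. ip (S s (x + z)) y)
        = integral {0..h} (\<lambda>s. ip (S s x) y + ip (S s z) y)"
      using assms that by (intro integral_cong) (simp add: ip_S_add_arg)
    then show ?thesis
      using assms that by (simp add: mean_ip_def integral_add integrable_ip_S distrib_left add_divide_distrib)
  qed
  show "mean_ip h (a *\<^sub>R x) y = a * mean_ip h x y" if "x \<in> H" for x a
  proof -
    have "integral {0..h} (\<lambda>s. ip (S s (a *\<^sub>R x)) y) = integral {0..h} (\<lambda>s. a * ip (S s x) y)"
      using assms that by (intro integral_cong) (simp add: ip_S_scale_arg)
    then show ?thesis by (simp add: mean_ip_def)
  qed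
  show "\<bar>mean_ip h x y\<bar> \<le> nrm y * nrm x" if "x \<in> H" for x
    using mean_ip_bound[OF assms(1) that assms(2)] by (simp add: mult.commute)
qed

lemma ex_adjoint_S:
  assumes "0 \<le> t" "y \<in> H"
  shows "\<exists>w\<in>H. \<forall>x\<in>H. ip x w = ip (S t x) y"
proof (rule Riesz_representation)
  show "\<bar>ip (S t x) y\<bar> \<le> nrm y * nrm x" if "x \<in> H" for x
    using ip_S_bound[OF assms(1) that assms(2)] by (simp add: mult.commute)
qed (use assms in \<open>simp_all add: ip_S_add_arg ip_S_scale_arg\<close>)

definition mean :: "real \<Rightarrow> 'v \<Rightarrow> 'v" where
  "mean h x = (SOME m. m \<in> H \<and> (\<forall>y\<in>H. ip m y = mean_ip h x y))"

lemma
  assumes "0 < h" "x \<in> H"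
  shows mean_mem [simp]: "mean h x \<in> H"
    and ip_mean: "y \<in> H \<Longrightarrow> ip (mean h x) y = mean_ip h x y"
proof -
  have "\<exists>m. m \<in> H \<and> (\<forall>y\<in>H. ip m y = mean_ip h x y)" using ex_mean[OF assms] by blast
  from someI_ex[OF this]
  show "mean h x \<in> H" "y \<in> H \<Longrightarrow> ip (mean h x) y = mean_ip h x y" by (auto simp: mean_def)
qed

text \<open>Moving \<open>S t\<close> through the weakly defined mean requires its adjoint: \<open>\<langle>S(t) M\<^sub>h x, y\<rangle> = \<langle>M\<^sub>h x, S(t)* y\<rangle>\<close>.\<close>

lemma ip_S_mean:
  assumes "0 < h" "0 \<le> t" "x \<in> H" "y \<in> H"
  shows "ip (S t (mean h x)) y = 1 / h * integral {t..t + h} (\<lambda>s. ip (S s x) y)"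
proof -
  obtain w where w: "w \<in> H" "\<And>x. x \<in> H \<Longrightarrow> ip x w = ip (S t x) y"
    using ex_adjoint_S[OF assms(2,4)] by blast
  have "ip (S t (mean h x)) y = mean_ip h x w"
    using w ip_mean[OF assms(1,3) w(1)] w(2)[of "mean h x"] assms by simp
  also have "\<dots> = 1 / h * integral {0..h} ((\<lambda>s. ip (S s x) y) \<circ> (\<lambda>s. s + t))"
    unfolding mean_ip_def using w assms
    by (intro arg_cong2[where f="(*)"] integral_cong refl) (simp add: ip_S_add add.commute)
  also have "integral {0..h} ((\<lambda>s. ip (S s x) y) \<circ> (\<lambda>s. s + t)) = integral {0 + t..h + t} (\<lambda>s. ip (S s x) y)"
    using assms by (intro integral_shift continuous_on_ip_S) auto
  finally show ?thesis by (simp add: add.commute)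
qed

text \<open>After pairing with \<open>y\<close>, the quotient \<open>(S(t) M\<^sub>h x - M\<^sub>h x) / t\<close> is the difference of the averages of
\<open>\<langle>S(s) x, y\<rangle>\<close> over \<open>[h, h + t]\<close> and \<open>[0, t]\<close>, divided by \<open>h\<close>.  The estimate is uniform in \<open>y\<close> and so holds in norm.\<close>

lemma difference_quotient_mean:
  assumes h: "0 < h" and t: "0 < t" and x: "x \<in> H"
    and e: "\<And>r. \<lbrakk>0 \<le> r; r \<le> t\<rbrakk> \<Longrightarrow> nrm (S r x - x) \<le> e"
  shows "nrm ((1 / t) *\<^sub>R (S t (mean h x) - mean h x) - (1 / h) *\<^sub>R (S h x - x)) \<le> 2 * e / h"
proof (rule nrm_le_dual)
  have "0 \<le> nrm (S 0 x - x)" using x by simp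
  also have "\<dots> \<le> e" using e[of 0] t by simp
  finally have e0: "0 \<le> e" .
  then show "0 \<le> 2 * e / h" using h by simp
  show "(1 / t) *\<^sub>R (S t (mean h x) - mean h x) - (1 / h) *\<^sub>R (S h x - x) \<in> H"
    using assms by simp
  fix y assume y: "y \<in> H"
  define \<phi> where "\<phi> = (\<lambda>s. ip (S s x) y)"
  have cont: "continuous_on {a..b} \<phi>" if "0 \<le> a" for a b
    unfolding \<phi>_def using that x y by (intro continuous_on_ip_S) auto
  have int: "\<phi> integrable_on {a..b}" if "0 \<le> a" for a b
    using cont[OF that] by (rule integrable_continuous_interval)
  have split: "integral {0..t} \<phi> + integral {t..t + h} \<phi> = integral {0..h} \<phi> + integral {h..h + t} \<phi>"
    using Henstock_Kurzweil_Integration.integral_combine[of 0 t "t + h" \<phi>]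
      Henstock_Kurzweil_Integration.integral_combine[of 0 h "h + t" \<phi>] int h t
    by (simp add: add.commute)
  have near: "\<bar>\<phi> s - \<phi> a\<bar> \<le> e * nrm y" if "0 \<le> a" "a \<le> s" "s \<le> a + t" for a s
  proof -
    have "\<bar>ip (S s x - S a x) y\<bar> \<le> nrm (S s x - S a x) * nrm y"
      using that x y by (intro Cauchy_Schwarz) auto
    also have "nrm (S s x - S a x) \<le> e"
      using S_increment[of s a x] e[of "\<bar>s - a\<bar>"] that x by (simp add: abs_if split: if_splits)
    finally show ?thesis
      using that x y by (simp add: \<phi>_def ip_linear mult_right_mono)
  qed
  have 1: "\<bar>integral {h..h + t} \<phi> - (h + t - h) * \<phi> h\<bar> \<le> e * nrm y * (h + t - h)"
    using near h t cont by (intro integral_minus_const_bound) auto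
  have 2: "\<bar>integral {0..t} \<phi> - (t - 0) * \<phi> 0\<bar> \<le> e * nrm y * (t - 0)"
    using near t cont by (intro integral_minus_const_bound) auto
  have "ip ((1 / t) *\<^sub>R (S t (mean h x) - mean h x) - (1 / h) *\<^sub>R (S h x - x)) y
      = 1 / t * (1 / h * integral {t..t + h} \<phi> - 1 / h * integral {0..h} \<phi>) - 1 / h * (\<phi> h - \<phi> 0)"
    using assms y by (simp add: ip_linear ip_S_mean ip_mean mean_ip_def \<phi>_def ip_S_zero)
  also have "\<dots> = ((integral {h..h + t} \<phi> - t * \<phi> h) - (integral {0..t} \<phi> - t * \<phi> 0)) / (t * h)"
  proof -
    have *: "integral {t..t + h} \<phi> = integral {0..h} \<phi> + integral {h..h + t} \<phi> - integral {0..t} \<phi>"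
      using split by simp
    show ?thesis unfolding * using h t by (simp add: field_simps)
  qed
  finally have eq: "ip ((1 / t) *\<^sub>R (S t (mean h x) - mean h x) - (1 / h) *\<^sub>R (S h x - x)) y
      = ((integral {h..h + t} \<phi> - t * \<phi> h) - (integral {0..t} \<phi> - t * \<phi> 0)) / (t * h)" .
  have "\<bar>(integral {h..h + t} \<phi> - t * \<phi> h) - (integral {0..t} \<phi> - t * \<phi> 0)\<bar> \<le> 2 * e * nrm y * t"
    using 1 2 by (simp add: algebra_simps)
  then show "\<bar>ip ((1 / t) *\<^sub>R (S t (mean h x) - mean h x) - (1 / h) *\<^sub>R (S h x - x)) y\<bar> \<le> 2 * e / h * nrm y"
    unfolding eq using h t by (simp add: abs_mult field_simps)
qed

lemma mean_in_domain:
  assumes h: "0 < h" and x: "x \<in> H"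
  shows "mean h x \<in> D" "nrm ((1 / h) *\<^sub>R (S h x - x) - A (mean h x)) = 0"
proof -
  have "((\<lambda>t. nrm ((1 / t) *\<^sub>R (S t (mean h x) - mean h x) - (1 / h) *\<^sub>R (S h x - x))) \<longlongrightarrow> 0) (at_right 0)"
  proof (rule tendstoI)
    fix e :: real assume e: "0 < e"
    then obtain d where d: "0 < d" "\<And>r. \<lbrakk>0 \<le> r; r < d\<rbrakk> \<Longrightarrow> nrm (S r x - x) < e * h / 4"
      using S_near_zero[OF x, of "e * h / 4"] h by auto
    have "dist (nrm ((1 / t) *\<^sub>R (S t (mean h x) - mean h x) - (1 / h) *\<^sub>R (S h x - x))) 0 < e"
      if "0 < t" "t < d" for t
    proof -
      have "nrm ((1 / t) *\<^sub>R (S t (mean h x) - mean h x) - (1 / h) *\<^sub>R (S h x - x)) \<le> 2 * (e * h / 4) / h"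
        using that h x by (intro difference_quotient_mean less_imp_le[OF d(2)]) auto
      also have "\<dots> < e" using e h by simp
      finally show ?thesis using that h x by (simp add: dist_real_def)
    qed
    then show "\<forall>\<^sub>F t in at_right 0. dist (nrm ((1 / t) *\<^sub>R (S t (mean h x) - mean h x)
        - (1 / h) *\<^sub>R (S h x - x))) 0 < e"
      using d(1) by (auto simp: eventually_at_right_field)
  qed
  then show "mean h x \<in> D" "nrm ((1 / h) *\<^sub>R (S h x - x) - A (mean h x)) = 0"
    using generator[of "mean h x" "(1 / h) *\<^sub>R (S h x - x)"] h x by auto
qed

text \<open>The domain is characterised by right difference quotients at zero.  An increment between times \<open>s\<close> and
\<open>t\<close> equals \<open>S (min s t)\<close> applied to one from zero to \<open>\<bar>t - s\<bar>\<close>, whence the derivative is two-sided.\<close>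

lemma orbit_derivative:
  assumes x: "x \<in> D" and y: "y \<in> H" and s: "0 \<le> s"
  shows "((\<lambda>t. ip (S t x) y) has_real_derivative ip (S s (A x)) y) (at s within {0..})"
proof -
  have xH: "x \<in> H" and AH: "A x \<in> H" using x D_subset A_mem by auto
  define q where "q r = nrm ((1 / r) *\<^sub>R (S r x - x) - A x) + nrm (S r (A x) - A x)" for r
  have q: "(q \<longlongrightarrow> 0) (at_right 0)"
    unfolding q_def using generator[OF xH AH] x S_continuous[OF AH]
    by (intro tendsto_add_zero) auto
  have est: "\<bar>(ip (S t x) y - ip (S s x) y) / (t - s) - ip (S s (A x)) y\<bar> \<le> q \<bar>t - s\<bar> * nrm y"
    if t: "0 \<le> t" "t \<noteq> s" for t
  proof -
    define r where "r = \<bar>t - s\<bar>"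
    define p where "p = min s t"
    have r: "0 < r" and p: "0 \<le> p" using t s by (auto simp: r_def p_def)
    define Q where "Q = (1 / r) *\<^sub>R (S r x - x)"
    have Q: "Q \<in> H" using r xH by (simp add: Q_def)
    have "ip (S p Q) y = (ip (S (p + r) x) y - ip (S p x) y) / r"
    proof -
      have "Q = (1 / r) *\<^sub>R S r x + (- (1 / r)) *\<^sub>R x" by (simp add: Q_def algebra_simps)
      then have "ip (S p Q) y = 1 / r * ip (S p (S r x)) y + (- (1 / r)) * ip (S p x) y"
        using ip_S_lincomb[OF p _ xH y, of "S r x" "1 / r" "- (1 / r)"] r xH by simp
      then show ?thesis using p r xH y by (simp add: ip_S_add diff_divide_distrib)
    qed
    also have "\<dots> = (ip (S t x) y - ip (S s x) y) / (t - s)"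
      using t by (cases "t < s") (auto simp: p_def r_def min_def abs_if field_simps)
    finally have "\<bar>(ip (S t x) y - ip (S s x) y) / (t - s) - ip (S s (A x)) y\<bar>
        = \<bar>ip (S p Q - S s (A x)) y\<bar>"
      using p s Q AH y by (simp add: ip_linear)
    also have "\<dots> \<le> nrm (S p Q - S s (A x)) * nrm y"
      using p s Q AH y by (intro Cauchy_Schwarz) auto
    also have "nrm (S p Q - S s (A x)) \<le> nrm (S p Q - S p (A x)) + nrm (S p (A x) - S s (A x))"
      using p s Q AH by (intro nrm_triangle_diff) auto
    also have "\<dots> \<le> q r"
    proof -
      have "nrm (S p (A x) - S s (A x)) \<le> nrm (S \<bar>p - s\<bar> (A x) - A x)"
        using S_increment p s AH by blast
      also have "\<dots> \<le> nrm (S r (A x) - A x)"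
        using S_zero[OF AH] AH r by (cases "s \<le> t") (auto simp: p_def r_def min_def abs_if)
      finally show ?thesis
        using S_lipschitz[OF p Q AH] by (simp add: q_def Q_def)
    qed
    finally show ?thesis using y by (simp add: r_def mult_right_mono)
  qed
  have lim: "((\<lambda>t. q \<bar>t - s\<bar> * nrm y) \<longlongrightarrow> 0) (at s within {0..})"
  proof (rule tendsto_mult_left_zero)
    have "filterlim (\<lambda>t. \<bar>t - s\<bar>) (at_right 0) (at s within {0..})"
      unfolding filterlim_at
      by (auto simp: eventually_at_filter intro!: tendsto_eq_intros)
    then show "((\<lambda>t. q \<bar>t - s\<bar>) \<longlongrightarrow> 0) (at s within {0..})"
      using filterlim_compose[OF q] by blast
  qed
  have "((\<lambda>t. (ip (S t x) y - ip (S s x) y) / (t - s) - ip (S s (A x)) y) \<longlongrightarrow> 0) (at s within {0..})"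
  proof (rule Lim_null_comparison[OF _ lim])
    show "\<forall>\<^sub>F t in at s within {0..}.
        norm ((ip (S t x) y - ip (S s x) y) / (t - s) - ip (S s (A x)) y) \<le> q \<bar>t - s\<bar> * nrm y"
      using est by (auto simp: eventually_at_filter)
  qed
  then show ?thesis by (simp add: has_field_derivative_iff LIM_zero_iff)
qed

lemma orbit_integral:
  assumes "x \<in> D" "y \<in> H" "0 \<le> h"
  shows "ip (S h x) y - ip x y = integral {0..h} (\<lambda>s. ip (S s (A x)) y)"
proof -
  have "((\<lambda>s. ip (S s (A x)) y) has_integral ip (S h x) y - ip (S 0 x) y) {0..h}"
  proof (rule fundamental_theorem_of_calculus[OF assms(3)])
    fix s assume "s \<in> {0..h}"
    then have "((\<lambda>t. ip (S t x) y) has_real_derivative ip (S s (A x)) y) (at s within {0..h})"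
      using orbit_derivative[OF assms(1,2), of s] by (auto intro: DERIV_subset)
    then show "((\<lambda>t. ip (S t x) y) has_vector_derivative ip (S s (A x)) y) (at s within {0..h})"
      by (simp add: has_real_derivative_iff_has_vector_derivative)
  qed
  moreover have "ip (S 0 x) y = ip x y" using assms D_subset by (intro ip_S_zero) auto
  ultimately show ?thesis by (metis integral_unique)
qed

lemma dissipative:
  assumes "x \<in> D"
  shows "ip (A x) x \<le> 0"
proof -
  have xH: "x \<in> H" and AH: "A x \<in> H" using assms D_subset A_mem by auto
  define Q where "Q t = (1 / t) *\<^sub>R (S t x - x)" for t
  have "((\<lambda>t. nrm (Q t - A x)) \<longlongrightarrow> 0) (at_right 0)"
    using generator[OF xH AH] assms by (simp add: Q_def)
  then have lim: "((\<lambda>t. nrm (Q t - A x) * nrm x) \<longlongrightarrow> 0) (at_right 0)"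
    by (rule tendsto_mult_left_zero)
  have "ip (A x) x \<le> nrm (Q t - A x) * nrm x" if "0 < t" for t
  proof -
    have Q: "Q t \<in> H" using that xH by (simp add: Q_def)
    have "ip (S t x) x \<le> nrm x * nrm x" using ip_S_bound[of t x x] that xH by auto
    then have "ip (S t x) x \<le> ip x x" using nrm_square[OF xH] by (simp add: power2_eq_square)
    then have "ip (Q t) x \<le> 0"
      using that xH by (simp add: Q_def ip_linear mult_nonneg_nonpos divide_nonpos_pos)
    moreover have "\<bar>ip (Q t - A x) x\<bar> \<le> nrm (Q t - A x) * nrm x"
      using Q AH xH by (intro Cauchy_Schwarz) auto
    ultimately show ?thesis using Q AH xH by (simp add: ip_linear)
  qed
  then show ?thesis
    by (intro tendsto_lowerbound[OF lim]) (auto simp: eventually_at_right_field intro: exI[of _ 1])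
qed

text \<open>The graph of the adjoint of \<open>A\<close>.\<close>

definition adjoint_in :: "'v \<Rightarrow> 'v \<Rightarrow> bool" where
  "adjoint_in w z \<longleftrightarrow> w \<in> H \<and> z \<in> H \<and> (\<forall>x\<in>D. ip (A x) w = ip x z)"

lemma orbit_weak_solution:
  assumes "adjoint_in w z" "x \<in> H" "0 \<le> h"
  shows "ip (S h x) w = ip x w + integral {0..h} (\<lambda>s. ip (S s x) z)"
proof (cases "h = 0")
  case True
  then show ?thesis using assms ip_S_zero by (simp add: adjoint_in_def)
next
  case False
  then have h: "0 < h" using assms by simp
  have wz: "w \<in> H" "z \<in> H" using assms by (auto simp: adjoint_in_def)
  have D: "mean h x \<in> D" using mean_in_domain[OF h assms(2)] by simp
  have "ip ((1 / h) *\<^sub>R (S h x - x)) w = ip (A (mean h x)) w"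
    using mean_in_domain[OF h assms(2)] wz h assms(2) A_mem by (intro ip_zero_cong) auto
  also have "\<dots> = mean_ip h x z"
    using assms(1,2) D h wz by (simp add: adjoint_in_def ip_mean)
  finally show ?thesis using h assms(2) wz by (simp add: ip_linear mean_ip_def)
qed

text \<open>Adjoint means supply enough elements of \<open>D(A*)\<close> to test with: for \<open>x \<in> D(A)\<close> the integral of
\<open>\<langle>S(s) A x, y\<rangle>\<close> over \<open>[0, h]\<close> is \<open>\<langle>S(h) x - x, y\<rangle>\<close>.\<close>

lemma adjoint_mean:
  assumes h: "0 < h" and y: "y \<in> H"
  obtains w z where "adjoint_in w z"
    "\<And>x. x \<in> H \<Longrightarrow> ip x w = ip (mean h x) y"
    "\<And>x. x \<in> H \<Longrightarrow> ip x z = ip ((1 / h) *\<^sub>R (S h x - x)) y"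
proof -
  obtain w where w: "w \<in> H" "\<And>x. x \<in> H \<Longrightarrow> ip x w = mean_ip h x y"
    using ex_adjoint_mean[OF assms] by blast
  obtain y' where y': "y' \<in> H" "\<And>x. x \<in> H \<Longrightarrow> ip x y' = ip (S h x) y"
    using ex_adjoint_S[of h y] assms by auto
  define z where "z = (1 / h) *\<^sub>R (y' - y)"
  have z: "z \<in> H" "\<And>x. x \<in> H \<Longrightarrow> ip x z = ip ((1 / h) *\<^sub>R (S h x - x)) y"
    using y y' h by (auto simp: z_def ip_linear)
  have "ip (A x) w = ip x z" if "x \<in> D" for x
  proof -
    have "x \<in> H" "A x \<in> H" using that D_subset A_mem by auto
    then show ?thesis
      using w z(2)[of x] orbit_integral[OF that y, of h] h y by (simp add: mean_ip_def ip_linear)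
  qed
  then have "adjoint_in w z" using w z by (simp add: adjoint_in_def)
  then show ?thesis using that w z(2) ip_mean h y by simp
qed

lemma mean_separates:
  assumes x: "x \<in> H" and y: "y \<in> H" and eq: "\<And>h. 0 < h \<Longrightarrow> ip (mean h x) y = 0"
  shows "ip x y = 0"
proof (rule ccontr)
  assume nz: "ip x y \<noteq> 0"
  define e where "e = \<bar>ip x y\<bar> / (2 * (nrm y + 1))"
  have ny: "0 \<le> nrm y" using y by simp
  have e: "0 < e" using nz ny by (simp add: e_def)
  then obtain d where d: "0 < d" "\<And>r. \<lbrakk>0 \<le> r; r < d\<rbrakk> \<Longrightarrow> nrm (S r x - x) < e"
    using S_near_zero[OF x] by blast
  have "\<bar>mean_ip (d/2) x y - ip x y\<bar> \<le> e * nrm y"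
    using d x y by (intro mean_ip_near less_imp_le[OF d(2)]) auto
  then have "\<bar>ip x y\<bar> \<le> e * nrm y"
    using eq[of "d/2"] ip_mean[of "d/2" x y] d(1) x y by simp
  also have "\<dots> < e * (2 * (nrm y + 1))" using e ny by simp
  also have "\<dots> = \<bar>ip x y\<bar>" using ny by (simp add: e_def)
  finally show False by simp
qed

text \<open>Means lie in \<open>D(A)\<close> and converge to \<open>x\<close>, so \<open>D(A)\<close> is dense and the adjoint is single valued.\<close>

lemma adjoint_unique:
  assumes "adjoint_in w z" "adjoint_in w z'" "x \<in> H"
  shows "ip x z = ip x z'"
proof -
  have H: "z \<in> H" "z' \<in> H" using assms by (auto simp: adjoint_in_def)
  have "ip x (z - z') = 0"
  proof (rule mean_separates)
    show "ip (mean h x) (z - z') = 0" if "0 < h" for h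
      using assms mean_in_domain(1)[OF that assms(3)] that H by (simp add: adjoint_in_def ip_linear)
  qed (use assms H in auto)
  then show ?thesis using H assms(3) by (simp add: ip_linear)
qed

lemma strongly_continuous_difference_quotient:
  assumes "strongly_continuous v" "0 \<le> h"
  shows "strongly_continuous (\<lambda>t. (1 / h) *\<^sub>R (S h (v t) - v t))"
  unfolding strongly_continuous_def
proof (intro conjI allI impI)
  fix t :: real assume t: "0 \<le> t"
  note vH = strongly_continuous_mem[OF assms(1)]
  show "((\<lambda>s. nrm ((1 / h) *\<^sub>R (S h (v s) - v s) - (1 / h) *\<^sub>R (S h (v t) - v t))) \<longlongrightarrow> 0)
      (at t within {0..})"
  proof (rule Lim_null_comparison)
    have "norm (nrm ((1 / h) *\<^sub>R (S h (v s) - v s) - (1 / h) *\<^sub>R (S h (v t) - v t)))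
        \<le> 2 / h * nrm (v s - v t)" if "0 \<le> s" for s
    proof -
      have "(1 / h) *\<^sub>R (S h (v s) - v s) - (1 / h) *\<^sub>R (S h (v t) - v t)
          = (1 / h) *\<^sub>R ((S h (v s) - S h (v t)) + (v t - v s))"
        by (simp add: algebra_simps)
      then have "nrm ((1 / h) *\<^sub>R (S h (v s) - v s) - (1 / h) *\<^sub>R (S h (v t) - v t))
          = \<bar>1 / h\<bar> * nrm ((S h (v s) - S h (v t)) + (v t - v s))"
        using vH that t assms(2) by (simp add: nrm_scale)
      also have "\<dots> \<le> \<bar>1 / h\<bar> * (nrm (S h (v s) - S h (v t)) + nrm (v t - v s))"
        using vH that t assms(2) by (intro mult_left_mono nrm_triangle) auto
      also have "\<dots> \<le> \<bar>1 / h\<bar> * (nrm (v s - v t) + nrm (v s - v t))"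
        using S_lipschitz[OF assms(2) vH[OF that] vH[OF t]] nrm_diff_commute[OF vH[OF t] vH[OF that]]
        by (intro mult_left_mono) auto
      finally show ?thesis using assms(2) vH that t by simp
    qed
    then show "\<forall>\<^sub>F s in at t within {0..}.
        norm (nrm ((1 / h) *\<^sub>R (S h (v s) - v s) - (1 / h) *\<^sub>R (S h (v t) - v t))) \<le> 2 / h * nrm (v s - v t)"
      by (auto simp: eventually_at_filter)
    show "((\<lambda>s. 2 / h * nrm (v s - v t)) \<longlongrightarrow> 0) (at t within {0..})"
      using assms(1) t by (intro tendsto_mult_right_zero) (simp add: strongly_continuous_def)
  qed
qed (use assms strongly_continuous_mem in auto)

text \<open>The mean of \<open>v\<close> over a time \<open>h\<close> is regular enough for the energy argument that \<open>v\<close> itself does not admit.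
The hypothesis provides some \<open>z'\<close> for every \<open>w\<close> because the adjoint of \<open>w\<close> is known as a choice among its
representatives; by \<open>adjoint_unique\<close> all choices give the same pairings.\<close>

lemma weak_solution_zero:
  assumes v: "strongly_continuous v"
    and eq: "\<And>w z. adjoint_in w z \<Longrightarrow>
      \<exists>z'. adjoint_in w z' \<and> (\<forall>t\<ge>0. ip (v t) w = integral {0..t} (\<lambda>s. ip (v s) z'))"
    and t: "0 \<le> t"
  shows "nrm (v t) = 0"
proof -
  note vH = strongly_continuous_mem[OF v]
  have "nrm (mean h (v t)) = 0" if h: "0 < h" for h
  proof -
    define E where "E t = mean h (v t)" for t
    define G where "G t = (1 / h) *\<^sub>R (S h (v t) - v t)" for t
    have E: "E t \<in> H" "E t \<in> D" if "0 \<le> t" for t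
      using h vH[OF that] mean_in_domain by (auto simp: E_def)
    have G: "strongly_continuous G"
      unfolding G_def using v h by (intro strongly_continuous_difference_quotient) auto
    note GH = strongly_continuous_mem[OF G]
    have Gcont: "continuous_on {a..b} (\<lambda>s. ip (G s) y)" if "0 \<le> a" "y \<in> H" for a b y
      by (rule continuous_on_subset[OF continuous_on_ip[OF G that(2)]]) (use that in auto)
    have Eint: "ip (E t) y = integral {0..t} (\<lambda>s. ip (G s) y)" if "0 \<le> t" "y \<in> H" for t y
    proof -
      obtain w z where wz: "adjoint_in w z"
        "\<And>x. x \<in> H \<Longrightarrow> ip x w = ip (mean h x) y"
        "\<And>x. x \<in> H \<Longrightarrow> ip x z = ip ((1 / h) *\<^sub>R (S h x - x)) y"
        using adjoint_mean[OF h \<open>y \<in> H\<close>] by metis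
      obtain z' where z': "adjoint_in w z'"
        "\<And>t. 0 \<le> t \<Longrightarrow> ip (v t) w = integral {0..t} (\<lambda>s. ip (v s) z')"
        using eq[OF wz(1)] by blast
      have "ip (E t) y = integral {0..t} (\<lambda>s. ip (v s) z')"
        using wz(2) z'(2) vH that by (simp add: E_def)
      also have "\<dots> = integral {0..t} (\<lambda>s. ip (G s) y)"
        using adjoint_unique[OF z'(1) wz(1)] wz(3) vH by (intro integral_cong) (simp add: G_def)
      finally show ?thesis .
    qed
    have Ediff: "ip (E b - E a) y = integral {a..b} (\<lambda>s. ip (G s) y)" if "0 \<le> a" "a \<le> b" "y \<in> H" for a b y
      using Henstock_Kurzweil_Integration.integral_combine[of 0 a b "\<lambda>s. ip (G s) y"]
        integrable_continuous_interval[OF Gcont[of 0 y b]] Eint[of a y] Eint[of b y] E that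
      by (simp add: ip_linear)
    \<comment> \<open>\<open>G\<close> is \<open>A E\<close> up to a null difference.\<close>
    have diss: "ip (G t) (E t) \<le> 0" if "0 \<le> t" for t
    proof -
      have "ip (G t) (E t) = ip (A (E t)) (E t)"
        using mean_in_domain[OF h vH[OF that]] GH E A_mem that by (intro ip_zero_cong) (auto simp: E_def G_def)
      then show ?thesis using dissipative E that by simp
    qed
    obtain K where K: "0 \<le> K" "\<And>s. s \<in> {0..t} \<Longrightarrow> nrm (G s) \<le> K"
    proof -
      have "compact ((\<lambda>s. nrm (G s)) ` {0..t})"
        by (intro compact_continuous_image continuous_on_subset[OF continuous_on_nrm[OF G]]) auto
      then obtain K where "\<And>s. s \<in> {0..t} \<Longrightarrow> \<bar>nrm (G s)\<bar> \<le> K"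
        using compact_imp_bounded bounded_real by (metis (no_types, lifting) image_eqI)
      then show ?thesis using that[of "max K 0"] by fastforce
    qed
    \<comment> \<open>By duality the weak integral equation bounds the increments of \<open>E\<close> in norm.\<close>
    have lip: "nrm (E b - E a) \<le> K * \<bar>b - a\<bar>" if "a \<in> {0..t}" "b \<in> {0..t}" for a b
    proof -
      have main: "nrm (E q - E p) \<le> K * (q - p)" if pq: "0 \<le> p" "p \<le> q" "q \<le> t" for p q
      proof (rule nrm_le_dual)
        show "E q - E p \<in> H" using E pq by simp
        show "0 \<le> K * (q - p)" using K pq by simp
        fix y assume y: "y \<in> H"
        have "norm (integral {p..q} (\<lambda>s. ip (G s) y)) \<le> K * nrm y * (q - p)"
        proof (rule integral_bound)
          fix s assume "s \<in> {p..q}"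
          then have "norm (ip (G s) y) \<le> nrm (G s) * nrm y" "nrm (G s) \<le> K"
            using Cauchy_Schwarz GH y K(2)[of s] pq by auto
          then show "norm (ip (G s) y) \<le> K * nrm y"
            using y by (meson mult_right_mono nrm_nonneg order_trans)
        qed (use pq y Gcont in auto)
        then show "\<bar>ip (E q - E p) y\<bar> \<le> K * (q - p) * nrm y"
          using Ediff pq y by (simp add: mult_ac)
      qed
      show ?thesis
        using main[of a b] main[of b a] nrm_diff_commute[of "E a" "E b"] E that
        by (cases "a \<le> b") (auto simp: abs_if)
    qed
    have deriv: "\<exists>y. ((\<lambda>s. ip (E s) (E s)) has_real_derivative y) (at a) \<and> y \<le> 0"
      if a: "0 < a" "a < t" for a
    proof (intro exI conjI)
      have EaH: "E a \<in> H" using E a by simp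
      have "((\<lambda>s. integral {0..s} (\<lambda>s. ip (G s) (E a))) has_real_derivative ip (G a) (E a)) (at a within {0..t})"
        using integral_has_real_derivative[OF Gcont[of 0 "E a" t]] EaH a by auto
      then have "((\<lambda>s. integral {0..s} (\<lambda>s. ip (G s) (E a))) has_real_derivative ip (G a) (E a)) (at a)"
        using a by (simp add: at_within_Icc_at)
      then have 1: "((\<lambda>s. ip (E s) (E a)) has_real_derivative ip (G a) (E a)) (at a)"
      proof (rule DERIV_cong_ev[THEN iffD1, rotated -1])
        have "\<forall>\<^sub>F s in nhds a. s > 0" using a by (intro order_tendstoD[OF filterlim_ident]) 
        then show "\<forall>\<^sub>F s in nhds a. integral {0..s} (\<lambda>s. ip (G s) (E a)) = ip (E s) (E a)"
          by eventually_elim (use Eint EaH in auto)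
      qed auto
      \<comment> \<open>\<open>\<parallel>E s\<parallel>\<^sup>2\<close> is linear in \<open>E s\<close> up to \<open>\<parallel>E s - E a\<parallel>\<^sup>2\<close>, which the Lipschitz bound makes quadratically small.\<close>
      have 2: "((\<lambda>s. ip (E s - E a) (E s - E a)) has_real_derivative 0) (at a)"
        unfolding has_field_derivative_iff
      proof (rule Lim_null_comparison)
        have "\<forall>\<^sub>F s in at a. s \<in> {0<..<t}" using a by (intro eventually_at_in_open') auto
        then show "\<forall>\<^sub>F s in at a. norm ((ip (E s - E a) (E s - E a) - ip (E a - E a) (E a - E a)) / (s - a))
            \<le> K\<^sup>2 * \<bar>s - a\<bar>"
        proof eventually_elim
          case (elim s)
          have H: "E s - E a \<in> H" using E elim a by simp
          have "ip (E s - E a) (E s - E a) \<le> (K * \<bar>s - a\<bar>)\<^sup>2"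
            using lip[of a s] nrm_square[OF H] nrm_nonneg[OF H] elim a
            by (metis atLeastAtMost_iff greaterThanLessThan_iff less_imp_le power_mono)
          then have "norm (ip (E s - E a) (E s - E a) / (s - a)) \<le> (K * \<bar>s - a\<bar>)\<^sup>2 / \<bar>s - a\<bar>"
            using ip_nonneg[OF H] by (simp add: divide_right_mono)
          also have "\<dots> = K\<^sup>2 * \<bar>s - a\<bar>" by (simp add: power2_eq_square)
          finally show ?case using EaH by (simp add: ip_linear)
        qed
        show "((\<lambda>s. K\<^sup>2 * \<bar>s - a\<bar>) \<longlongrightarrow> 0) (at a)"
          by (auto intro!: tendsto_eq_intros)
      qed
      have "((\<lambda>s. 2 * ip (E s) (E a) + ip (E s - E a) (E s - E a) - ip (E a) (E a))
          has_real_derivative 2 * ip (G a) (E a)) (at a)"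
        using 1 2 by (auto intro!: derivative_eq_intros)
      then show "((\<lambda>s. ip (E s) (E s)) has_real_derivative 2 * ip (G a) (E a)) (at a)"
      proof (rule DERIV_cong_ev[THEN iffD1, rotated -1])
        have "\<forall>\<^sub>F s in nhds a. s > 0" using a by (intro order_tendstoD[OF filterlim_ident]) 
        then show "\<forall>\<^sub>F s in nhds a. 2 * ip (E s) (E a) + ip (E s - E a) (E s - E a) - ip (E a) (E a)
            = ip (E s) (E s)"
          by eventually_elim (use E EaH in \<open>simp add: ip_linear ip_commute\<close>)
      qed auto
      show "2 * ip (G a) (E a) \<le> 0" using diss[of a] a by simp
    qed
    have "continuous_on {0..t} (\<lambda>s. nrm (E s))"
    proof (rule continuous_onI)
      fix a e :: real assume a: "a \<in> {0..t}" and e: "0 < e"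
      have "dist (nrm (E s)) (nrm (E a)) \<le> e" if "s \<in> {0..t}" "dist s a < e / (K + 1)" for s
      proof -
        have "\<bar>nrm (E s) - nrm (E a)\<bar> \<le> nrm (E s - E a)"
          using nrm_triangle[of "E s - E a" "E a"] nrm_triangle[of "E a - E s" "E s"]
            nrm_diff_commute[of "E s" "E a"] E that a by auto
        also have "\<dots> \<le> (K + 1) * \<bar>s - a\<bar>" using lip[of a s] a that by (simp add: distrib_right)
        also have "\<dots> \<le> e" using that K by (simp add: dist_real_def field_simps)
        finally show ?thesis by (simp add: dist_real_def)
      qed
      then show "\<exists>d>0. \<forall>x'\<in>{0..t}. dist x' a < d \<longrightarrow> dist (nrm (E x')) (nrm (E a)) \<le> e"
        using e K by (intro exI[of _ "e / (K + 1)"]) auto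
    qed
    then have "continuous_on {0..t} (\<lambda>s. (nrm (E s))\<^sup>2)"
      by (intro continuous_on_power)
    also have "?this \<longleftrightarrow> continuous_on {0..t} (\<lambda>s. ip (E s) (E s))"
      using E nrm_square by (intro continuous_on_cong) auto
    finally have cont: "continuous_on {0..t} (\<lambda>s. ip (E s) (E s))" .
    have "ip (E t) (E t) \<le> ip (E 0) (E 0)"
      using DERIV_nonpos_imp_decreasing_open[OF t _ cont] deriv by blast
    also have "ip (E 0) (E 0) = 0" using Eint[of 0 "E 0"] E(1)[of 0] by simp
    finally have "ip (E t) (E t) = 0" using ip_nonneg[OF E(1)[OF t]] by linarith
    then show ?thesis by (simp add: nrm_def E_def)
  qed
  then have "ip (mean h (v t)) (v t) = 0" if "0 < h" for h
    using Cauchy_Schwarz[OF mean_mem[OF that vH[OF t]] vH[OF t]] that by simp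
  then have "ip (v t) (v t) = 0"
    using mean_separates[OF vH[OF t] vH[OF t]] by blast
  then show ?thesis by (simp add: nrm_def)
qed

end

section \<open>Absolutely continuous functions\<close>

lemma sum_lengths_le_measure:
  fixes p q :: "nat \<Rightarrow> real"
  assumes "\<And>k. k < n \<Longrightarrow> p k \<le> q k \<and> {p k<..<q k} \<subseteq> G"
    and "\<And>k l. \<lbrakk>k < n; l < n; k \<noteq> l\<rbrakk> \<Longrightarrow> {p k<..<q k} \<inter> {p l<..<q l} = {}"
    and G: "G \<in> lmeasurable"
  shows "(\<Sum>k<n. q k - p k) \<le> measure lebesgue G"
proof -
  have "(\<Sum>k<n. q k - p k) = (\<Sum>k<n. measure lebesgue {p k<..<q k})"
    using assms(1) by (intro sum.cong) auto
  also have "\<dots> = measure lebesgue (\<Union>k<n. {p k<..<q k})"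
    using assms(2) by (intro measure_UNION'[symmetric]) (auto simp: pairwise_def disjnt_def)
  also have "\<dots> \<le> measure lebesgue G"
    using assms(1) G by (intro measure_mono_fmeasurable) auto
  finally show ?thesis .
qed

text \<open>Absolute continuity in the form used for tagged divisions: nonoverlapping intervals inside a set of small
measure carry a small variation of \<open>f\<close>.\<close>

lemma abs_cont_on_tagged:
  assumes ac: "abs_cont_on a b f" and e: "0 < e"
  obtains d where "0 < d"
    "\<And>P G. \<lbrakk>P tagged_partial_division_of {a..b}; G \<in> lmeasurable; measure lebesgue G < d;
        \<forall>(x, K)\<in>P. K \<subseteq> G\<rbrakk> \<Longrightarrow> (\<Sum>(x, K)\<in>P. \<bar>f (Sup K) - f (Inf K)\<bar>) < e"
proof -
  obtain d where d: "0 < d" "\<forall>(N::nat) p q.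
        (\<forall>k<N. a \<le> p k \<and> p k \<le> q k \<and> q k \<le> b) \<and>
        (\<forall>k<N. \<forall>l<N. k \<noteq> l \<longrightarrow> {p k<..<q k} \<inter> {p l<..<q l} = {}) \<and>
        (\<Sum>k<N. q k - p k) < d
        \<longrightarrow> (\<Sum>k<N. \<bar>f (q k) - f (p k)\<bar>) < e"
    using ac e unfolding abs_cont_on_def by blast
  have "(\<Sum>(x, K)\<in>P. \<bar>f (Sup K) - f (Inf K)\<bar>) < e"
    if P: "P tagged_partial_division_of {a..b}" and G: "G \<in> lmeasurable" "measure lebesgue G < d"
      and sub: "\<forall>(x, K)\<in>P. K \<subseteq> G" for P G
  proof -
    have fin: "finite P" using tagged_partial_division_ofD(1)[OF P] .
    then obtain h where h: "bij_betw h {..<card P} P"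
      using ex_bij_betw_nat_finite atLeast0LessThan by metis
    define p where "p k = Inf (snd (h k))" for k
    define q where "q k = Sup (snd (h k))" for k
    have hP: "(fst (h k), snd (h k)) \<in> P" if "k < card P" for k
      using bij_betwE[OF h] that by simp
    have K: "snd (h k) = {p k..q k} \<and> p k \<le> q k \<and> a \<le> p k \<and> q k \<le> b \<and> {p k..q k} \<subseteq> G"
      if k: "k < card P" for k
    proof -
      obtain u v where uv: "snd (h k) = {u..v}"
        using tagged_partial_division_ofD(4)[OF P hP[OF k]] by auto
      moreover have "fst (h k) \<in> snd (h k)" "snd (h k) \<subseteq> {a..b}"
        using tagged_partial_division_ofD(2,3)[OF P hP[OF k]] by auto
      ultimately have "u \<le> v" "p k = u" "q k = v" by (auto simp: p_def q_def)
      then show ?thesis using uv \<open>snd (h k) \<subseteq> {a..b}\<close> sub hP[OF k] by auto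
    qed
    have disj: "{p k<..<q k} \<inter> {p l<..<q l} = {}" if "k < card P" "l < card P" "k \<noteq> l" for k l
    proof -
      have "h k \<noteq> h l" using h that by (auto simp: bij_betw_def inj_on_def)
      then have "interior (snd (h k)) \<inter> interior (snd (h l)) = {}"
        using tagged_partial_division_ofD(5)[OF P hP[OF that(1)] hP[OF that(2)]] by (metis prod.collapse)
      then show ?thesis using K that by simp
    qed
    have "(\<Sum>k<card P. q k - p k) \<le> measure lebesgue G"
      using K disj G(1) by (intro sum_lengths_le_measure) force+
    then have "(\<Sum>k<card P. \<bar>f (q k) - f (p k)\<bar>) < e"
      using K disj G(2) by (intro d(2)[rule_format]) auto
    also have "(\<Sum>k<card P. \<bar>f (q k) - f (p k)\<bar>) = (\<Sum>(x, K)\<in>P. \<bar>f (Sup K) - f (Inf K)\<bar>)"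
      using sum.reindex_bij_betw[OF h, of "\<lambda>(x, K). \<bar>f (Sup K) - f (Inf K)\<bar>"]
      by (simp add: p_def q_def case_prod_unfold)
    finally show ?thesis .
  qed
  then show ?thesis using that d(1) by blast
qed

lemma derivative_straddle:
  fixes f :: "real \<Rightarrow> real"
  assumes "(f has_real_derivative D) (at x)" "0 < e"
  obtains r where "0 < r"
    "\<And>u v. \<lbrakk>u \<le> x; x \<le> v; {u..v} \<subseteq> ball x r\<rbrakk> \<Longrightarrow> \<bar>(v - u) * D - (f v - f u)\<bar> \<le> e * (v - u)"
proof -
  obtain r where r: "0 < r" "\<And>y. norm (y - x) < r \<Longrightarrow> norm (f y - f x - D * (y - x)) \<le> e * norm (y - x)"
    using assms unfolding has_field_derivative_def has_derivative_at_alt by blast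
  have "\<bar>(v - u) * D - (f v - f u)\<bar> \<le> e * (v - u)" if "u \<le> x" "x \<le> v" "{u..v} \<subseteq> ball x r" for u v
  proof -
    have "u \<in> {u..v}" "v \<in> {u..v}" using that by auto
    then have "u \<in> ball x r" "v \<in> ball x r" using that(3) by blast+
    then have "\<bar>f u - f x - D * (u - x)\<bar> \<le> e * (x - u)" "\<bar>f v - f x - D * (v - x)\<bar> \<le> e * (v - x)"
      using r(2)[of u] r(2)[of v] that by (auto simp: dist_real_def)
    moreover have "(v - u) * D - (f v - f u) = (f u - f x - D * (u - x)) - (f v - f x - D * (v - x))"
      by (simp add: algebra_simps)
    ultimately show ?thesis by (simp add: algebra_simps)
  qed
  then show ?thesis using that r(1) by blast
qed

text \<open>For a division that is fine enough, the intervals with tag outside \<open>N\<close> are controlled by the derivative at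
the tag.  Those with tag in \<open>N\<close> lie in an open set of small measure around \<open>N\<close>, where absolute continuity
makes the increments of \<open>f\<close> negligible.\<close>

theorem abs_cont_on_has_integral:
  assumes ac: "abs_cont_on a b f" and ab: "a \<le> b" and N: "N \<in> null_sets lebesgue"
    and deriv: "\<And>x. x \<in> {a..b} - N \<Longrightarrow> (f has_real_derivative g x) (at x)"
  shows "(g has_integral (f b - f a)) {a..b}"
proof -
  define g0 where "g0 x = (if x \<in> N then 0 else g x)" for x
  have "(g0 has_integral (f b - f a)) (cbox a b)"
    unfolding has_integral
  proof (intro allI impI)
    fix e :: real assume e: "0 < e"
    \<comment> \<open>The summand \<open>1\<close> keeps the denominator positive when \<open>a = b\<close>.\<close>
    define e' where "e' = e / (2 * (b - a + 1))"
    have e': "0 < e'" using e ab by (simp add: e'_def)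
    obtain d where d: "0 < d"
      "\<And>P G. \<lbrakk>P tagged_partial_division_of {a..b}; G \<in> lmeasurable; measure lebesgue G < d;
        \<forall>(x, K)\<in>P. K \<subseteq> G\<rbrakk> \<Longrightarrow> (\<Sum>(x, K)\<in>P. \<bar>f (Sup K) - f (Inf K)\<bar>) < e / 2"
      using abs_cont_on_tagged[OF ac half_gt_zero[OF e]] by blast
    obtain G where G: "open G" "N \<subseteq> G" "G \<in> lmeasurable" "measure lebesgue G < d"
    proof -
      obtain T where T: "open T" "N \<subseteq> T" "T - N \<in> lmeasurable" "emeasure lebesgue (T - N) < ennreal d"
        using sets_lebesgue_outer_open[of N d] N d(1) by auto
      have m: "emeasure lebesgue T = emeasure lebesgue (T - N)"
        using N T(1) by (intro emeasure_Diff_null_set[symmetric]) auto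
      then have fm: "T \<in> lmeasurable"
        using T by (intro fmeasurableI) (auto simp: less_top[symmetric] top_unique)
      then have "ennreal (measure lebesgue T) < ennreal d"
        using T(4) m by (simp add: emeasure_eq_measure2)
      then have "measure lebesgue T < d" by (simp add: ennreal_less_iff)
      then show ?thesis using that T fm by blast
    qed
    have "\<forall>x. \<exists>r>0. (x \<in> N \<longrightarrow> ball x r \<subseteq> G) \<and> (x \<in> {a..b} - N \<longrightarrow>
        (\<forall>u v. u \<le> x \<and> x \<le> v \<and> {u..v} \<subseteq> ball x r \<longrightarrow> \<bar>(v - u) * g x - (f v - f u)\<bar> \<le> e' * (v - u)))"
    proof
      fix x
      consider "x \<in> N" | "x \<in> {a..b} - N" | "x \<notin> N" "x \<notin> {a..b}" by blast
      then show "\<exists>r>0. (x \<in> N \<longrightarrow> ball x r \<subseteq> G) \<and> (x \<in> {a..b} - N \<longrightarrow>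
        (\<forall>u v. u \<le> x \<and> x \<le> v \<and> {u..v} \<subseteq> ball x r \<longrightarrow> \<bar>(v - u) * g x - (f v - f u)\<bar> \<le> e' * (v - u)))"
      proof cases
        case 1
        then have "x \<in> G" using G(2) by blast
        then obtain r where "0 < r" "ball x r \<subseteq> G" by (rule openE[OF G(1)])
        then show ?thesis using 1 by (intro exI[of _ r]) simp
      next
        case 2
        obtain r where "0 < r" "\<And>u v. \<lbrakk>u \<le> x; x \<le> v; {u..v} \<subseteq> ball x r\<rbrakk>
            \<Longrightarrow> \<bar>(v - u) * g x - (f v - f u)\<bar> \<le> e' * (v - u)"
          using derivative_straddle[OF deriv[OF 2] e'] by blast
        then show ?thesis using 2 by (intro exI[of _ r]) simp
      next
        case 3
        then show ?thesis by (intro exI[of _ 1]) auto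
      qed
    qed
    then obtain r where r: "\<And>x. 0 < r x" "\<And>x. x \<in> N \<Longrightarrow> ball x (r x) \<subseteq> G"
      "\<And>x u v. \<lbrakk>x \<in> {a..b} - N; u \<le> x; x \<le> v; {u..v} \<subseteq> ball x (r x)\<rbrakk>
        \<Longrightarrow> \<bar>(v - u) * g x - (f v - f u)\<bar> \<le> e' * (v - u)"
      by metis
    show "\<exists>\<gamma>. gauge \<gamma> \<and> (\<forall>\<D>. \<D> tagged_division_of cbox a b \<and> \<gamma> fine \<D> \<longrightarrow>
        norm ((\<Sum>(x, k)\<in>\<D>. measure lborel k *\<^sub>R g0 x) - (f b - f a)) < e)"
    proof (intro exI conjI allI impI)
      show "gauge (\<lambda>x. ball x (r x))"
        using r(1) by (rule gauge_ball_dependent[rule_format])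
    next
      fix P assume "P tagged_division_of cbox a b \<and> (\<lambda>x. ball x (r x)) fine P"
      then have P: "P tagged_division_of {a..b}" and fine: "(\<lambda>x. ball x (r x)) fine P" by auto
      have fin: "finite P" using P by auto
      define F where "F = (\<lambda>(x, K). measure lborel K *\<^sub>R g0 x - (f (Sup K) - f (Inf K)))"
      have sums: "b - a = (\<Sum>(x, K)\<in>P. Sup K - Inf K)" "f b - f a = (\<Sum>(x, K)\<in>P. f (Sup K) - f (Inf K))"
        by (rule additive_tagged_division_1[OF ab P, symmetric])+
      have iv: "\<exists>u v. K = {u..v} \<and> u \<le> x \<and> x \<le> v \<and> x \<in> {a..b} \<and> {u..v} \<subseteq> ball x (r x)" if "(x, K) \<in> P" for x K
      proof -
        have "x \<in> K" "K \<subseteq> {a..b}" using that P by blast+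
        moreover obtain u v where "K = {u..v}"
          using tagged_division_ofD(4)[OF P \<open>(x, K) \<in> P\<close>] by auto
        moreover have "K \<subseteq> ball x (r x)" using fine \<open>(x, K) \<in> P\<close> unfolding fine_def by blast
        ultimately show ?thesis by (intro exI[of _ u] exI[of _ v]) auto
      qed
      \<comment> \<open>Both parts of the division contribute at most \<open>e / 2\<close>.\<close>
      let ?N = "{z \<in> P. fst z \<in> N}" and ?R = "{z \<in> P. fst z \<notin> N}"
      have "?N tagged_partial_division_of {a..b}"
        by (rule tagged_partial_division_subset[of P]) (use P in \<open>auto simp: tagged_division_of_def\<close>)
      then have "(\<Sum>(x, K)\<in>?N. \<bar>f (Sup K) - f (Inf K)\<bar>) < e / 2"
      proof (rule d(2)[OF _ G(3,4)])
        have "K \<subseteq> G" if K: "(x, K) \<in> P" "x \<in> N" for x K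
        proof -
          obtain u v where "K = {u..v}" "{u..v} \<subseteq> ball x (r x)" using iv[OF K(1)] by blast
          then show ?thesis using r(2)[OF K(2)] by simp
        qed
        then show "\<forall>(x, K)\<in>?N. K \<subseteq> G" by auto
      qed
      moreover have "(\<Sum>z\<in>?N. \<bar>F z\<bar>) = (\<Sum>(x, K)\<in>?N. \<bar>f (Sup K) - f (Inf K)\<bar>)"
        by (intro sum.cong) (auto simp: F_def g0_def)
      ultimately have bad: "(\<Sum>z\<in>?N. \<bar>F z\<bar>) < e / 2" by simp
      have "(\<Sum>z\<in>?R. \<bar>F z\<bar>) \<le> (\<Sum>z\<in>?R. e' * (Sup (snd z) - Inf (snd z)))"
      proof (rule sum_mono)
        fix z assume "z \<in> ?R"
        then obtain x K where z: "z = (x, K)" "(x, K) \<in> P" "x \<notin> N" by (cases z) auto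
        then obtain u v where uv: "K = {u..v}" "u \<le> x" "x \<le> v" "x \<in> {a..b}" "{u..v} \<subseteq> ball x (r x)"
          using iv[OF z(2)] by blast
        show "\<bar>F z\<bar> \<le> e' * (Sup (snd z) - Inf (snd z))"
          using r(3)[of x u v] uv z by (simp add: F_def g0_def)
      qed
      also have "\<dots> \<le> (\<Sum>z\<in>P. e' * (Sup (snd z) - Inf (snd z)))"
      proof (intro sum_mono2)
        fix z assume "z \<in> P - ?R"
        then obtain u v where "snd z = {u..v}" "u \<le> v"
          using iv[of "fst z" "snd z"] by auto
        then show "0 \<le> e' * (Sup (snd z) - Inf (snd z))" using e' by simp
      qed (use fin in auto)
      also have "\<dots> = e' * (b - a)"
        unfolding sums(1) by (simp add: sum_distrib_left case_prod_unfold)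
      also have "\<dots> \<le> e / 2"
        using e ab by (simp add: e'_def field_simps)
      finally have good: "(\<Sum>z\<in>?R. \<bar>F z\<bar>) \<le> e / 2" .
      have "(\<Sum>(x, k)\<in>P. measure lborel k *\<^sub>R g0 x) - (f b - f a) = (\<Sum>z\<in>P. F z)"
        unfolding sums(2) by (simp add: F_def sum_subtractf case_prod_unfold)
      also have "norm \<dots> \<le> (\<Sum>z\<in>P. \<bar>F z\<bar>)" by simp
      also have "(\<Sum>z\<in>P. \<bar>F z\<bar>) = (\<Sum>z\<in>?N. \<bar>F z\<bar>) + (\<Sum>z\<in>?R. \<bar>F z\<bar>)"
        using fin by (subst sum.union_disjoint[symmetric]) (auto intro: sum.cong)
      also have "\<dots> < e" using bad good by simp
      finally show "norm ((\<Sum>(x, k)\<in>P. measure lborel k *\<^sub>R g0 x) - (f b - f a)) < e" .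
    qed
  qed
  then have "(g0 has_integral (f b - f a)) {a..b}" by simp
  then show ?thesis
    using N by (elim has_integral_spike[rotated 2]) (auto simp: g0_def negligible_iff_null_sets)
qed

lemma abs_cont_on_lipschitz:
  assumes K: "0 \<le> K" and lip: "\<And>p q. \<lbrakk>a \<le> p; p \<le> q; q \<le> b\<rbrakk> \<Longrightarrow> \<bar>f q - f p\<bar> \<le> K * (q - p)"
  shows "abs_cont_on a b f"
  unfolding abs_cont_on_def
proof (intro allI impI)
  fix e :: real assume e: "0 < e"
  show "\<exists>d>0. \<forall>(N::nat) p q.
        (\<forall>k<N. a \<le> p k \<and> p k \<le> q k \<and> q k \<le> b) \<and>
        (\<forall>k<N. \<forall>l<N. k \<noteq> l \<longrightarrow> {p k<..<q k} \<inter> {p l<..<q l} = {}) \<and>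
        (\<Sum>k<N. q k - p k) < d
        \<longrightarrow> (\<Sum>k<N. \<bar>f (q k) - f (p k)\<bar>) < e"
  proof (intro exI conjI allI impI)
    show "0 < e / (K + 1)" using e K by simp
    fix N :: nat and p q :: "nat \<Rightarrow> real"
    assume h: "(\<forall>k<N. a \<le> p k \<and> p k \<le> q k \<and> q k \<le> b) \<and>
        (\<forall>k<N. \<forall>l<N. k \<noteq> l \<longrightarrow> {p k<..<q k} \<inter> {p l<..<q l} = {}) \<and>
        (\<Sum>k<N. q k - p k) < e / (K + 1)"
    have "(\<Sum>k<N. \<bar>f (q k) - f (p k)\<bar>) \<le> (\<Sum>k<N. (K + 1) * (q k - p k))"
    proof (rule sum_mono)
      fix k assume "k \<in> {..<N}"
      then have k: "a \<le> p k" "p k \<le> q k" "q k \<le> b" using h by auto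
      show "\<bar>f (q k) - f (p k)\<bar> \<le> (K + 1) * (q k - p k)"
        using lip[OF k] k(2) by (simp add: distrib_right)
    qed
    also have "\<dots> = (K + 1) * (\<Sum>k<N. q k - p k)" by (simp add: sum_distrib_left)
    also have "\<dots> < (K + 1) * (e / (K + 1))" using h K by (intro mult_strict_left_mono) auto
    also have "\<dots> = e" using K by simp
    finally show "(\<Sum>k<N. \<bar>f (q k) - f (p k)\<bar>) < e" .
  qed
qed

section \<open>Square integrable fields\<close>

lemma norm_square_add_le:
  fixes x y :: "'b::real_normed_vector"
  shows "(norm (x + y))\<^sup>2 \<le> 2 * (norm x)\<^sup>2 + 2 * (norm y)\<^sup>2"
proof -
  have "(norm (x + y))\<^sup>2 \<le> (norm x + norm y)\<^sup>2"
    by (intro power_mono norm_triangle_ineq) simp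
  moreover have "0 \<le> (norm x - norm y)\<^sup>2" by simp
  ultimately show ?thesis by (simp add: power2_sum power2_diff)
qed

context finite_measure
begin

lemma integrable_norm_of_square:
  fixes f :: "'a \<Rightarrow> 'b::euclidean_space"
  assumes "f \<in> borel_measurable M" "integrable M (\<lambda>x. (norm (f x))\<^sup>2)"
  shows "integrable M (\<lambda>x. norm (f x))"
  by (rule square_integrable_imp_integrable) (use assms in measurable)

lemma integral_norm_le_square:
  fixes f :: "'a \<Rightarrow> 'b::euclidean_space"
  assumes "f \<in> borel_measurable M" "integrable M (\<lambda>x. (norm (f x))\<^sup>2)"
  shows "(\<integral>x. norm (f x) \<partial>M)\<^sup>2 \<le> measure M (space M) * (\<integral>x. (norm (f x))\<^sup>2 \<partial>M)"
proof -
  have "(\<integral>x. norm (f x) \<partial>M)\<^sup>2 \<le> (\<integral>x. (norm (f x))\<^sup>2 \<partial>M) * measure M (space M)"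
  proof (rule quadratic_nonneg_imp_discriminant)
    fix t :: real
    have "0 \<le> (\<integral>x. (norm (f x) + t)\<^sup>2 \<partial>M)" by simp
    also have "(\<integral>x. (norm (f x) + t)\<^sup>2 \<partial>M) = (\<integral>x. (norm (f x))\<^sup>2 + 2 * t * norm (f x) + t\<^sup>2 \<partial>M)"
      by (simp add: power2_sum algebra_simps)
    also have "\<dots> = (\<integral>x. (norm (f x))\<^sup>2 \<partial>M) + 2 * t * (\<integral>x. norm (f x) \<partial>M) + t\<^sup>2 * measure M (space M)"
      using assms integrable_norm_of_square[OF assms] by simp
    finally show "0 \<le> (\<integral>x. (norm (f x))\<^sup>2 \<partial>M) + 2 * t * (\<integral>x. norm (f x) \<partial>M) + t\<^sup>2 * measure M (space M)" .
  qed simp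
  then show ?thesis by (simp add: mult.commute)
qed

text \<open>On a finite measure space a Cauchy sequence in \<open>L\<^sup>2\<close> is Cauchy in \<open>L\<^sup>1\<close>, hence has a subsequence that converges
almost everywhere; Fatou's lemma identifies the limit in \<open>L\<^sup>2\<close>.  The subsequence is part of the conclusion
since pointwise constraints, such as symmetry, pass to the limit through it.\<close>

theorem square_integrable_complete:
  fixes X :: "nat \<Rightarrow> 'a \<Rightarrow> 'b::euclidean_space"
  assumes meas [measurable]: "\<And>n. X n \<in> borel_measurable M"
    and int: "\<And>n. integrable M (\<lambda>x. (norm (X n x))\<^sup>2)"
    and Cauchy: "\<And>e. 0 < e \<Longrightarrow> \<exists>N. \<forall>m\<ge>N. \<forall>n\<ge>N. (\<integral>x. (norm (X m x - X n x))\<^sup>2 \<partial>M) < e"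
  obtains g r where "g \<in> borel_measurable M" "integrable M (\<lambda>x. (norm (g x))\<^sup>2)"
    "(\<lambda>n. \<integral>x. (norm (X n x - g x))\<^sup>2 \<partial>M) \<longlonglongrightarrow> 0"
    "strict_mono r" "AE x in M. (\<lambda>k. X (r k) x) \<longlonglongrightarrow> g x"
proof -
  have int_diff: "integrable M (\<lambda>x. (norm (f x - h x))\<^sup>2)"
    if [measurable]: "f \<in> borel_measurable M" "h \<in> borel_measurable M"
      and "integrable M (\<lambda>x. (norm (f x))\<^sup>2)" "integrable M (\<lambda>x. (norm (h x))\<^sup>2)"
    for f h :: "'a \<Rightarrow> 'b"
  proof (rule Bochner_Integration.integrable_bound)
    show "integrable M (\<lambda>x. 2 * (norm (f x))\<^sup>2 + 2 * (norm (h x))\<^sup>2)" using that by simp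
    show "AE x in M. norm ((norm (f x - h x))\<^sup>2) \<le> norm (2 * (norm (f x))\<^sup>2 + 2 * (norm (h x))\<^sup>2)"
      using norm_square_add_le[of "f x" "- h x" for x] by simp
  qed measurable
  have L1: "integrable M (X n)" for n
    using integrable_norm_of_square[OF meas int] by (simp add: integrable_norm_iff)
  define \<mu> where "\<mu> = measure M (space M)"
  have \<mu>: "0 \<le> \<mu>" by (simp add: \<mu>_def)
  obtain r where r: "strict_mono r" "AE x in M. Cauchy (\<lambda>k. X (r k) x)"
  proof (rule cauchy_L1_AE_cauchy_subseq[of M X])
    show "integrable M (X n)" for n by (rule L1)
    show "\<exists>N. \<forall>i\<ge>N. \<forall>j\<ge>N. (\<integral>x. norm (X i x - X j x) \<partial>M) < e" if e: "0 < e" for e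
    proof -
      obtain N where N: "\<And>m n. \<lbrakk>N \<le> m; N \<le> n\<rbrakk> \<Longrightarrow> (\<integral>x. (norm (X m x - X n x))\<^sup>2 \<partial>M) < e\<^sup>2 / (\<mu> + 1)"
        using Cauchy[of "e\<^sup>2 / (\<mu> + 1)"] e \<mu> by auto
      have "(\<integral>x. norm (X i x - X j x) \<partial>M) < e" if "N \<le> i" "N \<le> j" for i j
      proof (rule power2_less_imp_less)
        have "(\<integral>x. norm (X i x - X j x) \<partial>M)\<^sup>2 \<le> \<mu> * (\<integral>x. (norm (X i x - X j x))\<^sup>2 \<partial>M)"
          unfolding \<mu>_def by (intro integral_norm_le_square int_diff int) measurable
        also have "\<dots> \<le> \<mu> * (e\<^sup>2 / (\<mu> + 1))"
          using N[OF that] \<mu> by (intro mult_left_mono) auto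
        also have "\<dots> < e\<^sup>2" using e \<mu> by (simp add: field_simps)
        finally show "(\<integral>x. norm (X i x - X j x) \<partial>M)\<^sup>2 < e\<^sup>2" .
      qed (use e in simp)
      then show ?thesis by blast
    qed
  qed
  define g where "g x = lim (\<lambda>k. X (r k) x)" for x
  have g [measurable]: "g \<in> borel_measurable M" unfolding g_def by measurable
  have lim: "AE x in M. (\<lambda>k. X (r k) x) \<longlonglongrightarrow> g x"
    using r(2) by eventually_elim (simp add: g_def Cauchy_convergent_iff convergent_LIMSEQ_iff)
  have fatou: "(\<integral>\<^sup>+x. ennreal ((norm (X n x - g x))\<^sup>2) \<partial>M) \<le> ennreal e"
    if N: "\<And>m. N \<le> m \<Longrightarrow> (\<integral>x. (norm (X n x - X m x))\<^sup>2 \<partial>M) < e" for n N e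
  proof -
    have "(\<integral>\<^sup>+x. ennreal ((norm (X n x - g x))\<^sup>2) \<partial>M)
        = (\<integral>\<^sup>+x. liminf (\<lambda>k. ennreal ((norm (X n x - X (r k) x))\<^sup>2)) \<partial>M)"
    proof (rule nn_integral_cong_AE)
      show "AE x in M. ennreal ((norm (X n x - g x))\<^sup>2) = liminf (\<lambda>k. ennreal ((norm (X n x - X (r k) x))\<^sup>2))"
        using lim
      proof eventually_elim
        case (elim x)
        then have "(\<lambda>k. ennreal ((norm (X n x - X (r k) x))\<^sup>2)) \<longlonglongrightarrow> ennreal ((norm (X n x - g x))\<^sup>2)"
          by (intro tendsto_ennrealI tendsto_intros)
        then show ?case by (rule lim_imp_Liminf[OF sequentially_bot, symmetric])
      qed
    qed
    also have "\<dots> \<le> liminf (\<lambda>k. \<integral>\<^sup>+x. ennreal ((norm (X n x - X (r k) x))\<^sup>2) \<partial>M)"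
      by (rule nn_integral_liminf) measurable
    also have "\<dots> \<le> ennreal e"
    proof (rule Liminf_le)
      show "\<forall>\<^sub>F k in sequentially. (\<integral>\<^sup>+x. ennreal ((norm (X n x - X (r k) x))\<^sup>2) \<partial>M) \<le> ennreal e"
        unfolding eventually_sequentially
      proof (intro exI allI impI)
        fix k assume "N \<le> k"
        then have "N \<le> r k" using seq_suble[OF r(1)] order_trans by blast
        then show "(\<integral>\<^sup>+x. ennreal ((norm (X n x - X (r k) x))\<^sup>2) \<partial>M) \<le> ennreal e"
          using N[of "r k"] by (subst nn_integral_eq_integral) (auto intro!: int_diff int ennreal_leI)
      qed
    qed simp
    finally show ?thesis .
  qed
  have int_Xg: "integrable M (\<lambda>x. (norm (X n x - g x))\<^sup>2) \<and> (\<integral>x. (norm (X n x - g x))\<^sup>2 \<partial>M) \<le> e"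
    if e: "0 \<le> e" and N: "\<And>m. N \<le> m \<Longrightarrow> (\<integral>x. (norm (X n x - X m x))\<^sup>2 \<partial>M) < e" for n N e
  proof
    have fin: "(\<integral>\<^sup>+x. ennreal ((norm (X n x - g x))\<^sup>2) \<partial>M) \<le> ennreal e"
      using N by (rule fatou)
    show int: "integrable M (\<lambda>x. (norm (X n x - g x))\<^sup>2)"
    proof (rule integrableI_nonneg)
      show "(\<integral>\<^sup>+x. ennreal ((norm (X n x - g x))\<^sup>2) \<partial>M) < \<infinity>"
        using fin by (rule order_le_less_trans) simp
    qed auto
    have "ennreal (\<integral>x. (norm (X n x - g x))\<^sup>2 \<partial>M) \<le> ennreal e"
      using fin nn_integral_eq_integral[OF int] by simp
    then show "(\<integral>x. (norm (X n x - g x))\<^sup>2 \<partial>M) \<le> e" using e by simp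
  qed
  have "integrable M (\<lambda>x. (norm (g x))\<^sup>2)"
  proof -
    obtain N where "\<And>m n. \<lbrakk>N \<le> m; N \<le> n\<rbrakk> \<Longrightarrow> (\<integral>x. (norm (X m x - X n x))\<^sup>2 \<partial>M) < 1"
      using Cauchy[of 1] by auto
    then have "integrable M (\<lambda>x. (norm (X N x - g x))\<^sup>2)" using int_Xg[of 1 N N] by auto
    then have "integrable M (\<lambda>x. (norm (X N x - (X N x - g x)))\<^sup>2)"
      by (intro int_diff[of "X N" "\<lambda>x. X N x - g x"] int) auto
    then show ?thesis by simp
  qed
  moreover have "(\<lambda>n. \<integral>x. (norm (X n x - g x))\<^sup>2 \<partial>M) \<longlonglongrightarrow> 0"
  proof (rule LIMSEQ_I)
    fix e :: real assume e: "0 < e"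
    obtain N where N: "\<And>m n. \<lbrakk>N \<le> m; N \<le> n\<rbrakk> \<Longrightarrow> (\<integral>x. (norm (X m x - X n x))\<^sup>2 \<partial>M) < e / 2"
      using Cauchy[of "e / 2"] e by auto
    have "norm ((\<integral>x. (norm (X n x - g x))\<^sup>2 \<partial>M) - 0) < e" if "N \<le> n" for n
      using int_Xg[of "e / 2" N n] N[OF that] e by auto
    then show "\<exists>N. \<forall>n\<ge>N. norm ((\<integral>x. (norm (X n x - g x))\<^sup>2 \<partial>M) - 0) < e" by blast
  qed
  ultimately show ?thesis using that g r(1) lim by blast
qed

end

lemma L2_measurable: "f \<in> L2 \<Omega> \<Longrightarrow> f \<in> borel_measurable (lebesgue_on \<Omega>)"
  and L2_integrable: "f \<in> L2 \<Omega> \<Longrightarrow> integrable (lebesgue_on \<Omega>) (\<lambda>x. (norm (f x))\<^sup>2)"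
  by (auto simp: L2_def)

lemma L2_bound:
  fixes f :: "space \<Rightarrow> 'b::euclidean_space"
  assumes "f \<in> borel_measurable (lebesgue_on \<Omega>)" "integrable (lebesgue_on \<Omega>) h"
    and "\<And>x. x \<in> \<Omega> \<Longrightarrow> (norm (f x))\<^sup>2 \<le> h x"
  shows "f \<in> L2 \<Omega>"
proof -
  have "integrable (lebesgue_on \<Omega>) (\<lambda>x. (norm (f x))\<^sup>2)"
  proof (rule Bochner_Integration.integrable_bound[OF assms(2)])
    show "(\<lambda>x. (norm (f x))\<^sup>2) \<in> borel_measurable (lebesgue_on \<Omega>)" using assms(1) by measurable
    show "AE x in lebesgue_on \<Omega>. norm ((norm (f x))\<^sup>2) \<le> norm (h x)"
      using assms(3) by (intro AE_I2) fastforce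
  qed
  then show ?thesis using assms(1) by (simp add: L2_def)
qed

lemma L2_add:
  fixes f g :: "space \<Rightarrow> 'b::euclidean_space"
  assumes "f \<in> L2 \<Omega>" "g \<in> L2 \<Omega>"
  shows "(\<lambda>x. f x + g x) \<in> L2 \<Omega>"
proof (rule L2_bound)
  show "(\<lambda>x. f x + g x) \<in> borel_measurable (lebesgue_on \<Omega>)"
    using assms[THEN L2_measurable] by measurable
  show "integrable (lebesgue_on \<Omega>) (\<lambda>x. 2 * (norm (f x))\<^sup>2 + 2 * (norm (g x))\<^sup>2)"
    using assms[THEN L2_integrable] by simp
qed (rule norm_square_add_le)

lemma L2_mult_bounded:
  fixes f :: "space \<Rightarrow> 'b::euclidean_space"
  assumes "f \<in> L2 \<Omega>" "c \<in> borel_measurable (lebesgue_on \<Omega>)" "\<And>x. x \<in> \<Omega> \<Longrightarrow> \<bar>c x\<bar> \<le> B"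
  shows "(\<lambda>x. c x *\<^sub>R f x) \<in> L2 \<Omega>"
proof (rule L2_bound)
  show "(\<lambda>x. c x *\<^sub>R f x) \<in> borel_measurable (lebesgue_on \<Omega>)"
    using L2_measurable[OF assms(1)] assms(2) by measurable
  show "integrable (lebesgue_on \<Omega>) (\<lambda>x. B\<^sup>2 * (norm (f x))\<^sup>2)"
    using L2_integrable[OF assms(1)] by simp
  show "(norm (c x *\<^sub>R f x))\<^sup>2 \<le> B\<^sup>2 * (norm (f x))\<^sup>2" if "x \<in> \<Omega>" for x
    using power_mono[OF assms(3)[OF that], of 2]
    by (simp add: power_mult_distrib mult_right_mono)
qed

lemma L2_scale: "f \<in> L2 \<Omega> \<Longrightarrow> (\<lambda>x. a *\<^sub>R f x) \<in> L2 \<Omega>"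
  for f :: "space \<Rightarrow> 'b::euclidean_space"
  by (rule L2_mult_bounded[where B = "\<bar>a\<bar>"]) auto

lemma L2_diff: "\<lbrakk>f \<in> L2 \<Omega>; g \<in> L2 \<Omega>\<rbrakk> \<Longrightarrow> (\<lambda>x. f x - g x) \<in> L2 \<Omega>"
  for f g :: "space \<Rightarrow> 'b::euclidean_space"
  using L2_add[of f \<Omega> "\<lambda>x. (-1) *\<^sub>R g x"] L2_scale[of g \<Omega> "-1"] by simp

lemma L2_zero: "(\<lambda>x. 0) \<in> L2 \<Omega>"
  by (simp add: L2_def)

lemma L2_sum:
  fixes f :: "'i \<Rightarrow> space \<Rightarrow> 'b::euclidean_space"
  assumes "\<And>i. i \<in> I \<Longrightarrow> f i \<in> L2 \<Omega>"
  shows "(\<lambda>x. \<Sum>i\<in>I. f i x) \<in> L2 \<Omega>"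
  using assms by (induction I rule: infinite_finite_induct) (auto intro: L2_add L2_zero)

lemma norm_vec_square: "(norm x)\<^sup>2 = (\<Sum>i\<in>UNIV. (norm (x $ i))\<^sup>2)"
  for x :: "'a::real_normed_vector ^ 'n"
  by (simp add: norm_vec_def L2_set_def sum_nonneg)

lemma L2_vec_lambda:
  fixes f :: "'n::finite \<Rightarrow> space \<Rightarrow> 'b::euclidean_space"
  assumes "\<And>i. f i \<in> L2 \<Omega>"
  shows "(\<lambda>x. \<chi> i. f i x) \<in> L2 \<Omega>"
proof (rule L2_bound)
  show "(\<lambda>x. \<chi> i. f i x) \<in> borel_measurable (lebesgue_on \<Omega>)"
    using assms[THEN L2_measurable]
    by (subst borel_measurable_euclidean_space) (auto simp: Basis_vec_def inner_axis)
  show "integrable (lebesgue_on \<Omega>) (\<lambda>x. \<Sum>i\<in>UNIV. (norm (f i x))\<^sup>2)"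
    using assms[THEN L2_integrable] by simp
qed (simp add: norm_vec_square)

lemma borel_measurable_nth:
  fixes f :: "'a \<Rightarrow> 'b::euclidean_space ^ 'n"
  assumes "f \<in> borel_measurable M"
  shows "(\<lambda>x. f x $ i) \<in> borel_measurable M"
  by (rule measurable_compose[OF assms])
    (rule borel_measurable_continuous_onI[OF continuous_on_component[OF continuous_on_id]])

lemma borel_measurable_fst_snd:
  fixes f :: "'a \<Rightarrow> 'b::euclidean_space \<times> 'c::euclidean_space"
  assumes "f \<in> borel_measurable M"
  shows "(\<lambda>x. fst (f x)) \<in> borel_measurable M" "(\<lambda>x. snd (f x)) \<in> borel_measurable M"
  by (rule measurable_compose[OF assms borel_measurable_continuous_onI[OF continuous_on_fst[OF continuous_on_id]]],
      rule measurable_compose[OF assms borel_measurable_continuous_onI[OF continuous_on_snd[OF continuous_on_id]]])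

lemma L2_nth:
  fixes f :: "space \<Rightarrow> 'b::euclidean_space ^ 'n"
  assumes "f \<in> L2 \<Omega>"
  shows "(\<lambda>x. f x $ i) \<in> L2 \<Omega>"
  by (rule L2_bound[OF borel_measurable_nth[OF L2_measurable[OF assms]] L2_integrable[OF assms]])
    (simp add: Finite_Cartesian_Product.norm_nth_le power_mono)

lemma norm_Pair_square: "(norm u)\<^sup>2 = (norm (fst u))\<^sup>2 + (norm (snd u))\<^sup>2"
  for u :: "'b::real_normed_vector \<times> 'c::real_normed_vector"
  by (simp add: norm_prod_def)

lemma L2_Pair_iff:
  fixes f :: "space \<Rightarrow> 'b::euclidean_space \<times> 'c::euclidean_space"
  shows "f \<in> L2 \<Omega> \<longleftrightarrow> (\<lambda>x. fst (f x)) \<in> L2 \<Omega> \<and> (\<lambda>x. snd (f x)) \<in> L2 \<Omega>"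
proof safe
  assume f: "f \<in> L2 \<Omega>"
  note meas = borel_measurable_fst_snd[OF L2_measurable[OF f]]
  show "(\<lambda>x. fst (f x)) \<in> L2 \<Omega>" "(\<lambda>x. snd (f x)) \<in> L2 \<Omega>"
    by (rule L2_bound[OF meas(1) L2_integrable[OF f]], simp add: norm_Pair_square)
      (rule L2_bound[OF meas(2) L2_integrable[OF f]], simp add: norm_Pair_square)
next
  assume f: "(\<lambda>x. fst (f x)) \<in> L2 \<Omega>" "(\<lambda>x. snd (f x)) \<in> L2 \<Omega>"
  show "f \<in> L2 \<Omega>"
  proof (rule L2_bound)
    show "f \<in> borel_measurable (lebesgue_on \<Omega>)"
      using borel_measurable_Pair[OF f[THEN L2_measurable]] by simp
    show "integrable (lebesgue_on \<Omega>) (\<lambda>x. (norm (fst (f x)))\<^sup>2 + (norm (snd (f x)))\<^sup>2)"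
      using f[THEN L2_integrable] by simp
  qed (simp add: norm_Pair_square)
qed

section \<open>The energy space\<close>

text \<open>States are functions of position; with pointwise operations they form a real vector space, in which the
abstract theory applies to the set \<open>Hspace \<Omega>\<close>.\<close>

instantiation "fun" :: (type, scaleR) scaleR
begin

definition "a *\<^sub>R f = (\<lambda>x. a *\<^sub>R f x)"

instance ..

end

instance "fun" :: (type, real_vector) real_vector
  by standard (simp_all add: fun_eq_iff scaleR_fun_def scaleR_add_right scaleR_add_left)

lemma scaleR_fun_apply [simp]: "(a *\<^sub>R f) x = a *\<^sub>R f x"
  by (simp add: scaleR_fun_def)

lemma strain_eq: "strain U = (\<lambda>x. fst (U x))"
  and velocity_eq: "velocity U = (\<lambda>x. snd (U x))"
  by (auto simp: strain_def velocity_def)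

lemma Hspace_iff:
  "U \<in> Hspace \<Omega> \<longleftrightarrow> U \<in> L2 \<Omega> \<and> (AE x in lebesgue_on \<Omega>. transpose (fst (U x)) = fst (U x))"
  by (auto simp: Hspace_def H0_def L2_Pair_iff[of U] strain_eq velocity_eq)

definition energy_density ::
    "real \<Rightarrow> tensor4 \<Rightarrow> (real^3^3) \<times> (real^3) \<Rightarrow> (real^3^3) \<times> (real^3) \<Rightarrow> real" where
  "energy_density \<rho> c u v =
     (\<Sum>i\<in>UNIV. \<Sum>j\<in>UNIV. (\<Sum>k\<in>UNIV. \<Sum>l\<in>UNIV. c i j k l * fst u $ k $ l) * fst v $ i $ j)
     + \<rho> * (\<Sum>i\<in>UNIV. snd u $ i * snd v $ i)"

lemma H_inner_eq: "H_inner \<Omega> \<rho> C U V = (\<integral>x. energy_density \<rho> (C x) (U x) (V x) \<partial>lebesgue_on \<Omega>)"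
  by (simp add: H_inner_def energy_density_def stress_def strain_def velocity_def)

lemma energy_density_add: "energy_density \<rho> c (u + v) w = energy_density \<rho> c u w + energy_density \<rho> c v w"
  by (simp add: energy_density_def distrib_left distrib_right sum.distrib)

lemma energy_density_scale: "energy_density \<rho> c (a *\<^sub>R u) w = a * energy_density \<rho> c u w"
  by (simp add: energy_density_def distrib_left sum_distrib_left sum_distrib_right mult_ac)

lemma sum_swap4:
  "(\<Sum>i\<in>I. \<Sum>j\<in>J. \<Sum>k\<in>K. \<Sum>l\<in>L. f i j k l) = (\<Sum>k\<in>K. \<Sum>l\<in>L. \<Sum>i\<in>I. \<Sum>j\<in>J. f i j k l)"
proof -
  have "(\<Sum>i\<in>I. \<Sum>j\<in>J. \<Sum>k\<in>K. \<Sum>l\<in>L. f i j k l) = (\<Sum>i\<in>I. \<Sum>k\<in>K. \<Sum>j\<in>J. \<Sum>l\<in>L. f i j k l)"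
    by (intro sum.cong refl sum.swap)
  also have "\<dots> = (\<Sum>k\<in>K. \<Sum>i\<in>I. \<Sum>j\<in>J. \<Sum>l\<in>L. f i j k l)" by (rule sum.swap)
  also have "\<dots> = (\<Sum>k\<in>K. \<Sum>i\<in>I. \<Sum>l\<in>L. \<Sum>j\<in>J. f i j k l)" by (intro sum.cong refl sum.swap)
  also have "\<dots> = (\<Sum>k\<in>K. \<Sum>l\<in>L. \<Sum>i\<in>I. \<Sum>j\<in>J. f i j k l)" by (intro sum.cong refl sum.swap)
  finally show ?thesis .
qed

lemma energy_density_commute:
  assumes "\<And>i j k l. c i j k l = c k l i j"
  shows "energy_density \<rho> c u v = energy_density \<rho> c v u"
proof -
  have strain: "(\<Sum>i\<in>UNIV. \<Sum>j\<in>UNIV. \<Sum>k\<in>UNIV. \<Sum>l\<in>UNIV. c i j k l * fst u $ k $ l * fst v $ i $ j)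
      = (\<Sum>k\<in>UNIV. \<Sum>l\<in>UNIV. \<Sum>i\<in>UNIV. \<Sum>j\<in>UNIV. c k l i j * fst v $ i $ j * fst u $ k $ l)"
  proof (rule trans[OF sum_swap4], intro sum.cong refl)
    show "c i j k l * fst u $ k $ l * fst v $ i $ j = c k l i j * fst v $ i $ j * fst u $ k $ l" for i j k l
      using assms[of i j k l] by simp
  qed
  have velocity: "(\<Sum>i\<in>UNIV. snd u $ i * snd v $ i) = (\<Sum>i\<in>UNIV. snd v $ i * snd u $ i)"
    by (intro sum.cong refl mult.commute)
  show ?thesis
    unfolding energy_density_def sum_distrib_right by (simp only: strain velocity)
qed

lemma abs_sum3_le: "(\<And>i. \<bar>f i\<bar> \<le> K) \<Longrightarrow> \<bar>\<Sum>i\<in>(UNIV :: 3 set). f i\<bar> \<le> 3 * (K::real)"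
  using sum_norm_bound[of "UNIV :: 3 set" f K] by simp

lemma component_le:
  fixes u :: "(real^3^3) \<times> (real^3)"
  shows "\<bar>fst u $ i $ j\<bar> \<le> norm u" "\<bar>snd u $ i\<bar> \<le> norm u"
proof -
  have "norm (fst u $ i $ j) \<le> norm (fst u)" by (rule order_trans[OF Finite_Cartesian_Product.norm_nth_le Finite_Cartesian_Product.norm_nth_le])
  then show "\<bar>fst u $ i $ j\<bar> \<le> norm u" using norm_fst_le[of "fst u" "snd u"] by simp
  have "norm (snd u $ i) \<le> norm (snd u)" by (rule Finite_Cartesian_Product.norm_nth_le)
  then show "\<bar>snd u $ i\<bar> \<le> norm u" using norm_snd_le[of "snd u" "fst u"] by simp
qed

lemma energy_density_bound:
  assumes c: "\<And>i j k l. \<bar>c i j k l\<bar> \<le> B" and \<rho>: "0 \<le> \<rho>"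
  shows "\<bar>energy_density \<rho> c u v\<bar> \<le> (81 * B + 3 * \<rho>) * (norm u * norm v)"
proof -
  have B: "0 \<le> B" using c[of 1 1 1 1] by simp
  have 1: "\<bar>c i j k l * fst u $ k $ l\<bar> \<le> B * norm u" for i j k l
    unfolding abs_mult by (rule mult_mono[OF c component_le(1) B abs_ge_zero])
  have 2: "\<bar>\<Sum>k\<in>UNIV. \<Sum>l\<in>UNIV. c i j k l * fst u $ k $ l\<bar> \<le> 3 * (3 * (B * norm u))" for i j
    by (rule abs_sum3_le, rule abs_sum3_le, rule 1)
  have 3: "\<bar>(\<Sum>k\<in>UNIV. \<Sum>l\<in>UNIV. c i j k l * fst u $ k $ l) * fst v $ i $ j\<bar>
      \<le> 3 * (3 * (B * norm u)) * norm v" for i j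
    unfolding abs_mult[of "sum _ _"] by (rule mult_mono[OF 2 component_le(1)]) (use B in auto)
  have 4: "\<bar>\<Sum>i\<in>UNIV. \<Sum>j\<in>UNIV. (\<Sum>k\<in>UNIV. \<Sum>l\<in>UNIV. c i j k l * fst u $ k $ l) * fst v $ i $ j\<bar>
      \<le> 3 * (3 * (3 * (3 * (B * norm u)) * norm v))"
    by (rule abs_sum3_le, rule abs_sum3_le, rule 3)
  have 5: "\<bar>snd u $ i * snd v $ i\<bar> \<le> norm u * norm v" for i
    unfolding abs_mult by (rule mult_mono[OF component_le(2) component_le(2) norm_ge_zero abs_ge_zero])
  have "\<bar>\<Sum>i\<in>UNIV. snd u $ i * snd v $ i\<bar> \<le> 3 * (norm u * norm v)"
    by (rule abs_sum3_le, rule 5)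
  then have 6: "\<bar>\<rho> * (\<Sum>i\<in>UNIV. snd u $ i * snd v $ i)\<bar> \<le> \<rho> * (3 * (norm u * norm v))"
    unfolding abs_mult using \<rho> by (simp add: mult_left_mono)
  have "\<bar>energy_density \<rho> c u v\<bar> \<le> 3 * (3 * (3 * (3 * (B * norm u)) * norm v)) + \<rho> * (3 * (norm u * norm v))"
    unfolding energy_density_def by (rule order_trans[OF abs_triangle_ineq add_mono[OF 4 6]])
  also have "\<dots> = (81 * B + 3 * \<rho>) * (norm u * norm v)" by (simp add: algebra_simps)
  finally show ?thesis .
qed

lemma uniform_bound_finite_index:
  fixes f :: "'i::finite \<Rightarrow> 'a \<Rightarrow> real"
  assumes "\<And>i. \<exists>B. \<forall>x\<in>A. \<bar>f i x\<bar> \<le> B"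
  shows "\<exists>B\<ge>0. \<forall>i. \<forall>x\<in>A. \<bar>f i x\<bar> \<le> B"
proof -
  obtain B where B: "\<And>i x. x \<in> A \<Longrightarrow> \<bar>f i x\<bar> \<le> B i" using assms by metis
  have "\<bar>f i x\<bar> \<le> (\<Sum>i\<in>UNIV. \<bar>B i\<bar>)" if "x \<in> A" for i x
  proof -
    have "\<bar>f i x\<bar> \<le> \<bar>B i\<bar>" using B[OF that, of i] by simp
    also have "\<dots> \<le> (\<Sum>i\<in>UNIV. \<bar>B i\<bar>)" by (rule member_le_sum) auto
    finally show ?thesis .
  qed
  then show ?thesis by (intro exI[of _ "\<Sum>i\<in>UNIV. \<bar>B i\<bar>"]) (simp add: sum_nonneg)
qed

locale elastic_medium =
  fixes \<Omega> :: "space set" and \<rho> :: real and C :: "space \<Rightarrow> tensor4"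
  assumes open_domain: "open \<Omega>" and bounded_domain: "bounded \<Omega>"
    and density_pos: "\<rho> > 0" and elasticity: "elasticity_tensor \<Omega> C"
begin

abbreviation "M \<equiv> lebesgue_on \<Omega>"

lemma domain_lmeasurable: "\<Omega> \<in> lmeasurable"
  using bounded_domain open_domain by (rule lmeasurable_open)

sublocale finite_measure M
  by (rule finite_measure_lebesgue_on[OF domain_lmeasurable])

lemma continuous_coefficient:
  assumes "continuous_on (closure \<Omega>) (c :: space \<Rightarrow> real)"
  shows "c \<in> borel_measurable M" "\<exists>B. \<forall>x\<in>\<Omega>. \<bar>c x\<bar> \<le> B"
proof -
  have "continuous_on \<Omega> c" using assms closure_subset continuous_on_subset by blast
  then show "c \<in> borel_measurable M"
    using domain_lmeasurable by (intro continuous_imp_measurable_on_sets_lebesgue) auto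
  have "bounded (c ` closure \<Omega>)"
    using assms bounded_domain by (intro compact_imp_bounded compact_continuous_image) (simp_all add: compact_closure)
  then obtain B where "\<forall>y\<in>c ` closure \<Omega>. \<bar>y\<bar> \<le> B" by (auto simp: bounded_real)
  then show "\<exists>B. \<forall>x\<in>\<Omega>. \<bar>c x\<bar> \<le> B" using closure_subset[of \<Omega>] by blast
qed

lemma C_continuous: "continuous_on (closure \<Omega>) (\<lambda>x. C x i j k l)"
  using elasticity by (simp add: elasticity_tensor_def)

lemma energy_density_C_bound: "\<exists>K\<ge>0. \<forall>x\<in>\<Omega>. \<forall>u v. \<bar>energy_density \<rho> (C x) u v\<bar> \<le> K * (norm u * norm v)"
proof -
  have "\<exists>B\<ge>0. \<forall>p :: 3 \<times> 3 \<times> 3 \<times> 3. \<forall>x\<in>\<Omega>. \<bar>(case p of (i, j, k, l) \<Rightarrow> C x i j k l)\<bar> \<le> B"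
  proof (rule uniform_bound_finite_index)
    fix p :: "3 \<times> 3 \<times> 3 \<times> 3"
    obtain i j k l where p: "p = (i, j, k, l)" by (cases p)
    show "\<exists>B. \<forall>x\<in>\<Omega>. \<bar>(case p of (i, j, k, l) \<Rightarrow> C x i j k l)\<bar> \<le> B"
      using continuous_coefficient(2)[OF C_continuous] by (simp add: p)
  qed
  then obtain B where "0 \<le> B" "\<And>x i j k l. x \<in> \<Omega> \<Longrightarrow> \<bar>C x i j k l\<bar> \<le> B" by fastforce
  then show ?thesis
    using energy_density_bound density_pos by (intro exI[of _ "81 * B + 3 * \<rho>"]) auto
qed

text \<open>Positivity of the elasticity tensor controls symmetric strains only; the equivalence of the energy with the
\<open>L\<^sup>2\<close> norm on \<open>H\<close> rests on the symmetry of the strains in \<open>H\<close>.\<close>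

lemma energy_density_coercive:
  "\<exists>m>0. \<forall>x\<in>\<Omega>. \<forall>u. transpose (fst u) = fst u \<longrightarrow> m * (norm u)\<^sup>2 \<le> energy_density \<rho> (C x) u u"
proof -
  obtain a where a: "a > 0" "\<And>x e :: real^3^3. \<lbrakk>x \<in> closure \<Omega>; transpose e = e\<rbrakk> \<Longrightarrow>
      (\<Sum>i\<in>UNIV. \<Sum>j\<in>UNIV. \<Sum>k\<in>UNIV. \<Sum>l\<in>UNIV. C x i j k l * e $ i $ j * e $ k $ l)
        \<ge> a * (\<Sum>i\<in>UNIV. \<Sum>j\<in>UNIV. e $ i $ j * e $ i $ j)"
    using elasticity unfolding elasticity_tensor_def by blast
  have "min a \<rho> * (norm u)\<^sup>2 \<le> energy_density \<rho> (C x) u u"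
    if x: "x \<in> \<Omega>" and u: "transpose (fst u) = fst u" for x u
  proof -
    have "min a \<rho> * (norm u)\<^sup>2 \<le> a * (norm (fst u))\<^sup>2 + \<rho> * (norm (snd u))\<^sup>2"
      unfolding norm_Pair_square distrib_left by (intro add_mono mult_right_mono) auto
    also have "a * (norm (fst u))\<^sup>2 = a * (\<Sum>i\<in>UNIV. \<Sum>j\<in>UNIV. fst u $ i $ j * fst u $ i $ j)"
      by (simp only: norm_vec_square real_norm_def power2_abs, simp only: power2_eq_square)
    also have "\<dots> \<le> (\<Sum>i\<in>UNIV. \<Sum>j\<in>UNIV. \<Sum>k\<in>UNIV. \<Sum>l\<in>UNIV. C x i j k l * fst u $ i $ j * fst u $ k $ l)"
      using x closure_subset u by (intro a) auto
    also have "\<dots> = (\<Sum>i\<in>UNIV. \<Sum>j\<in>UNIV. (\<Sum>k\<in>UNIV. \<Sum>l\<in>UNIV. C x i j k l * fst u $ k $ l) * fst u $ i $ j)"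
      unfolding sum_distrib_right by (intro sum.cong refl) (simp only: mult_ac)
    also have "(norm (snd u))\<^sup>2 = (\<Sum>i\<in>UNIV. snd u $ i * snd u $ i)"
      by (simp only: norm_vec_square real_norm_def power2_abs, simp only: power2_eq_square)
    finally show ?thesis by (simp add: energy_density_def)
  qed
  then show ?thesis using a(1) density_pos by (intro exI[of _ "min a \<rho>"]) auto
qed

lemma energy_integrable:
  assumes U: "U \<in> L2 \<Omega>" and V: "V \<in> L2 \<Omega>"
  shows "integrable M (\<lambda>x. energy_density \<rho> (C x) (U x) (V x))"
proof -
  obtain K where K: "0 \<le> K" "\<And>x u v. x \<in> \<Omega> \<Longrightarrow> \<bar>energy_density \<rho> (C x) u v\<bar> \<le> K * (norm u * norm v)"
    using energy_density_C_bound by blast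
  note [measurable] = continuous_coefficient(1)[OF C_continuous]
    borel_measurable_nth[OF borel_measurable_nth[OF borel_measurable_fst_snd(1)[OF L2_measurable[OF U]]]]
    borel_measurable_nth[OF borel_measurable_nth[OF borel_measurable_fst_snd(1)[OF L2_measurable[OF V]]]]
    borel_measurable_nth[OF borel_measurable_fst_snd(2)[OF L2_measurable[OF U]]]
    borel_measurable_nth[OF borel_measurable_fst_snd(2)[OF L2_measurable[OF V]]]
  show ?thesis
  proof (rule Bochner_Integration.integrable_bound)
    show "integrable M (\<lambda>x. K * ((norm (U x))\<^sup>2 + (norm (V x))\<^sup>2))"
      using L2_integrable[OF U] L2_integrable[OF V] by simp
    show "(\<lambda>x. energy_density \<rho> (C x) (U x) (V x)) \<in> borel_measurable M"
      unfolding energy_density_def by measurable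
    show "AE x in M. norm (energy_density \<rho> (C x) (U x) (V x)) \<le> norm (K * ((norm (U x))\<^sup>2 + (norm (V x))\<^sup>2))"
    proof (rule AE_I2)
      fix x assume "x \<in> space M"
      then have "\<bar>energy_density \<rho> (C x) (U x) (V x)\<bar> \<le> K * (norm (U x) * norm (V x))"
        by (intro K(2)) simp
      also have "\<dots> \<le> K * ((norm (U x))\<^sup>2 + (norm (V x))\<^sup>2)"
      proof (rule mult_left_mono[OF _ K(1)])
        have "0 \<le> (norm (U x) - norm (V x))\<^sup>2" by simp
        moreover have "0 \<le> norm (U x) * norm (V x)" by simp
        ultimately show "norm (U x) * norm (V x) \<le> (norm (U x))\<^sup>2 + (norm (V x))\<^sup>2"
          unfolding power2_diff by linarith
      qed
      finally show "norm (energy_density \<rho> (C x) (U x) (V x)) \<le> norm (K * ((norm (U x))\<^sup>2 + (norm (V x))\<^sup>2))"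
        using K(1) by simp
    qed
  qed
qed

lemma H_inner_bounds:
  obtains m K where "0 < m" "0 \<le> K"
    "\<And>U. U \<in> Hspace \<Omega> \<Longrightarrow> m * (\<integral>x. (norm (U x))\<^sup>2 \<partial>M) \<le> H_inner \<Omega> \<rho> C U U"
    "\<And>U. U \<in> Hspace \<Omega> \<Longrightarrow> H_inner \<Omega> \<rho> C U U \<le> K * (\<integral>x. (norm (U x))\<^sup>2 \<partial>M)"
proof -
  obtain m where m: "0 < m"
    "\<And>x u. \<lbrakk>x \<in> \<Omega>; transpose (fst u) = fst u\<rbrakk> \<Longrightarrow> m * (norm u)\<^sup>2 \<le> energy_density \<rho> (C x) u u"
    using energy_density_coercive by blast
  obtain K where K: "0 \<le> K" "\<And>x u v. x \<in> \<Omega> \<Longrightarrow> \<bar>energy_density \<rho> (C x) u v\<bar> \<le> K * (norm u * norm v)"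
    using energy_density_C_bound by blast
  have "m * (\<integral>x. (norm (U x))\<^sup>2 \<partial>M) \<le> H_inner \<Omega> \<rho> C U U \<and>
      H_inner \<Omega> \<rho> C U U \<le> K * (\<integral>x. (norm (U x))\<^sup>2 \<partial>M)" if "U \<in> Hspace \<Omega>" for U
  proof
    have U: "U \<in> L2 \<Omega>" "AE x in M. transpose (fst (U x)) = fst (U x)"
      using that by (auto simp: Hspace_iff)
    have "AE x in M. x \<in> \<Omega>" by (auto intro: AE_I2)
    then have "AE x in M. m * (norm (U x))\<^sup>2 \<le> energy_density \<rho> (C x) (U x) (U x)"
      using U(2) by eventually_elim (rule m(2))
    then have "(\<integral>x. m * (norm (U x))\<^sup>2 \<partial>M) \<le> H_inner \<Omega> \<rho> C U U"
      unfolding H_inner_eq using U(1) by (intro integral_mono_AE energy_integrable) (auto simp: L2_integrable)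
    then show "m * (\<integral>x. (norm (U x))\<^sup>2 \<partial>M) \<le> H_inner \<Omega> \<rho> C U U" by simp
    have "H_inner \<Omega> \<rho> C U U \<le> (\<integral>x. K * (norm (U x))\<^sup>2 \<partial>M)"
      unfolding H_inner_eq
    proof (rule integral_mono)
      show "energy_density \<rho> (C x) (U x) (U x) \<le> K * (norm (U x))\<^sup>2" if "x \<in> space M" for x
        using K(2)[of x "U x" "U x"] that by (auto simp: power2_eq_square)
    qed (use U(1) in \<open>auto intro: energy_integrable simp: L2_integrable\<close>)
    then show "H_inner \<Omega> \<rho> C U U \<le> K * (\<integral>x. (norm (U x))\<^sup>2 \<partial>M)" by simp
  qed
  then show ?thesis using that m(1) K(1) by blast
qed

lemma Hspace_L2: "U \<in> Hspace \<Omega> \<Longrightarrow> U \<in> L2 \<Omega>"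
  by (simp add: Hspace_iff)

lemma transpose_add: "transpose (A + B) = transpose A + transpose B"
  and transpose_scale: "transpose (a *\<^sub>R A) = a *\<^sub>R transpose A" for A B :: "real^3^3"
  by (simp_all add: transpose_def vec_eq_iff)

lemma subspace_Hspace: "subspace (Hspace \<Omega>)"
  unfolding subspace_def
proof (intro conjI ballI allI)
  show "0 \<in> Hspace \<Omega>"
    by (simp add: Hspace_iff zero_fun_def L2_zero transpose_def vec_eq_iff)
next
  fix U V assume "U \<in> Hspace \<Omega>" "V \<in> Hspace \<Omega>"
  then have UV: "U \<in> L2 \<Omega>" "V \<in> L2 \<Omega>" "AE x in M. transpose (fst (U x)) = fst (U x)"
    "AE x in M. transpose (fst (V x)) = fst (V x)" by (auto simp: Hspace_iff)
  have "AE x in M. transpose (fst ((U + V) x)) = fst ((U + V) x)"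
    using UV(3,4) by eventually_elim (simp add: transpose_add)
  then show "U + V \<in> Hspace \<Omega>"
    using L2_add[OF UV(1,2)] by (simp add: Hspace_iff plus_fun_def)
next
  fix a U assume "U \<in> Hspace \<Omega>"
  then have U: "U \<in> L2 \<Omega>" "AE x in M. transpose (fst (U x)) = fst (U x)" by (auto simp: Hspace_iff)
  have "AE x in M. transpose (fst ((a *\<^sub>R U) x)) = fst ((a *\<^sub>R U) x)"
    using U(2) by eventually_elim (simp add: transpose_scale)
  then show "a *\<^sub>R U \<in> Hspace \<Omega>"
    using L2_scale[OF U(1), of a] by (simp add: Hspace_iff scaleR_fun_def)
qed

lemma H_inner_commute: "H_inner \<Omega> \<rho> C U V = H_inner \<Omega> \<rho> C V U"
  unfolding H_inner_eq
proof (rule Bochner_Integration.integral_cong[OF refl])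
  fix x assume "x \<in> space M"
  then have "x \<in> closure \<Omega>" using closure_subset[of \<Omega>] by auto
  then have "C x i j k l = C x k l i j" for i j k l
    using elasticity unfolding elasticity_tensor_def by blast
  then show "energy_density \<rho> (C x) (U x) (V x) = energy_density \<rho> (C x) (V x) (U x)"
    by (rule energy_density_commute)
qed

lemma Hspace_complete:
  assumes X: "\<And>n. X n \<in> Hspace \<Omega>"
    and Cauchy: "\<And>e. 0 < e \<Longrightarrow> \<exists>N. \<forall>m\<ge>N. \<forall>n\<ge>N. H_inner \<Omega> \<rho> C (X m - X n) (X m - X n) < e"
  shows "\<exists>U\<in>Hspace \<Omega>. (\<lambda>n. H_inner \<Omega> \<rho> C (X n - U) (X n - U)) \<longlonglongrightarrow> 0"
proof -
  obtain m K where mK: "0 < m" "0 \<le> K"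
    "\<And>U. U \<in> Hspace \<Omega> \<Longrightarrow> m * (\<integral>x. (norm (U x))\<^sup>2 \<partial>M) \<le> H_inner \<Omega> \<rho> C U U"
    "\<And>U. U \<in> Hspace \<Omega> \<Longrightarrow> H_inner \<Omega> \<rho> C U U \<le> K * (\<integral>x. (norm (U x))\<^sup>2 \<partial>M)"
    using H_inner_bounds by blast
  have diff: "X i - U \<in> Hspace \<Omega>" if "U \<in> Hspace \<Omega>" for i U
    using subspace_diff[OF subspace_Hspace X that] .
  obtain U r where U: "U \<in> borel_measurable M" "integrable M (\<lambda>x. (norm (U x))\<^sup>2)"
    and lim: "(\<lambda>n. \<integral>x. (norm (X n x - U x))\<^sup>2 \<partial>M) \<longlonglongrightarrow> 0"
    and r: "AE x in M. (\<lambda>k. X (r k) x) \<longlonglongrightarrow> U x"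
  proof (rule square_integrable_complete)
    show "X n \<in> borel_measurable M" "integrable M (\<lambda>x. (norm (X n x))\<^sup>2)" for n
      using Hspace_L2[OF X] by (auto simp: L2_measurable L2_integrable)
    show "\<exists>N. \<forall>i\<ge>N. \<forall>j\<ge>N. (\<integral>x. (norm (X i x - X j x))\<^sup>2 \<partial>M) < e" if e: "0 < e" for e
    proof -
      obtain N where N: "\<And>i j. \<lbrakk>N \<le> i; N \<le> j\<rbrakk> \<Longrightarrow> H_inner \<Omega> \<rho> C (X i - X j) (X i - X j) < m * e"
        using Cauchy[of "m * e"] e mK(1) by auto
      have "(\<integral>x. (norm (X i x - X j x))\<^sup>2 \<partial>M) < e" if "N \<le> i" "N \<le> j" for i j
      proof -
        have "m * (\<integral>x. (norm ((X i - X j) x))\<^sup>2 \<partial>M) < m * e"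
          using mK(3)[OF diff[OF X]] N[OF that] by (rule order_le_less_trans)
        then show ?thesis using mK(1) by simp
      qed
      then show ?thesis by blast
    qed
  qed
  have sym: "AE x in M. transpose (fst (U x)) = fst (U x)"
  proof -
    have "AE x in M. \<forall>n. transpose (fst (X n x)) = fst (X n x)"
      using X by (auto simp: AE_all_countable Hspace_iff)
    then show ?thesis
      using r
    proof eventually_elim
      case (elim x)
      have lim: "(\<lambda>k. fst (X (r k) x) $ i $ j) \<longlonglongrightarrow> fst (U x) $ i $ j" for i j
        by (intro tendsto_vec_nth tendsto_fst elim(2))
      have "fst (X (r k) x) $ i $ j = fst (X (r k) x) $ j $ i" for i j k
        using arg_cong[where f="\<lambda>A. A $ j $ i", OF spec[OF elim(1), of "r k"]]
        by (simp add: transpose_def)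
      then have "(\<lambda>k. fst (X (r k) x) $ i $ j) \<longlonglongrightarrow> fst (U x) $ j $ i" for i j
        by (subst \<open>\<And>i j k. fst (X (r k) x) $ i $ j = fst (X (r k) x) $ j $ i\<close>) (rule lim)
      then have "fst (U x) $ i $ j = fst (U x) $ j $ i" for i j
        using LIMSEQ_unique[OF lim[of i j]] by blast
      then show ?case by (simp add: transpose_def vec_eq_iff)
    qed
  qed
  have UH: "U \<in> Hspace \<Omega>" using U sym by (simp add: Hspace_iff L2_def)
  have "(\<lambda>n. H_inner \<Omega> \<rho> C (X n - U) (X n - U)) \<longlonglongrightarrow> 0"
  proof (rule Lim_null_comparison)
    show "\<forall>\<^sub>F n in sequentially. norm (H_inner \<Omega> \<rho> C (X n - U) (X n - U)) \<le> K * (\<integral>x. (norm (X n x - U x))\<^sup>2 \<partial>M)"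
    proof (rule always_eventually, rule allI)
      fix n
      have "0 \<le> m * (\<integral>x. (norm ((X n - U) x))\<^sup>2 \<partial>M)" using mK(1) by simp
      also have "\<dots> \<le> H_inner \<Omega> \<rho> C (X n - U) (X n - U)" by (rule mK(3)[OF diff[OF UH]])
      finally show "norm (H_inner \<Omega> \<rho> C (X n - U) (X n - U)) \<le> K * (\<integral>x. (norm (X n x - U x))\<^sup>2 \<partial>M)"
        using mK(4)[OF diff[OF UH], of n] by simp
    qed
    show "(\<lambda>n. K * (\<integral>x. (norm (X n x - U x))\<^sup>2 \<partial>M)) \<longlonglongrightarrow> 0"
      by (rule tendsto_mult_right_zero[OF lim])
  qed
  then show ?thesis using UH by blast
qed

sublocale energy: semi_hilbert "Hspace \<Omega>" "H_inner \<Omega> \<rho> C"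
proof
  show "subspace (Hspace \<Omega>)" by (rule subspace_Hspace)
next
  fix U V W assume "U \<in> Hspace \<Omega>" "V \<in> Hspace \<Omega>" "W \<in> Hspace \<Omega>"
  then show "H_inner \<Omega> \<rho> C (U + V) W = H_inner \<Omega> \<rho> C U W + H_inner \<Omega> \<rho> C V W"
    by (simp add: H_inner_eq energy_density_add energy_integrable Hspace_L2)
next
  fix U W a
  show "H_inner \<Omega> \<rho> C (a *\<^sub>R U) W = a * H_inner \<Omega> \<rho> C U W"
    by (simp add: H_inner_eq energy_density_scale)
next
  show "H_inner \<Omega> \<rho> C U V = H_inner \<Omega> \<rho> C V U" for U V by (rule H_inner_commute)
next
  fix U assume U: "U \<in> Hspace \<Omega>"
  obtain m K where m: "0 < m" "0 \<le> K"
    "\<And>U. U \<in> Hspace \<Omega> \<Longrightarrow> m * (\<integral>x. (norm (U x))\<^sup>2 \<partial>M) \<le> H_inner \<Omega> \<rho> C U U"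
    "\<And>U. U \<in> Hspace \<Omega> \<Longrightarrow> H_inner \<Omega> \<rho> C U U \<le> K * (\<integral>x. (norm (U x))\<^sup>2 \<partial>M)"
    by (rule H_inner_bounds) (rule that)
  have "0 \<le> m * (\<integral>x. (norm (U x))\<^sup>2 \<partial>M)" using m(1) by simp
  then show "0 \<le> H_inner \<Omega> \<rho> C U U" using m(3)[OF U] by linarith
qed (rule Hspace_complete)

lemma nrm_eq_H_norm: "energy.nrm U = H_norm \<Omega> \<rho> C U"
  by (simp add: energy.nrm_def H_norm_def)

text \<open>Bounded domains have finite volume, so the energy norm controls the \<open>L\<^sup>1\<close> norm, against which bounded test
functions are paired.\<close>

lemma L1_le_nrm:
  obtains c where "0 \<le> c" "\<And>U. U \<in> Hspace \<Omega> \<Longrightarrow> (\<integral>x. norm (U x) \<partial>M) \<le> c * energy.nrm U"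
proof -
  obtain m K where m: "0 < m" "0 \<le> K"
    "\<And>U. U \<in> Hspace \<Omega> \<Longrightarrow> m * (\<integral>x. (norm (U x))\<^sup>2 \<partial>M) \<le> H_inner \<Omega> \<rho> C U U"
    "\<And>U. U \<in> Hspace \<Omega> \<Longrightarrow> H_inner \<Omega> \<rho> C U U \<le> K * (\<integral>x. (norm (U x))\<^sup>2 \<partial>M)"
    by (rule H_inner_bounds) (rule that)
  define c where "c = sqrt (measure M (space M) / m)"
  have "(\<integral>x. norm (U x) \<partial>M) \<le> c * energy.nrm U" if U: "U \<in> Hspace \<Omega>" for U
  proof (rule power2_le_imp_le)
    have "(\<integral>x. norm (U x) \<partial>M)\<^sup>2 \<le> measure M (space M) * (\<integral>x. (norm (U x))\<^sup>2 \<partial>M)"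
      using Hspace_L2[OF U] by (intro integral_norm_le_square) (auto simp: L2_def)
    also have "\<dots> \<le> measure M (space M) * (H_inner \<Omega> \<rho> C U U / m)"
      using m(3)[OF U] m(1) by (intro mult_left_mono) (simp_all add: pos_le_divide_eq mult.commute)
    also have "\<dots> = (c * energy.nrm U)\<^sup>2"
      using m(1) U by (simp add: c_def power_mult_distrib energy.nrm_square)
    finally show "(\<integral>x. norm (U x) \<partial>M)\<^sup>2 \<le> (c * energy.nrm U)\<^sup>2" .
    show "0 \<le> c * energy.nrm U" using U m(1) by (simp add: c_def)
  qed
  then show ?thesis using that[of c] m(1) by (simp add: c_def)
qed

lemma nrm_diff_eq_0_iff:
  assumes U: "U \<in> Hspace \<Omega>" and V: "V \<in> Hspace \<Omega>"
  shows "energy.nrm (U - V) = 0 \<longleftrightarrow> ae_eq \<Omega> U V"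
proof
  have D: "U - V \<in> Hspace \<Omega>" using U V by simp
  assume "energy.nrm (U - V) = 0"
  then have "(\<integral>x. norm ((U - V) x) \<partial>M) \<le> 0"
    using L1_le_nrm D by (metis mult_zero_right)
  then have "(\<integral>x. norm ((U - V) x) \<partial>M) = 0" by (simp add: order_antisym)
  moreover have "integrable M (\<lambda>x. norm ((U - V) x))"
    by (rule integrable_norm_of_square[OF L2_measurable[OF Hspace_L2[OF D]] L2_integrable[OF Hspace_L2[OF D]]])
  ultimately have "AE x in M. norm ((U - V) x) = 0"
    by (subst integral_nonneg_eq_0_iff_AE[symmetric]) auto
  then show "ae_eq \<Omega> U V" by (simp add: ae_eq_def)
next
  assume "ae_eq \<Omega> U V"
  then have "AE x in M. (U - V) x = 0" by (simp add: ae_eq_def)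
  then have "AE x in M. (norm ((U - V) x))\<^sup>2 = 0" by eventually_elim simp
  then have z: "(\<integral>x. (norm ((U - V) x))\<^sup>2 \<partial>M) = 0" by (rule integral_eq_zero_AE)
  obtain m K where m: "0 < m" "0 \<le> K"
    "\<And>U. U \<in> Hspace \<Omega> \<Longrightarrow> m * (\<integral>x. (norm (U x))\<^sup>2 \<partial>M) \<le> H_inner \<Omega> \<rho> C U U"
    "\<And>U. U \<in> Hspace \<Omega> \<Longrightarrow> H_inner \<Omega> \<rho> C U U \<le> K * (\<integral>x. (norm (U x))\<^sup>2 \<partial>M)"
    by (rule H_inner_bounds) (rule that)
  have "H_inner \<Omega> \<rho> C (U - V) (U - V) \<le> 0" using m(4)[of "U - V"] z U V by simp
  then have "H_inner \<Omega> \<rho> C (U - V) (U - V) = 0" using energy.ip_nonneg[of "U - V"] U V by simp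
  then show "energy.nrm (U - V) = 0" by (simp add: energy.nrm_def)
qed

end

section \<open>The operator\<close>

lemma wpd_L2:
  assumes "u \<in> H1_scalar \<Omega>"
  shows "wpd \<Omega> j u \<in> L2 \<Omega>"
proof -
  have "\<exists>g. g \<in> L2 \<Omega> \<and> is_weak_pd \<Omega> j u g" using assms by (auto simp: H1_scalar_def)
  from someI_ex[OF this] show ?thesis by (simp add: wpd_def)
qed

lemma wdiv_L2:
  assumes "\<exists>g\<in>L2 \<Omega>. is_weak_div \<Omega> F g"
  shows "wdiv \<Omega> F \<in> L2 \<Omega>"
proof -
  have "\<exists>g. g \<in> L2 \<Omega> \<and> is_weak_div \<Omega> F g" using assms by blast
  from someI_ex[OF this] show ?thesis by (simp add: wdiv_def)
qed

locale stressed_medium = elastic_medium +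
  fixes \<alpha> :: "space \<Rightarrow> real^3^3"
  assumes \<alpha>_continuous: "continuous_on (closure \<Omega>) \<alpha>"
begin

lemma Btens_continuous: "continuous_on (closure \<Omega>) (\<lambda>x. Btens C \<alpha> x i j k l)"
  unfolding Btens_def
  by (intro continuous_on_sum continuous_on_mult continuous_on_const C_continuous
      continuous_on_component \<alpha>_continuous)

lemma Bsym_continuous: "continuous_on (closure \<Omega>) (\<lambda>x. Bsym C \<alpha> x i j k l)"
  unfolding Bsym_def
  by (intro continuous_on_divide continuous_on_add continuous_on_const Btens_continuous) simp

lemma Bsym_strain_L2:
  assumes "U \<in> Hspace \<Omega>"
  shows "(\<lambda>x. \<Sum>k\<in>UNIV. \<Sum>l\<in>UNIV. Bsym C \<alpha> x i j k l * strain U x $ k $ l) \<in> L2 \<Omega>"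
proof (intro L2_sum)
  fix k l :: 3
  have "strain U \<in> L2 \<Omega>" using assms by (simp add: Hspace_def H0_def)
  then have "(\<lambda>x. strain U x $ k $ l) \<in> L2 \<Omega>" by (intro L2_nth)
  moreover obtain B where "\<forall>x\<in>\<Omega>. \<bar>Bsym C \<alpha> x i j k l\<bar> \<le> B"
    using continuous_coefficient(2)[OF Bsym_continuous] by blast
  ultimately have "(\<lambda>x. Bsym C \<alpha> x i j k l *\<^sub>R strain U x $ k $ l) \<in> L2 \<Omega>"
    using continuous_coefficient(1)[OF Bsym_continuous] by (intro L2_mult_bounded) auto
  then show "(\<lambda>x. Bsym C \<alpha> x i j k l * strain U x $ k $ l) \<in> L2 \<Omega>" by simp
qed

text \<open>The derivatives in \<open>op_A\<close> are chosen among the square integrable weak derivatives, which exist on the domain.\<close>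

lemma op_A_mem:
  assumes U: "U \<in> dom_A \<Omega> \<Gamma> C"
  shows "op_A \<Omega> \<rho> C \<alpha> U \<in> Hspace \<Omega>"
proof -
  have UH: "U \<in> Hspace \<Omega>" and H1: "\<And>i. (\<lambda>x. velocity U x $ i) \<in> H1_scalar \<Omega>"
    and div: "\<And>i. \<exists>g\<in>L2 \<Omega>. is_weak_div \<Omega> (\<lambda>x. stress C (strain U) x $ i) g"
    using U by (auto simp: dom_A_def H1_hat_def H1_def)
  have entry: "(\<lambda>x. (wpd \<Omega> j (\<lambda>y. velocity U y $ i) x + wpd \<Omega> i (\<lambda>y. velocity U y $ j) x) / 2
      - (\<Sum>k\<in>UNIV. \<Sum>l\<in>UNIV. Bsym C \<alpha> x i j k l * strain U x $ k $ l)) \<in> L2 \<Omega>" for i j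
    using L2_diff[OF L2_scale[OF L2_add[OF wpd_L2[OF H1] wpd_L2[OF H1]], of "1/2"] Bsym_strain_L2[OF UH], of j i i j i j]
    by simp
  have strain: "(\<lambda>x. fst (op_A \<Omega> \<rho> C \<alpha> U x)) \<in> L2 \<Omega>"
    unfolding op_A_def fst_conv by (rule L2_vec_lambda, rule L2_vec_lambda, rule entry)
  have "(\<lambda>x. 1 / \<rho> * wdiv \<Omega> (\<lambda>y. stress C (strain U) y $ i) x) \<in> L2 \<Omega>" for i
    using L2_scale[OF wdiv_L2[OF div], of "1 / \<rho>"] by simp
  then have "(\<lambda>x. snd (op_A \<Omega> \<rho> C \<alpha> U x)) \<in> L2 \<Omega>"
    unfolding op_A_def snd_conv by (rule L2_vec_lambda)
  moreover have "transpose (fst (op_A \<Omega> \<rho> C \<alpha> U x)) = fst (op_A \<Omega> \<rho> C \<alpha> U x)" for x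
    by (simp add: op_A_def transpose_def vec_eq_iff Bsym_def add_ac)
  ultimately show ?thesis using strain by (simp add: Hspace_iff L2_Pair_iff)
qed

end

section \<open>Test functions\<close>

lemma pd_eq_0:
  assumes "x \<notin> supp f"
  shows "pd j f x = 0"
proof -
  have "(f has_derivative (\<lambda>_. 0)) (at x)"
  proof (rule has_derivative_transform_within_open)
    show "((\<lambda>_. 0) has_derivative (\<lambda>_. 0)) (at x)" by simp
    show "open (- supp f)" by (simp add: supp_def open_Compl)
    show "x \<in> - supp f" using assms by simp
    show "0 = f y" if "y \<in> - supp f" for y
      using that closure_subset[of "{x. f x \<noteq> 0}"] by (auto simp: supp_def)
  qed
  then show ?thesis unfolding pd_def by (metis frechet_derivative_at)
qed

lemma supp_iter_pd: "supp (iter_pd js f) \<subseteq> supp f"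
proof (induction js)
  case (Cons j js)
  have "supp (pd j g) \<subseteq> supp g" for g
  proof -
    have "{x. pd j g x \<noteq> 0} \<subseteq> supp g" using pd_eq_0 by blast
    then show ?thesis unfolding supp_def by (rule closure_minimal) simp
  qed
  then show ?case using Cons by auto
qed simp

text \<open>Applied to iterated derivatives of test functions, the seminorms in terms of which the continuity of
distributions is expressed.\<close>

definition sup_abs :: "(space \<Rightarrow> real) \<Rightarrow> real" where
  "sup_abs f = (SUP x. \<bar>f x\<bar>)"

lemma iter_pd_test_fun:
  assumes "w \<in> test_fun \<Omega>"
  shows "continuous_on A (iter_pd js w)" "\<bar>iter_pd js w x\<bar> \<le> sup_abs (iter_pd js w)"
    "0 \<le> sup_abs (iter_pd js w)"
proof -
  have diff: "iter_pd js w differentiable (at x)" for x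
    using assms by (simp add: test_fun_def smooth_def)
  then have cont: "continuous_on A (iter_pd js w)" for A
    by (intro continuous_at_imp_continuous_on ballI differentiable_imp_continuous_within)
  show "continuous_on A (iter_pd js w)" by (rule cont)
  have "compact (iter_pd js w ` supp w)"
    using assms cont by (intro compact_continuous_image) (auto simp: test_fun_def)
  then obtain B where B: "\<forall>y\<in>iter_pd js w ` supp w. \<bar>y\<bar> \<le> B"
    using compact_imp_bounded bounded_real by metis
  have "\<bar>iter_pd js w y\<bar> \<le> max B 0" for y
  proof (cases "y \<in> supp w")
    case False
    then have "y \<notin> supp (iter_pd js w)" using supp_iter_pd by blast
    then have "iter_pd js w y = 0"
      using closure_subset[of "{x. iter_pd js w x \<noteq> 0}"] by (auto simp: supp_def)
    then show ?thesis by simp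
  qed (use B in fastforce)
  then have bdd: "bdd_above (range (\<lambda>x. \<bar>iter_pd js w x\<bar>))" by (intro bdd_aboveI2)
  show bound: "\<bar>iter_pd js w x\<bar> \<le> sup_abs (iter_pd js w)" for x
    unfolding sup_abs_def by (rule cSUP_upper[OF UNIV_I bdd])
  show "0 \<le> sup_abs (iter_pd js w)" using bound[of 0] by linarith
qed

lemma
  assumes "w \<in> test_fun \<Omega>"
  shows test_fun_continuous: "continuous_on A w"
    and test_fun_bound: "\<bar>w x\<bar> \<le> sup_abs w"
    and test_fun_pd_continuous: "continuous_on A (pd j w)"
    and test_fun_pd_bound: "\<bar>pd j w x\<bar> \<le> sup_abs (pd j w)"
    and test_fun_sup_nonneg: "0 \<le> sup_abs w" "0 \<le> sup_abs (pd j w)"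
  using iter_pd_test_fun[OF assms, where js = "[]"] iter_pd_test_fun[OF assms, where js = "[j]"] by auto

lemma test_fun_differentiable:
  assumes "w \<in> test_fun \<Omega>"
  shows "w differentiable (at x)"
proof -
  have "iter_pd [] w differentiable (at x)"
    using assms unfolding test_fun_def smooth_def by blast
  then show ?thesis by simp
qed

lemma pd_lincomb:
  assumes "w \<in> test_fun \<Omega>" "z \<in> test_fun \<Omega>"
  shows "pd j (\<lambda>x. a * w x + b * z x) = (\<lambda>x. a * pd j w x + b * pd j z x)"
proof
  fix x
  have w: "(w has_derivative frechet_derivative w (at x)) (at x)"
    and z: "(z has_derivative frechet_derivative z (at x)) (at x)"
    using test_fun_differentiable[OF assms(1)] test_fun_differentiable[OF assms(2)]
    by (simp_all add: frechet_derivative_works)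
  have "((\<lambda>x. a * w x + b * z x) has_derivative
      (\<lambda>h. a * frechet_derivative w (at x) h + b * frechet_derivative z (at x) h)) (at x)"
    using w z by (intro has_derivative_add has_derivative_mult_right)
  then show "pd j (\<lambda>x. a * w x + b * z x) x = a * pd j w x + b * pd j z x"
    unfolding pd_def by (simp add: frechet_derivative_at[symmetric])
qed

section \<open>The rate of rotation\<close>

lemma half_diff_le:
  fixes a b c :: real
  assumes "\<bar>a\<bar> \<le> A" "\<bar>b\<bar> \<le> B" "\<bar>c\<bar> \<le> D"
  shows "\<bar>1 / 2 * (a - b) - c\<bar> \<le> 1 / 2 * (A + B) + D"
  using assms by (auto simp: abs_le_iff field_simps)

text \<open>The skew part of the flux, the term of order zero in the equation for the rotation.\<close>

definition skew_flux :: "(space \<Rightarrow> tensor4) \<Rightarrow> (space \<Rightarrow> real^3^3) \<Rightarrow> state \<Rightarrow> 3 \<Rightarrow> 3 \<Rightarrow> space \<Rightarrow> real" where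
  "skew_flux C \<alpha> U i j x = 1 / 2 * (flux C \<alpha> (strain U) x $ i $ j - flux C \<alpha> (strain U) x $ j $ i)"

lemma spin_rate_eq:
  "spin_rate \<Omega> C \<alpha> U i j w =
     1 / 2 * (distr_of \<Omega> (\<lambda>x. velocity U x $ j) (pd i w) - distr_of \<Omega> (\<lambda>x. velocity U x $ i) (pd j w))
     - distr_of \<Omega> (skew_flux C \<alpha> U i j) w"
  by (simp add: spin_rate_def distr_pd_def skew_flux_def[abs_def])

context stressed_medium
begin

text \<open>The fields that enter the spin rate are pointwise linear in the state with bounded coefficients; this is
the resulting bound.\<close>

definition dominated :: "state \<Rightarrow> (space \<Rightarrow> real) \<Rightarrow> real \<Rightarrow> bool" where
  "dominated U f K \<longleftrightarrow> f \<in> borel_measurable M \<and> (\<forall>x\<in>\<Omega>. \<bar>f x\<bar> \<le> K * norm (U x))"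

lemma integrable_norm_state: "U \<in> Hspace \<Omega> \<Longrightarrow> integrable M (\<lambda>x. norm (U x))"
  using Hspace_L2 by (intro integrable_norm_of_square) (auto simp: L2_def)

lemma velocity_dominated:
  assumes "U \<in> Hspace \<Omega>"
  shows "dominated U (\<lambda>x. velocity U x $ i) 1"
  using borel_measurable_nth[OF borel_measurable_fst_snd(2)[OF L2_measurable[OF Hspace_L2[OF assms]]]]
  by (simp add: dominated_def velocity_def component_le(2))

lemma skew_flux_dominated: "\<exists>K\<ge>0. \<forall>U\<in>Hspace \<Omega>. \<forall>i j. dominated U (skew_flux C \<alpha> U i j) K"
proof -
  have "\<exists>B\<ge>0. \<forall>p :: 3 \<times> 3 \<times> 3 \<times> 3. \<forall>x\<in>\<Omega>. \<bar>(case p of (i, j, k, l) \<Rightarrow> Btens C \<alpha> x i j k l)\<bar> \<le> B"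
  proof (rule uniform_bound_finite_index)
    fix p :: "3 \<times> 3 \<times> 3 \<times> 3"
    obtain i j k l where p: "p = (i, j, k, l)" by (cases p)
    show "\<exists>B. \<forall>x\<in>\<Omega>. \<bar>(case p of (i, j, k, l) \<Rightarrow> Btens C \<alpha> x i j k l)\<bar> \<le> B"
      using continuous_coefficient(2)[OF Btens_continuous] by (simp add: p)
  qed
  then obtain B where B: "0 \<le> B" "\<And>x i j k l. x \<in> \<Omega> \<Longrightarrow> \<bar>Btens C \<alpha> x i j k l\<bar> \<le> B" by fastforce
  have "dominated U (skew_flux C \<alpha> U i j) (9 * B)" if U: "U \<in> Hspace \<Omega>" for U i j
    unfolding dominated_def
  proof (intro conjI ballI)
    note [measurable] = continuous_coefficient(1)[OF Btens_continuous]
      borel_measurable_nth[OF borel_measurable_nth[OF borel_measurable_fst_snd(1)[OF L2_measurable[OF Hspace_L2[OF U]]]]]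
    show "skew_flux C \<alpha> U i j \<in> borel_measurable M"
      unfolding skew_flux_def[abs_def] flux_def strain_def vec_lambda_beta by measurable
    fix x assume x: "x \<in> \<Omega>"
    have 1: "\<bar>Btens C \<alpha> x i j k l * fst (U x) $ k $ l\<bar> \<le> B * norm (U x)" for i j k l
      unfolding abs_mult by (rule mult_mono[OF B(2)[OF x] component_le(1) B(1) abs_ge_zero])
    have "\<bar>flux C \<alpha> (strain U) x $ i $ j\<bar> \<le> 3 * (3 * (B * norm (U x)))" for i j
      unfolding flux_def strain_def vec_lambda_beta by (rule abs_sum3_le, rule abs_sum3_le, rule 1)
    from half_diff_le[OF this[of i j] this[of j i], of 0 0]
    show "\<bar>skew_flux C \<alpha> U i j x\<bar> \<le> 9 * B * norm (U x)"
      by (simp add: skew_flux_def)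
  qed
  then show ?thesis using B(1) by (intro exI[of _ "9 * B"]) simp
qed

lemma continuous_borel_measurable: "continuous_on \<Omega> \<phi> \<Longrightarrow> \<phi> \<in> borel_measurable M" for \<phi> :: "space \<Rightarrow> real"
  using domain_lmeasurable by (intro continuous_imp_measurable_on_sets_lebesgue) auto

lemma integrable_times_bounded:
  fixes f \<phi> :: "space \<Rightarrow> real"
  assumes "integrable M f" "continuous_on \<Omega> \<phi>" "\<And>x. \<bar>\<phi> x\<bar> \<le> b"
  shows "integrable M (\<lambda>x. f x * \<phi> x)" "\<bar>distr_of \<Omega> f \<phi>\<bar> \<le> b * (\<integral>x. \<bar>f x\<bar> \<partial>M)"
proof -
  have le: "\<bar>f x * \<phi> x\<bar> \<le> b * \<bar>f x\<bar>" for x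
    using mult_left_mono[OF assms(3), of "\<bar>f x\<bar>" x] by (simp add: abs_mult mult.commute)
  have m: "(\<lambda>x. f x * \<phi> x) \<in> borel_measurable M"
    using assms(1) continuous_borel_measurable[OF assms(2)] by (intro borel_measurable_times) auto
  show int: "integrable M (\<lambda>x. f x * \<phi> x)"
  proof (rule Bochner_Integration.integrable_bound[OF _ m])
    show "integrable M (\<lambda>x. b * \<bar>f x\<bar>)" using assms(1) by simp
    show "AE x in M. norm (f x * \<phi> x) \<le> norm (b * \<bar>f x\<bar>)"
      using le by (intro AE_I2) (metis abs_ge_self order_trans real_norm_def)
  qed
  have "\<bar>distr_of \<Omega> f \<phi>\<bar> \<le> (\<integral>x. \<bar>f x * \<phi> x\<bar> \<partial>M)"
    unfolding distr_of_def by (rule integral_abs_bound)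
  also have "\<dots> \<le> (\<integral>x. b * \<bar>f x\<bar> \<partial>M)"
    using int assms(1) le by (intro integral_mono) auto
  finally show "\<bar>distr_of \<Omega> f \<phi>\<bar> \<le> b * (\<integral>x. \<bar>f x\<bar> \<partial>M)" by simp
qed

lemma dominated_integrable:
  assumes U: "U \<in> Hspace \<Omega>" and f: "dominated U f K"
  shows "integrable M f" "(\<integral>x. \<bar>f x\<bar> \<partial>M) \<le> K * (\<integral>x. norm (U x) \<partial>M)"
proof -
  show int: "integrable M f"
  proof (rule Bochner_Integration.integrable_bound)
    show "integrable M (\<lambda>x. K * norm (U x))" using integrable_norm_state[OF U] by simp
    show "AE x in M. norm (f x) \<le> norm (K * norm (U x))"
      using f by (intro AE_I2) (fastforce simp: dominated_def intro: order_trans[OF _ abs_ge_self])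
  qed (use f in \<open>simp add: dominated_def\<close>)
  have "(\<integral>x. \<bar>f x\<bar> \<partial>M) \<le> (\<integral>x. K * norm (U x) \<partial>M)"
    using int integrable_norm_state[OF U] f by (intro integral_mono) (auto simp: dominated_def)
  then show "(\<integral>x. \<bar>f x\<bar> \<partial>M) \<le> K * (\<integral>x. norm (U x) \<partial>M)" by simp
qed

lemma spin_rate_bound:
  obtains c where "0 \<le> c" "\<And>U i j w. \<lbrakk>U \<in> Hspace \<Omega>; w \<in> test_fun \<Omega>\<rbrakk> \<Longrightarrow>
    \<bar>spin_rate \<Omega> C \<alpha> U i j w\<bar> \<le> c * (sup_abs w + sup_abs (pd i w) + sup_abs (pd j w)) * energy.nrm U"
proof -
  obtain K where K: "0 \<le> K" "\<And>U i j. U \<in> Hspace \<Omega> \<Longrightarrow> dominated U (skew_flux C \<alpha> U i j) K"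
    using skew_flux_dominated by blast
  obtain c where c: "0 \<le> c" "\<And>U. U \<in> Hspace \<Omega> \<Longrightarrow> (\<integral>x. norm (U x) \<partial>M) \<le> c * energy.nrm U"
    using L1_le_nrm by blast
  have "\<bar>spin_rate \<Omega> C \<alpha> U i j w\<bar> \<le> (1 + K) * c * (sup_abs w + sup_abs (pd i w) + sup_abs (pd j w)) * energy.nrm U"
    if U: "U \<in> Hspace \<Omega>" and w: "w \<in> test_fun \<Omega>" for U i j w
  proof -
    define I where "I = (\<integral>x. norm (U x) \<partial>M)"
    have I: "0 \<le> I" "I \<le> c * energy.nrm U" using c(2)[OF U] by (auto simp: I_def)
    note sups = test_fun_sup_nonneg[OF w]
    have v: "\<bar>distr_of \<Omega> (\<lambda>x. velocity U x $ k) (pd l w)\<bar> \<le> sup_abs (pd l w) * I" for k l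
    proof -
      note dom = dominated_integrable[OF U velocity_dominated[OF U, of k]]
      have "\<bar>distr_of \<Omega> (\<lambda>x. velocity U x $ k) (pd l w)\<bar> \<le> sup_abs (pd l w) * (\<integral>x. \<bar>velocity U x $ k\<bar> \<partial>M)"
        by (rule integrable_times_bounded(2)[OF dom(1) test_fun_pd_continuous[OF w] test_fun_pd_bound[OF w]])
      also have "\<dots> \<le> sup_abs (pd l w) * I"
        using dom(2) sups(2)[of l] by (intro mult_left_mono) (simp_all add: I_def)
      finally show ?thesis .
    qed
    have s: "\<bar>distr_of \<Omega> (skew_flux C \<alpha> U i j) w\<bar> \<le> sup_abs w * (K * I)"
    proof -
      note dom = dominated_integrable[OF U K(2)[OF U, of i j]]
      have "\<bar>distr_of \<Omega> (skew_flux C \<alpha> U i j) w\<bar> \<le> sup_abs w * (\<integral>x. \<bar>skew_flux C \<alpha> U i j x\<bar> \<partial>M)"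
        by (rule integrable_times_bounded(2)[OF dom(1) test_fun_continuous[OF w] test_fun_bound[OF w]])
      also have "\<dots> \<le> sup_abs w * (K * I)"
        using dom(2) sups(1) by (intro mult_left_mono) (simp_all add: I_def)
      finally show ?thesis .
    qed
    have "\<bar>spin_rate \<Omega> C \<alpha> U i j w\<bar> \<le> 1 / 2 * (sup_abs (pd i w) * I + sup_abs (pd j w) * I) + sup_abs w * (K * I)"
      unfolding spin_rate_eq by (rule half_diff_le[OF v v s])
    also have "\<dots> \<le> (1 + K) * (sup_abs w + sup_abs (pd i w) + sup_abs (pd j w)) * I"
    proof -
      have "1 / 2 * (sup_abs (pd i w) + sup_abs (pd j w)) + sup_abs w * K
          \<le> (1 + K) * (sup_abs w + sup_abs (pd i w) + sup_abs (pd j w))"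
        using sups(1) sups(2)[of i] sups(2)[of j]
          mult_nonneg_nonneg[OF K(1) sups(2)[of i]] mult_nonneg_nonneg[OF K(1) sups(2)[of j]]
        by (simp add: distrib_left distrib_right mult.commute)
      from mult_right_mono[OF this I(1)] show ?thesis by (simp add: algebra_simps)
    qed
    also have "\<dots> \<le> (1 + K) * (sup_abs w + sup_abs (pd i w) + sup_abs (pd j w)) * (c * energy.nrm U)"
      using K(1) sups(1) sups(2)[of i] sups(2)[of j] by (intro mult_left_mono I(2)) auto
    finally show ?thesis by (simp add: mult_ac)
  qed
  then show ?thesis using that[of "(1 + K) * c"] K(1) c(1) by simp
qed

lemma distr_of_diff:
  assumes "integrable M f" "integrable M g" "continuous_on \<Omega> \<phi>" "\<And>x. \<bar>\<phi> x\<bar> \<le> b"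
  shows "distr_of \<Omega> (\<lambda>x. f x - g x) \<phi> = distr_of \<Omega> f \<phi> - distr_of \<Omega> g \<phi>"
  using integrable_times_bounded(1)[OF assms(1,3,4)] integrable_times_bounded(1)[OF assms(2,3,4)]
  by (simp add: distr_of_def left_diff_distrib)

lemma distr_of_lincomb:
  assumes "integrable M f" "continuous_on \<Omega> \<phi>" "\<And>x. \<bar>\<phi> x\<bar> \<le> b" "continuous_on \<Omega> \<psi>" "\<And>x. \<bar>\<psi> x\<bar> \<le> d"
  shows "distr_of \<Omega> f (\<lambda>x. a * \<phi> x + b' * \<psi> x) = a * distr_of \<Omega> f \<phi> + b' * distr_of \<Omega> f \<psi>"
proof -
  have "distr_of \<Omega> f (\<lambda>x. a * \<phi> x + b' * \<psi> x) = (\<integral>x. a * (f x * \<phi> x) + b' * (f x * \<psi> x) \<partial>M)"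
    unfolding distr_of_def by (intro Bochner_Integration.integral_cong) (simp_all add: algebra_simps)
  then show ?thesis
    using integrable_times_bounded(1)[OF assms(1,2,3)] integrable_times_bounded(1)[OF assms(1,4,5)]
    by (simp add: distr_of_def)
qed

lemma skew_flux_diff: "skew_flux C \<alpha> (U - V) i j = (\<lambda>x. skew_flux C \<alpha> U i j x - skew_flux C \<alpha> V i j x)"
  by (simp add: fun_eq_iff skew_flux_def flux_def strain_def right_diff_distrib sum_subtractf)

lemma skew_flux_integrable: "U \<in> Hspace \<Omega> \<Longrightarrow> integrable M (skew_flux C \<alpha> U i j)"
  using skew_flux_dominated dominated_integrable(1) by blast

lemma velocity_integrable: "U \<in> Hspace \<Omega> \<Longrightarrow> integrable M (\<lambda>x. velocity U x $ i)"
  using velocity_dominated dominated_integrable(1) by blast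

lemma spin_rate_diff:
  assumes U: "U \<in> Hspace \<Omega>" and V: "V \<in> Hspace \<Omega>" and w: "w \<in> test_fun \<Omega>"
  shows "spin_rate \<Omega> C \<alpha> (U - V) i j w = spin_rate \<Omega> C \<alpha> U i j w - spin_rate \<Omega> C \<alpha> V i j w"
proof -
  have v: "distr_of \<Omega> (\<lambda>x. velocity (U - V) x $ k) (pd l w)
      = distr_of \<Omega> (\<lambda>x. velocity U x $ k) (pd l w) - distr_of \<Omega> (\<lambda>x. velocity V x $ k) (pd l w)" for k l
    using distr_of_diff[OF velocity_integrable[OF U] velocity_integrable[OF V]
        test_fun_pd_continuous[OF w] test_fun_pd_bound[OF w]]
    by (simp add: velocity_def)
  have s: "distr_of \<Omega> (skew_flux C \<alpha> (U - V) i j) w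
      = distr_of \<Omega> (skew_flux C \<alpha> U i j) w - distr_of \<Omega> (skew_flux C \<alpha> V i j) w"
    unfolding skew_flux_diff
    by (rule distr_of_diff[OF skew_flux_integrable[OF U] skew_flux_integrable[OF V]
        test_fun_continuous[OF w] test_fun_bound[OF w]])
  show ?thesis unfolding spin_rate_eq v s by (simp add: field_simps)
qed

lemma spin_rate_lincomb:
  assumes U: "U \<in> Hspace \<Omega>" and w: "w \<in> test_fun \<Omega>" and z: "z \<in> test_fun \<Omega>"
  shows "spin_rate \<Omega> C \<alpha> U i j (\<lambda>x. a * w x + b * z x)
    = a * spin_rate \<Omega> C \<alpha> U i j w + b * spin_rate \<Omega> C \<alpha> U i j z"
proof -
  have v: "distr_of \<Omega> (\<lambda>x. velocity U x $ k) (pd l (\<lambda>x. a * w x + b * z x))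
      = a * distr_of \<Omega> (\<lambda>x. velocity U x $ k) (pd l w) + b * distr_of \<Omega> (\<lambda>x. velocity U x $ k) (pd l z)" for k l
    unfolding pd_lincomb[OF w z]
    by (rule distr_of_lincomb[OF velocity_integrable[OF U] test_fun_pd_continuous[OF w] test_fun_pd_bound[OF w]
        test_fun_pd_continuous[OF z] test_fun_pd_bound[OF z]])
  have s: "distr_of \<Omega> (skew_flux C \<alpha> U i j) (\<lambda>x. a * w x + b * z x)
      = a * distr_of \<Omega> (skew_flux C \<alpha> U i j) w + b * distr_of \<Omega> (skew_flux C \<alpha> U i j) z"
    by (rule distr_of_lincomb[OF skew_flux_integrable[OF U] test_fun_continuous[OF w] test_fun_bound[OF w]
        test_fun_continuous[OF z] test_fun_bound[OF z]])
  show ?thesis unfolding spin_rate_eq v s by (simp add: field_simps)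
qed

lemma spin_rate_continuous:
  assumes u: "energy.strongly_continuous u" and w: "w \<in> test_fun \<Omega>"
  shows "continuous_on {0..} (\<lambda>t. spin_rate \<Omega> C \<alpha> (u t) i j w)"
proof -
  obtain c where c: "0 \<le> c" "\<And>U i j w. \<lbrakk>U \<in> Hspace \<Omega>; w \<in> test_fun \<Omega>\<rbrakk> \<Longrightarrow>
    \<bar>spin_rate \<Omega> C \<alpha> U i j w\<bar> \<le> c * (sup_abs w + sup_abs (pd i w) + sup_abs (pd j w)) * energy.nrm U"
    by (rule spin_rate_bound) (rule that)
  show ?thesis
  proof (rule energy.continuous_on_lipschitz_functional[OF u])
    show "\<bar>spin_rate \<Omega> C \<alpha> U i j w - spin_rate \<Omega> C \<alpha> V i j w\<bar>
        \<le> c * (sup_abs w + sup_abs (pd i w) + sup_abs (pd j w)) * energy.nrm (U - V)"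
      if "U \<in> Hspace \<Omega>" "V \<in> Hspace \<Omega>" for U V
      using c(2)[of "U - V" w i j] that w by (simp add: spin_rate_diff)
  qed
qed

text \<open>The spin rate involves \<open>w\<close> and its first derivatives, so the integral is a distribution of order one: the
bound involves iterated derivatives of length at most one, uniformly in the compact set.\<close>

lemma distribution_on_integrated_rotation:
  assumes u: "energy.strongly_continuous u" and bound: "\<And>s. 0 \<le> s \<Longrightarrow> energy.nrm (u s) \<le> R"
    and t: "0 \<le> t" and \<omega>0: "\<omega>0 \<in> L2 \<Omega>"
  shows "distribution_on \<Omega> (integrated_rotation \<Omega> C \<alpha> \<omega>0 u t i j)"
proof -
  note uH = energy.strongly_continuous_mem[OF u]
  have int: "(\<lambda>s. spin_rate \<Omega> C \<alpha> (u s) i j w) integrable_on {0..t}" if "w \<in> test_fun \<Omega>" for w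
    by (intro integrable_continuous_interval continuous_on_subset[OF spin_rate_continuous[OF u that]]) auto
  have \<omega>_int: "integrable M (\<lambda>x. \<omega>0 x $ i $ j)"
  proof -
    have f: "(\<lambda>x. \<omega>0 x $ i $ j) \<in> L2 \<Omega>" by (intro L2_nth \<omega>0)
    show ?thesis
      using integrable_norm_of_square[OF L2_measurable[OF f] L2_integrable[OF f]] L2_measurable[OF f]
      by (simp add: integrable_abs_iff)
  qed
  obtain c where c: "0 \<le> c" "\<And>U i j w. \<lbrakk>U \<in> Hspace \<Omega>; w \<in> test_fun \<Omega>\<rbrakk> \<Longrightarrow>
    \<bar>spin_rate \<Omega> C \<alpha> U i j w\<bar> \<le> c * (sup_abs w + sup_abs (pd i w) + sup_abs (pd j w)) * energy.nrm U"
    by (rule spin_rate_bound) (rule that)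
  define c0 where "c0 = (\<integral>x. \<bar>\<omega>0 x $ i $ j\<bar> \<partial>M)"
  have R: "0 \<le> R" using bound[of 0] energy.nrm_nonneg[OF uH[of 0]] by simp
  define Q where "Q w = (\<Sum>js\<in>{js :: 3 list. length js \<le> 1}. SUP x. \<bar>iter_pd js w x\<bar>)" for w
  have "\<bar>integrated_rotation \<Omega> C \<alpha> \<omega>0 u t i j w\<bar> \<le> (c0 + t * (3 * c * R)) * Q w"
    if w: "w \<in> test_fun \<Omega>" for w
  proof -
    have fin: "finite {js :: 3 list. length js \<le> 1}"
      using finite_lists_length_le[of "UNIV :: 3 set" 1] by simp
    have mem: "sup_abs (iter_pd js w) \<le> Q w" if "length js \<le> 1" for js
      unfolding Q_def sup_abs_def
      by (rule member_le_sum[of js "{js. length js \<le> 1}" "\<lambda>js. SUP x. \<bar>iter_pd js w x\<bar>"])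
        (use that fin iter_pd_test_fun(3)[OF w] in \<open>auto simp: sup_abs_def\<close>)
    have Q: "sup_abs w \<le> Q w" "sup_abs (pd k w) \<le> Q w" for k
      using mem[of "[]"] mem[of "[k]"] by auto
    have "0 \<le> Q w" using Q(1) test_fun_sup_nonneg(1)[OF w] by linarith
    have c0: "0 \<le> c0" by (simp add: c0_def)
    have 1: "\<bar>distr_of \<Omega> (\<lambda>x. \<omega>0 x $ i $ j) w\<bar> \<le> c0 * Q w"
    proof -
      have "\<bar>distr_of \<Omega> (\<lambda>x. \<omega>0 x $ i $ j) w\<bar> \<le> sup_abs w * c0"
        unfolding c0_def by (rule integrable_times_bounded(2)[OF \<omega>_int test_fun_continuous[OF w] test_fun_bound[OF w]])
      also have "\<dots> \<le> Q w * c0" by (rule mult_right_mono[OF Q(1) c0])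
      finally show ?thesis by (simp add: mult.commute)
    qed
    have "norm (integral {0..t} (\<lambda>s. spin_rate \<Omega> C \<alpha> (u s) i j w)) \<le> (c * (3 * Q w) * R) * (t - 0)"
    proof (rule integral_bound[OF t])
      show "continuous_on {0..t} (\<lambda>s. spin_rate \<Omega> C \<alpha> (u s) i j w)"
        by (rule continuous_on_subset[OF spin_rate_continuous[OF u w]]) auto
      fix s assume "s \<in> {0..t}"
      then have s: "0 \<le> s" by simp
      have "norm (spin_rate \<Omega> C \<alpha> (u s) i j w)
          \<le> c * (sup_abs w + sup_abs (pd i w) + sup_abs (pd j w)) * energy.nrm (u s)"
        using c(2)[OF uH[OF s] w] by simp
      also have "\<dots> \<le> c * (3 * Q w) * R"
        using Q(1) Q(2)[of i] Q(2)[of j] c(1) \<open>0 \<le> Q w\<close> bound[OF s] uH[OF s]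
          test_fun_sup_nonneg[OF w]
        by (intro mult_mono) auto
      finally show "norm (spin_rate \<Omega> C \<alpha> (u s) i j w) \<le> c * (3 * Q w) * R" .
    qed
    then have "\<bar>integral {0..t} (\<lambda>s. spin_rate \<Omega> C \<alpha> (u s) i j w)\<bar> \<le> t * (3 * c * R) * Q w"
      by (simp add: mult_ac)
    then show ?thesis unfolding integrated_rotation_def using 1 by (simp add: distrib_right)
  qed
  then have bounded: "\<exists>c N. \<forall>w\<in>test_fun \<Omega>. supp w \<subseteq> K \<longrightarrow>
      \<bar>integrated_rotation \<Omega> C \<alpha> \<omega>0 u t i j w\<bar> \<le> c * (\<Sum>js\<in>{js. length js \<le> N}. SUP x. \<bar>iter_pd js w x\<bar>)" for K
    unfolding Q_def by blast
  have linear: "integrated_rotation \<Omega> C \<alpha> \<omega>0 u t i j (\<lambda>x. a * w x + b * z x)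
      = a * integrated_rotation \<Omega> C \<alpha> \<omega>0 u t i j w + b * integrated_rotation \<Omega> C \<alpha> \<omega>0 u t i j z"
    if w: "w \<in> test_fun \<Omega>" and z: "z \<in> test_fun \<Omega>" for w z a b
  proof -
    have "integral {0..t} (\<lambda>s. spin_rate \<Omega> C \<alpha> (u s) i j (\<lambda>x. a * w x + b * z x))
        = integral {0..t} (\<lambda>s. a * spin_rate \<Omega> C \<alpha> (u s) i j w + b * spin_rate \<Omega> C \<alpha> (u s) i j z)"
      using uH spin_rate_lincomb[OF _ w z] by (intro integral_cong) auto
    also have "\<dots> = a * integral {0..t} (\<lambda>s. spin_rate \<Omega> C \<alpha> (u s) i j w)
        + b * integral {0..t} (\<lambda>s. spin_rate \<Omega> C \<alpha> (u s) i j z)"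
      using int[OF w] int[OF z] by (simp add: integral_add integrable_on_mult_right)
    moreover have "distr_of \<Omega> (\<lambda>x. \<omega>0 x $ i $ j) (\<lambda>x. a * w x + b * z x)
        = a * distr_of \<Omega> (\<lambda>x. \<omega>0 x $ i $ j) w + b * distr_of \<Omega> (\<lambda>x. \<omega>0 x $ i $ j) z"
      by (rule distr_of_lincomb[OF \<omega>_int test_fun_continuous[OF w] test_fun_bound[OF w]
          test_fun_continuous[OF z] test_fun_bound[OF z]])
    ultimately show ?thesis by (simp add: integrated_rotation_def algebra_simps)
  qed
  show ?thesis unfolding distribution_on_def using bounded linear by blast
qed

lemma integrated_rotation_derivative:
  assumes u: "energy.strongly_continuous u" and w: "w \<in> test_fun \<Omega>" and t: "0 \<le> t"
  shows "((\<lambda>s. integrated_rotation \<Omega> C \<alpha> \<omega>0 u s i j w) has_real_derivative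
      spin_rate \<Omega> C \<alpha> (u t) i j w) (at t within {0..})"
proof -
  have "((\<lambda>s. integral {0..s} (\<lambda>s. spin_rate \<Omega> C \<alpha> (u s) i j w)) has_real_derivative
      spin_rate \<Omega> C \<alpha> (u t) i j w) (at t within {0..t + 1})"
    using t by (intro integral_has_real_derivative continuous_on_subset[OF spin_rate_continuous[OF u w]]) auto
  moreover have "at t within {0..t + 1} = at t within {0..}"
    by (rule at_within_nhd[of _ "{..<t + 1}"]) auto
  ultimately show ?thesis
    unfolding integrated_rotation_def by (auto intro!: derivative_eq_intros)
qed

end

section \<open>Weak solutions\<close>

locale elastic_flow = stressed_medium +
  fixes \<Gamma> :: "space set" and S :: "real \<Rightarrow> state \<Rightarrow> state"
  assumes semigroup: "C0_contraction_semigroup \<Omega> \<rho> C S"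
    and generated: "generated_by_A \<Omega> \<Gamma> \<rho> C \<alpha> S"
begin

sublocale flow: contraction_semigroup "Hspace \<Omega>" "H_inner \<Omega> \<rho> C" S "dom_A \<Omega> \<Gamma> C" "op_A \<Omega> \<rho> C \<alpha>"
proof
  note sg = semigroup[unfolded C0_contraction_semigroup_def]
  show mem: "S t U \<in> Hspace \<Omega>" if "0 \<le> t" "U \<in> Hspace \<Omega>" for t U
    using sg that by blast
  show "energy.nrm (S t (a *\<^sub>R U + b *\<^sub>R V) - (a *\<^sub>R S t U + b *\<^sub>R S t V)) = 0"
    if t: "0 \<le> t" and U: "U \<in> Hspace \<Omega>" and V: "V \<in> Hspace \<Omega>" for t U V a b
  proof -
    have "ae_eq \<Omega> (S t (\<lambda>x. a *\<^sub>R U x + b *\<^sub>R V x)) (\<lambda>x. a *\<^sub>R S t U x + b *\<^sub>R S t V x)"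
      using sg t U V by blast
    then have "ae_eq \<Omega> (S t (a *\<^sub>R U + b *\<^sub>R V)) (a *\<^sub>R S t U + b *\<^sub>R S t V)"
      by (simp add: plus_fun_def scaleR_fun_def)
    then show ?thesis using t U V mem by (subst nrm_diff_eq_0_iff) auto
  qed
  show "energy.nrm (S 0 U - U) = 0" if "U \<in> Hspace \<Omega>" for U
    using sg that mem by (subst nrm_diff_eq_0_iff) auto
  show "energy.nrm (S (s + t) U - S s (S t U)) = 0" if "0 \<le> s" "0 \<le> t" "U \<in> Hspace \<Omega>" for s t U
    using sg that mem by (subst nrm_diff_eq_0_iff) auto
  show "((\<lambda>t. energy.nrm (S t U - U)) \<longlongrightarrow> 0) (at_right 0)" if "U \<in> Hspace \<Omega>" for U
    using sg that by (simp add: nrm_eq_H_norm fun_diff_def)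
  show "energy.nrm (S t U) \<le> energy.nrm U" if "0 \<le> t" "U \<in> Hspace \<Omega>" for t U
    using sg that by (simp add: nrm_eq_H_norm)
  show "dom_A \<Omega> \<Gamma> C \<subseteq> Hspace \<Omega>" by (auto simp: dom_A_def)
  show A: "op_A \<Omega> \<rho> C \<alpha> U \<in> Hspace \<Omega>" if "U \<in> dom_A \<Omega> \<Gamma> C" for U
    by (rule op_A_mem[OF that])
  show "((\<lambda>t. energy.nrm ((1 / t) *\<^sub>R (S t U - U) - F)) \<longlongrightarrow> 0) (at_right 0) \<longleftrightarrow>
      U \<in> dom_A \<Omega> \<Gamma> C \<and> energy.nrm (F - op_A \<Omega> \<rho> C \<alpha> U) = 0"
    if U: "U \<in> Hspace \<Omega>" and F: "F \<in> Hspace \<Omega>" for U F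
  proof -
    have eq: "(1 / t) *\<^sub>R (S t U - U) - F = (\<lambda>x. (1 / t) *\<^sub>R (S t U x - U x) - F x)" for t
      by (simp add: fun_eq_iff)
    have "((\<lambda>t. energy.nrm ((1 / t) *\<^sub>R (S t U - U) - F)) \<longlongrightarrow> 0) (at_right 0) \<longleftrightarrow>
        U \<in> dom_A \<Omega> \<Gamma> C \<and> ae_eq \<Omega> F (op_A \<Omega> \<rho> C \<alpha> U)"
      unfolding eq nrm_eq_H_norm using generated U F unfolding generated_by_A_def by blast
    also have "\<dots> \<longleftrightarrow> U \<in> dom_A \<Omega> \<Gamma> C \<and> energy.nrm (F - op_A \<Omega> \<rho> C \<alpha> U) = 0"
      using nrm_diff_eq_0_iff[OF F A] by blast
    finally show ?thesis .
  qed
qed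

lemma strongly_continuous_iff:
  "energy.strongly_continuous U \<longleftrightarrow> (\<forall>t\<ge>0. U t \<in> Hspace \<Omega>) \<and>
     (\<forall>t\<ge>0. ((\<lambda>s. H_norm \<Omega> \<rho> C (\<lambda>x. U s x - U t x)) \<longlongrightarrow> 0) (at t within {0..}))"
  by (simp add: energy.strongly_continuous_def nrm_eq_H_norm fun_diff_def)

lemma adjoint_pair_iff: "adjoint_pair \<Omega> \<Gamma> \<rho> C \<alpha> W Z \<longleftrightarrow> flow.adjoint_in W Z"
  by (simp add: adjoint_pair_def flow.adjoint_in_def)

lemma adjoint_in_op_A_adj:
  assumes "W \<in> dom_A_adj \<Omega> \<Gamma> \<rho> C \<alpha>"
  shows "flow.adjoint_in W (op_A_adj \<Omega> \<Gamma> \<rho> C \<alpha> W)"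
  using assms someI_ex[of "adjoint_pair \<Omega> \<Gamma> \<rho> C \<alpha> W"]
  by (simp add: dom_A_adj_def op_A_adj_def adjoint_pair_iff)

text \<open>The integrand \<open>\<langle>S(t) U0, A* W\<rangle>\<close> is continuous and bounded, so its integral is Lipschitz, hence absolutely
continuous, and differentiable at every positive time.\<close>

lemma weak_evolution_orbit:
  assumes U0: "U0 \<in> Hspace \<Omega>"
  shows "weak_evolution \<Omega> \<Gamma> \<rho> C \<alpha> U0 (\<lambda>t. S t U0)"
proof -
  have main: "(\<forall>a b. 0 \<le> a \<and> a \<le> b \<longrightarrow> abs_cont_on a b (\<lambda>t. H_inner \<Omega> \<rho> C (S t U0) W)) \<and>
      (AE t in lebesgue_on {0<..}. ((\<lambda>s. H_inner \<Omega> \<rho> C (S s U0) W) has_real_derivative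
         H_inner \<Omega> \<rho> C (S t U0) (op_A_adj \<Omega> \<Gamma> \<rho> C \<alpha> W)) (at t))"
    if W: "W \<in> dom_A_adj \<Omega> \<Gamma> \<rho> C \<alpha>" for W
  proof -
    define Z where "Z = op_A_adj \<Omega> \<Gamma> \<rho> C \<alpha> W"
    have adj: "flow.adjoint_in W Z" unfolding Z_def by (rule adjoint_in_op_A_adj[OF W])
    then have Z: "Z \<in> Hspace \<Omega>" by (simp add: flow.adjoint_in_def)
    define f where "f t = H_inner \<Omega> \<rho> C (S t U0) W" for t
    define g where "g t = H_inner \<Omega> \<rho> C (S t U0) Z" for t
    have f: "f t = H_inner \<Omega> \<rho> C U0 W + integral {0..t} g" if "0 \<le> t" for t
      unfolding f_def g_def by (rule flow.orbit_weak_solution[OF adj U0 that])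
    have g: "continuous_on {p..q} g" if "0 \<le> p" for p q
      unfolding g_def using that by (intro flow.continuous_on_ip_S U0 Z) auto
    define K where "K = energy.nrm U0 * energy.nrm Z"
    have K: "0 \<le> K" using U0 Z by (simp add: K_def)
    have lip: "\<bar>f q - f p\<bar> \<le> K * (q - p)" if "0 \<le> p" "p \<le> q" for p q
    proof -
      have "f q - f p = integral {p..q} g"
        using Henstock_Kurzweil_Integration.integral_combine[of 0 p q g]
          integrable_continuous_interval[OF g[of 0 q]] f[of p] f[of q] that by simp
      moreover have "norm (integral {p..q} g) \<le> K * (q - p)"
      proof (rule integral_bound[OF that(2) g[OF that(1)]])
        fix t assume "t \<in> {p..q}"
        then show "norm (g t) \<le> K"
          using flow.ip_S_bound[OF _ U0 Z, of t] that by (simp add: g_def K_def)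
      qed
      ultimately show ?thesis by simp
    qed
    have "(f has_real_derivative g t) (at t)" if t: "0 < t" for t
    proof -
      have "((\<lambda>s. integral {0..s} g) has_real_derivative g t) (at t within {0..t + 1})"
        using t g[of 0 "t + 1"] by (intro integral_has_real_derivative) auto
      then have "((\<lambda>s. H_inner \<Omega> \<rho> C U0 W + integral {0..s} g) has_real_derivative g t) (at t)"
        using t by (auto simp: at_within_Icc_at intro!: derivative_eq_intros)
      moreover have "\<forall>\<^sub>F s in nhds t. H_inner \<Omega> \<rho> C U0 W + integral {0..s} g = f s"
        using eventually_nhds_in_open[of "{0<..}" t] t by (auto elim!: eventually_mono simp: f)
      ultimately show ?thesis
        by (subst DERIV_cong_ev[OF refl _ refl, symmetric]) auto
    qed
    then have "AE t in lebesgue_on {0<..}. (f has_real_derivative g t) (at t)"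
      by (intro AE_I2) simp
    moreover have "abs_cont_on a b f" if "0 \<le> a" for a b
      using K lip that by (intro abs_cont_on_lipschitz[of K]) auto
    ultimately show ?thesis
      unfolding f_def[abs_def] g_def Z_def by blast
  qed
  have "energy.strongly_continuous (\<lambda>t. S t U0)" by (rule flow.strongly_continuous_S[OF U0])
  moreover have "ae_eq \<Omega> (S 0 U0) U0"
    using nrm_diff_eq_0_iff[of "S 0 U0" U0] flow.S_zero[OF U0] U0 by simp
  ultimately show ?thesis
    unfolding weak_evolution_def using main by (auto simp: strongly_continuous_iff)
qed

lemma weak_evolution_integral:
  assumes U: "weak_evolution \<Omega> \<Gamma> \<rho> C \<alpha> U0 U" and U0: "U0 \<in> Hspace \<Omega>"
    and W: "W \<in> dom_A_adj \<Omega> \<Gamma> \<rho> C \<alpha>" and t: "0 \<le> t"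
  shows "H_inner \<Omega> \<rho> C (U t) W = H_inner \<Omega> \<rho> C U0 W
    + integral {0..t} (\<lambda>s. H_inner \<Omega> \<rho> C (U s) (op_A_adj \<Omega> \<Gamma> \<rho> C \<alpha> W))"
proof -
  let ?f = "\<lambda>s. H_inner \<Omega> \<rho> C (U s) W" and ?g = "\<lambda>s. H_inner \<Omega> \<rho> C (U s) (op_A_adj \<Omega> \<Gamma> \<rho> C \<alpha> W)"
  have WH: "W \<in> Hspace \<Omega>" using adjoint_in_op_A_adj[OF W] by (simp add: flow.adjoint_in_def)
  have ac: "abs_cont_on 0 t ?f"
    and deriv: "AE s in lebesgue_on {0<..}. (?f has_real_derivative ?g s) (at s)"
    using U W t unfolding weak_evolution_def by auto
  have "AE s in lebesgue. s \<in> {0<..} \<longrightarrow> (?f has_real_derivative ?g s) (at s)"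
    using deriv by (subst (asm) AE_restrict_space_iff) auto
  then obtain N where N: "N \<in> null_sets lebesgue"
    "{s. \<not> (s \<in> {0<..} \<longrightarrow> (?f has_real_derivative ?g s) (at s))} \<subseteq> N"
    by (auto simp: eventually_ae_filter)
  have "(?g has_integral ?f t - ?f 0) {0..t}"
  proof (rule abs_cont_on_has_integral[OF ac t])
    show "N \<union> {0} \<in> null_sets lebesgue"
      using N(1) by (intro null_sets.Un) (auto simp: negligible_iff_null_sets[symmetric])
    show "(?f has_real_derivative ?g s) (at s)" if "s \<in> {0..t} - (N \<union> {0})" for s
    proof -
      have "s \<notin> {s. \<not> (s \<in> {0<..} \<longrightarrow> (?f has_real_derivative ?g s) (at s))}"
        using N(2) that by blast
      moreover have "s \<in> {0<..}" using that by auto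
      ultimately show ?thesis by blast
    qed
  qed
  then have "?f t = ?f 0 + integral {0..t} ?g" by (simp add: integral_unique)
  moreover have "?f 0 = H_inner \<Omega> \<rho> C U0 W"
  proof -
    have "U 0 \<in> Hspace \<Omega>" "ae_eq \<Omega> (U 0) U0" using U by (auto simp: weak_evolution_def)
    then show ?thesis using nrm_diff_eq_0_iff[of "U 0" U0] U0 WH by (intro energy.ip_zero_cong) auto
  qed
  ultimately show ?thesis by simp
qed

theorem weak_evolution_unique:
  assumes U: "weak_evolution \<Omega> \<Gamma> \<rho> C \<alpha> U0 U" and U0: "U0 \<in> Hspace \<Omega>" and t: "0 \<le> t"
  shows "ae_eq \<Omega> (U t) (S t U0)"
proof -
  have sc: "energy.strongly_continuous U"
    using U by (simp add: weak_evolution_def strongly_continuous_iff)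
  have sS: "energy.strongly_continuous (\<lambda>t. S t U0)" by (rule flow.strongly_continuous_S[OF U0])
  note UH = energy.strongly_continuous_mem[OF sc]
  define v where "v s = U s - S s U0" for s
  have "energy.nrm (v t) = 0"
  proof (rule flow.weak_solution_zero[OF _ _ t])
    show "energy.strongly_continuous v"
      unfolding v_def by (rule energy.strongly_continuous_diff[OF sc sS])
  next
    fix W Z assume "flow.adjoint_in W Z"
    then have W: "W \<in> dom_A_adj \<Omega> \<Gamma> \<rho> C \<alpha>" by (auto simp: dom_A_adj_def adjoint_pair_iff)
    define Z' where "Z' = op_A_adj \<Omega> \<Gamma> \<rho> C \<alpha> W"
    have adj: "flow.adjoint_in W Z'" unfolding Z'_def by (rule adjoint_in_op_A_adj[OF W])
    then have H: "W \<in> Hspace \<Omega>" "Z' \<in> Hspace \<Omega>" by (auto simp: flow.adjoint_in_def)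
    have "H_inner \<Omega> \<rho> C (v s) W = integral {0..s} (\<lambda>r. H_inner \<Omega> \<rho> C (v r) Z')" if s: "0 \<le> s" for s
    proof -
      have int: "(\<lambda>r. H_inner \<Omega> \<rho> C (u r) Z') integrable_on {0..s}"
        if "energy.strongly_continuous u" for u
        by (intro integrable_continuous_interval continuous_on_subset[OF energy.continuous_on_ip[OF that H(2)]]) auto
      have "integral {0..s} (\<lambda>r. H_inner \<Omega> \<rho> C (v r) Z')
          = integral {0..s} (\<lambda>r. H_inner \<Omega> \<rho> C (U r) Z' - H_inner \<Omega> \<rho> C (S r U0) Z')"
        using UH U0 H by (intro integral_cong) (simp add: v_def energy.ip_diff_left)
      also have "\<dots> = integral {0..s} (\<lambda>r. H_inner \<Omega> \<rho> C (U r) Z') - integral {0..s} (\<lambda>r. H_inner \<Omega> \<rho> C (S r U0) Z')"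
        by (rule integral_diff[OF int[OF sc] int[OF sS]])
      also have "\<dots> = H_inner \<Omega> \<rho> C (U s) W - H_inner \<Omega> \<rho> C (S s U0) W"
        using weak_evolution_integral[OF U U0 W s] flow.orbit_weak_solution[OF adj U0 s]
        by (simp add: Z'_def)
      also have "\<dots> = H_inner \<Omega> \<rho> C (v s) W"
        using UH[OF s] U0 H s by (simp add: v_def energy.ip_diff_left)
      finally show ?thesis by simp
    qed
    then show "\<exists>Z'. flow.adjoint_in W Z' \<and>
        (\<forall>s\<ge>0. H_inner \<Omega> \<rho> C (v s) W = integral {0..s} (\<lambda>r. H_inner \<Omega> \<rho> C (v r) Z'))"
      using adj by blast
  qed
  then show ?thesis using nrm_diff_eq_0_iff[OF UH[OF t], of "S t U0"] U0 t by (simp add: v_def)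
qed

lemma weak_solution_orbit:
  assumes U0: "U0 \<in> Hspace \<Omega>" and \<omega>0: "\<omega>0 \<in> L2 \<Omega>"
  shows "weak_solution \<Omega> \<Gamma> \<rho> C \<alpha> U0 \<omega>0 (\<lambda>t. S t U0) (integrated_rotation \<Omega> C \<alpha> \<omega>0 (\<lambda>t. S t U0))"
proof -
  have sS: "energy.strongly_continuous (\<lambda>t. S t U0)" by (rule flow.strongly_continuous_S[OF U0])
  have "distribution_on \<Omega> (integrated_rotation \<Omega> C \<alpha> \<omega>0 (\<lambda>t. S t U0) t i j)" if "0 \<le> t" for t i j
    using flow.S_contraction U0 that \<omega>0
    by (intro distribution_on_integrated_rotation[OF sS, where R = "energy.nrm U0"]) auto
  moreover have "\<exists>D. continuous_on {0..} D \<and> (\<forall>t\<ge>0. ((\<lambda>s. integrated_rotation \<Omega> C \<alpha> \<omega>0 (\<lambda>t. S t U0) s i j w)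
      has_real_derivative D t) (at t within {0..}) \<and> D t = spin_rate \<Omega> C \<alpha> (S t U0) i j w)"
    if w: "w \<in> test_fun \<Omega>" for i j w
    using spin_rate_continuous[OF sS w] integrated_rotation_derivative[OF sS w] by blast
  moreover have "integrated_rotation \<Omega> C \<alpha> \<omega>0 (\<lambda>t. S t U0) 0 i j w = distr_of \<Omega> (\<lambda>x. \<omega>0 x $ i $ j) w" for i j w
    by (simp add: integrated_rotation_def)
  ultimately show ?thesis
    unfolding weak_solution_def using weak_evolution_orbit[OF U0] by blast
qed

text \<open>The spin rate depends on the state only through its class, so both rotations have the same time derivative
against every test function.\<close>

lemma weak_solution_unique:
  assumes sol: "weak_solution \<Omega> \<Gamma> \<rho> C \<alpha> U0 \<omega>0 U \<omega>" and U0: "U0 \<in> Hspace \<Omega>" and t: "0 \<le> t"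
  shows "ae_eq \<Omega> (U t) (S t U0)"
    and "w \<in> test_fun \<Omega> \<Longrightarrow> \<omega> t i j w = integrated_rotation \<Omega> C \<alpha> \<omega>0 (\<lambda>t. S t U0) t i j w"
proof -
  have U: "weak_evolution \<Omega> \<Gamma> \<rho> C \<alpha> U0 U" using sol by (simp add: weak_solution_def)
  note eq = weak_evolution_unique[OF U U0]
  show "ae_eq \<Omega> (U t) (S t U0)" by (rule eq[OF t])
  assume w: "w \<in> test_fun \<Omega>"
  have sS: "energy.strongly_continuous (\<lambda>t. S t U0)" by (rule flow.strongly_continuous_S[OF U0])
  have spin: "spin_rate \<Omega> C \<alpha> (U s) i j w = spin_rate \<Omega> C \<alpha> (S s U0) i j w" if s: "0 \<le> s" for s
  proof -
    have H: "U s \<in> Hspace \<Omega>" "S s U0 \<in> Hspace \<Omega>"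
      using U U0 s by (auto simp: weak_evolution_def)
    obtain c where "0 \<le> c" "\<And>U i j w. \<lbrakk>U \<in> Hspace \<Omega>; w \<in> test_fun \<Omega>\<rbrakk> \<Longrightarrow>
      \<bar>spin_rate \<Omega> C \<alpha> U i j w\<bar> \<le> c * (sup_abs w + sup_abs (pd i w) + sup_abs (pd j w)) * energy.nrm U"
      by (rule spin_rate_bound) (rule that)
    from this(2)[of "U s - S s U0" w i j] show ?thesis
      using nrm_diff_eq_0_iff[OF H] eq[OF s] H w by (simp add: spin_rate_diff)
  qed
  let ?d = "\<lambda>s. \<omega> s i j w - integrated_rotation \<Omega> C \<alpha> \<omega>0 (\<lambda>t. S t U0) s i j w"
  obtain D where D: "\<And>s. 0 \<le> s \<Longrightarrow> ((\<lambda>s. \<omega> s i j w) has_real_derivative D s) (at s within {0..})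
      \<and> D s = spin_rate \<Omega> C \<alpha> (U s) i j w"
  proof -
    have "\<exists>D. continuous_on {0..} D \<and> (\<forall>s\<ge>0. ((\<lambda>s. \<omega> s i j w) has_real_derivative D s) (at s within {0..})
        \<and> D s = spin_rate \<Omega> C \<alpha> (U s) i j w)"
      using sol w unfolding weak_solution_def by blast
    then show ?thesis using that by blast
  qed
  have "(?d has_field_derivative 0) (at s within {0..})" if "s \<in> {0..}" for s
  proof -
    have "((\<lambda>s. \<omega> s i j w) has_real_derivative spin_rate \<Omega> C \<alpha> (S s U0) i j w) (at s within {0..})"
      using D[of s] spin[of s] that by auto
    moreover have "((\<lambda>s. integrated_rotation \<Omega> C \<alpha> \<omega>0 (\<lambda>t. S t U0) s i j w) has_real_derivative
        spin_rate \<Omega> C \<alpha> (S s U0) i j w) (at s within {0..})"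
      using that by (intro integrated_rotation_derivative[OF sS w]) simp
    ultimately have "(?d has_real_derivative
        spin_rate \<Omega> C \<alpha> (S s U0) i j w - spin_rate \<Omega> C \<alpha> (S s U0) i j w) (at s within {0..})"
      by (rule DERIV_diff)
    then show ?thesis by simp
  qed
  then obtain c where c: "\<And>s. s \<in> {0..} \<Longrightarrow> ?d s = c"
    using has_field_derivative_zero_constant[of "{0::real..}" ?d] by auto
  have "?d 0 = 0" using sol w by (simp add: weak_solution_def integrated_rotation_def)
  then have "?d t = 0" using c[of 0] c[of t] t by simp
  then show "\<omega> t i j w = integrated_rotation \<Omega> C \<alpha> \<omega>0 (\<lambda>t. S t U0) t i j w" by simp
qed

end

theorem corollary3p1p1:
  fixes \<Omega> \<Gamma>1 \<Gamma>2 :: "space set"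
    and \<rho> :: real
    and C :: "space \<Rightarrow> tensor4"
    and \<alpha> \<omega>0 :: "space \<Rightarrow> real^3^3"
    and S :: "real \<Rightarrow> state \<Rightarrow> state"
    and U0 :: state
  assumes "open \<Omega>" and "bounded \<Omega>" and "connected \<Omega>" and "C1_boundary \<Omega>"
    and "\<Gamma>1 \<in> sets (surface_measure \<Omega>)" and "\<Gamma>2 \<in> sets (surface_measure \<Omega>)"
    and "\<Gamma>1 \<inter> \<Gamma>2 = {}" and "frontier \<Omega> - (\<Gamma>1 \<union> \<Gamma>2) \<in> null_sets (surface_measure \<Omega>)"
    and "\<rho> > 0"
    and "elasticity_tensor \<Omega> C"
    and "continuous_on (closure \<Omega>) \<alpha>" and "stress_free_base \<Omega> \<alpha>"
    and "C0_contraction_semigroup \<Omega> \<rho> C S" and "generated_by_A \<Omega> \<Gamma>1 \<rho> C \<alpha> S"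
    and "U0 \<in> Hspace \<Omega>"
    and "\<omega>0 \<in> L2 \<Omega>" and "AE x in lebesgue_on \<Omega>. transpose (\<omega>0 x) = - \<omega>0 x"
  shows "weak_solution \<Omega> \<Gamma>1 \<rho> C \<alpha> U0 \<omega>0
           (\<lambda>t. S t U0) (integrated_rotation \<Omega> C \<alpha> \<omega>0 (\<lambda>t. S t U0)) \<and>
         (\<forall>U \<omega>. weak_solution \<Omega> \<Gamma>1 \<rho> C \<alpha> U0 \<omega>0 U \<omega> \<longrightarrow>
            (\<forall>t\<ge>0. ae_eq \<Omega> (U t) (S t U0) \<and>
               (\<forall>i j. \<forall>w\<in>test_fun \<Omega>.
                  \<omega> t i j w = integrated_rotation \<Omega> C \<alpha> \<omega>0 (\<lambda>t. S t U0) t i j w)))"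
proof -
  interpret elastic_flow \<Omega> \<rho> C \<alpha> \<Gamma>1 S
    by unfold_locales (use assms in auto)
  show ?thesis
    using weak_solution_orbit weak_solution_unique \<open>U0 \<in> Hspace \<Omega>\<close> \<open>\<omega>0 \<in> L2 \<Omega>\<close> by blast
qed

end
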